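(* Let $E$ be a complex Banach space whose topological dual $E'$ is separable, and let $\Theta=(\mathcal{P}_{\Theta}(^{m}E))_{m=0}^{\infty}$ be a $\pi_1$-holomorphy type from $E$ to $\mathbb{C}$. Then every convolution operator on $\mathcal{H}_{\Theta b}(E)$ which is not a scalar multiple of the identity is hypercyclic.
   Context: Notation. $E'$ carries its norm topology. $\mathcal{P}(^{m}E)$ is the Banach space of continuous $m$-homogeneous polynomials $E\to\mathbb{C}$ with the sup norm on the unit ball ($\mathcal{P}(^0E)=\mathbb{C}$), and $\mathcal{P}_f(^mE)$ (polynomials of finite type) is the linear span of $\{\phi^m:\phi\in E'\}$ (with $\mathcal{P}_f(^0E)=\mathbb{C}$). $\mathcal{H}(E)$ is the space of entire functions $E\to\mathbb{C}$. For $f\in\mathcal{H}(E)$ and $a\in E$, $\frac{1}{m!}\hat d^m f(a)$ denotes the $m$-homogeneous polynomial which is the degree-$m$ term of the Taylor expansion of $f$ at $a$, i.e. $f(a+x)=\sum_m \frac{1}{m!}\hat d^m f(a)(x)$. Holomorphy type. A holomorphy type $\Theta$ from $E$ to $\mathbb{C}$ is a sequence of Banach spaces $(\mathcal{P}_\Theta(^mE))_{m=0}^\infty$, each with norm denoted $\|\cdot\|_\Theta$, such that: (1) each $\mathcal{P}_\Theta(^mE)$ is a linear subspace of $\mathcal{P}(^mE)$; (2) $\mathcal{P}_\Theta(^0E)=\mathbb{C}$ as a normed space; (3) there is $\sigma\ge 1$ such that for all $0\le k\le m$, $a\in E$ and $P\in\mathcal{P}_\Theta(^mE)$, one has $\hat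 d^kP(a)\in\mathcal{P}_\Theta(^kE)$ and $\|\frac{1}{k!}\hat d^kP(a)\|_\Theta\le\sigma^m\|P\|_\Theta\|a\|^{m-k}$. $\pi_1$-holomorphy type. $\Theta$ is a $\pi_1$-holomorphy type if (a1) $\mathcal{P}_f(^mE)\subseteq\mathcal{P}_\Theta(^mE)$ for all $m$, and there is $K>0$ with $\|\phi^m\cdot b\|_\Theta\le K^m\|\phi\|^m|b|$ for all $\phi\in E'$, $b\in\mathbb{C}$, $m\in\mathbb{N}=\{1,2,\dots\}$; (a2) for each $m\ge 0$, $\mathcal{P}_f(^mE)$ is dense in $(\mathcal{P}_\Theta(^mE),\|\cdot\|_\Theta)$. The space $\mathcal{H}_{\Theta b}(E)$. It is the space of all $f\in\mathcal{H}(E)$ such that $\frac{1}{m!}\hat d^mf(0)\in\mathcal{P}_\Theta(^mE)$ for all $m\ge 0$ and $\lim_{m\to\infty}(\frac{1}{m!}\|\hat d^mf(0)\|_\Theta)^{1/m}=0$. It is endowed with the locally convex topology generated by the seminorms $\|f\|_{\Theta,\rho}=\sum_{m=0}^\infty\frac{\rho^m}{m!}\|\hat d^mf(0)\|_\Theta$, $\rho>0$; it is a Fréchet space. Convolution operators. For $a\in E$ and $f\in\mathcal{H}_{\Theta b}(E)$, $(\tau_af)(x)=f(x-a)$; one has $\tau_af\in\mathcal{H}_{\Theta b}(E)$. A convolution operator on $\mathcal{H}_{\Theta b}(E)$ is a continuous linear operator $L:\mathcal{H}_{\Theta b}(E)\to\mathcal{H}_{\Theta b}(E)$ with $L(\tau_af)=\tau_a(L(f))$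 for all $a\in E$, $f\in\mathcal{H}_{\Theta b}(E)$. Hypercyclicity. A map $T:X\to X$ on a topological space is hypercyclic if for some $x\in X$ the orbit $\{x,T(x),T^2(x),\dots\}$ is dense in $X$. *)

theory Defs
  imports "HOL-Analysis.Analysis" "HOL-Library.Function_Algebras"
begin

section \<open>Complex Banach spaces\<close>

class complex_normed_vector = real_normed_vector +
  fixes scaleC :: "complex \<Rightarrow> 'a \<Rightarrow> 'a"  (infixr \<open>*\<^sub>C\<close> 75)
  assumes scaleC_add_right: "c *\<^sub>C (x + y) = c *\<^sub>C x + c *\<^sub>C y"
    and scaleC_add_left: "(c + d) *\<^sub>C x = c *\<^sub>C x + d *\<^sub>C x"
    and scaleC_scaleC: "c *\<^sub>C (d *\<^sub>C x) = (c * d) *\<^sub>C x"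
    and scaleC_of_real: "complex_of_real r *\<^sub>C x = r *\<^sub>R x"
    and norm_scaleC: "norm (c *\<^sub>C x) = cmod c * norm x"

class complex_banach = complex_normed_vector + banach

instantiation complex :: complex_banach
begin

definition scaleC_complex :: "complex \<Rightarrow> complex \<Rightarrow> complex"
  where "scaleC_complex = (*)"

instance
  by standard
    (simp_all add: scaleC_complex_def algebra_simps norm_mult scaleR_conv_of_real)

end

interpretation cvec: vector_space "scaleC :: complex \<Rightarrow> 'a \<Rightarrow> 'a::complex_normed_vector"
proof
  fix x :: 'a
  show "1 *\<^sub>C x = x"
    using scaleC_of_real[of 1 x] by simp
qed (simp_all add: scaleC_add_right scaleC_add_left scaleC_scaleC)

text \<open>Scalar-valued functions form a complex vector space under the pointwise operations of
  \<^theory>\<open>HOL-Library.Function_Algebras\<close>; all function spaces below are subspaces of it.\<close>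

definition fscale :: "complex \<Rightarrow> ('a \<Rightarrow> complex) \<Rightarrow> 'a \<Rightarrow> complex"
  where "fscale c f = (\<lambda>x. c * f x)"

interpretation cfun: vector_space "fscale :: complex \<Rightarrow> ('a \<Rightarrow> complex) \<Rightarrow> 'a \<Rightarrow> complex"
  by standard (simp_all add: fscale_def fun_eq_iff algebra_simps)

text \<open>The type \<open>'a \<Rightarrow>\<^sub>L complex\<close> consists of the bounded \<^emph>\<open>real\<close>-linear maps with the operator norm;
  the dual is its subset of complex-linear maps, with the induced norm.\<close>

definition cdual :: "('a::complex_normed_vector \<Rightarrow>\<^sub>L complex) set"
  where "cdual = {\<phi>. Vector_Spaces.linear (*\<^sub>C) (*) (blinfun_apply \<phi>)}"

section \<open>Homogeneous polynomials\<close>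

text \<open>An \<open>m\<close>-linear form on \<open>'a\<close> is a function of sequences that depends only on the
  coordinates below \<open>m\<close> and is complex-linear in each of these.\<close>

definition multilinear_form ::
    "nat \<Rightarrow> ((nat \<Rightarrow> 'a::complex_normed_vector) \<Rightarrow> complex) \<Rightarrow> bool"
  where "multilinear_form m A \<longleftrightarrow>
    (\<forall>x y. (\<forall>i<m. x i = y i) \<longrightarrow> A x = A y) \<and>
    (\<forall>i<m. \<forall>x. Vector_Spaces.linear (*\<^sub>C) (*) (\<lambda>v. A (x(i := v))))"

definition cpoly :: "nat \<Rightarrow> ('a::complex_normed_vector \<Rightarrow> complex) set"
  where "cpoly m =
    {P. (\<exists>A. multilinear_form m A \<and> P = (\<lambda>x. A (\<lambda>_. x))) \<and> continuous_on UNIV P}"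

definition cpoly_finite_type :: "nat \<Rightarrow> ('a::complex_normed_vector \<Rightarrow> complex) set"
  where "cpoly_finite_type m = cfun.span {(\<lambda>x. blinfun_apply \<phi> x ^ m) | \<phi>. \<phi> \<in> cdual}"

section \<open>Entire functions and Taylor expansions\<close>

definition taylor_series_at ::
    "('a::complex_normed_vector \<Rightarrow> complex) \<Rightarrow> 'a \<Rightarrow> (nat \<Rightarrow> 'a \<Rightarrow> complex) \<Rightarrow> bool"
  where "taylor_series_at f a P \<longleftrightarrow>
    (\<forall>m. P m \<in> cpoly m) \<and>
    (\<exists>r>0. uniform_limit (ball 0 r) (\<lambda>n x. \<Sum>m<n. P m x) (\<lambda>x. f (a + x)) sequentially)"

definition entire :: "('a::complex_normed_vector \<Rightarrow> complex) set"
  where "entire = {f. \<forall>a. \<exists>P. taylor_series_at f a P}"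

text \<open>\<open>dhat m f a\<close> is \<open>m!\<close> times the degree-\<open>m\<close> term of the Taylor series of \<open>f\<close> at \<open>a\<close>.
  The series is unique by \<open>taylor_series_at_unique\<close> below.\<close>

definition dhat ::
    "nat \<Rightarrow> ('a::complex_normed_vector \<Rightarrow> complex) \<Rightarrow> 'a \<Rightarrow> 'a \<Rightarrow> complex"
  where "dhat m f a = fscale (fact m) ((THE P. taylor_series_at f a P) m)"

lemma multilinear_form_scale_prefix:
  assumes A: "multilinear_form m A" and "k \<le> m"
  shows "A (\<lambda>i. if i < k then c *\<^sub>C x else x) = c ^ k * A (\<lambda>_. x)"
  using \<open>k \<le> m\<close>
proof (induction k)
  case (Suc k)
  let ?z = "\<lambda>i. if i < k then c *\<^sub>C x else x"
  have lin: "Vector_Spaces.linear (*\<^sub>C) (*) (\<lambda>v. A (?z(k := v)))"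
    using A Suc.prems by (auto simp: multilinear_form_def)
  have "(\<lambda>i. if i < Suc k then c *\<^sub>C x else x) = ?z(k := c *\<^sub>C x)"
    by (auto simp: fun_eq_iff)
  moreover have "A (?z(k := c *\<^sub>C x)) = c * A (?z(k := x))"
    using module_hom.scale[OF Vector_Spaces.linear.axioms(3)[OF lin]] by blast
  moreover have "?z(k := x) = ?z"
    by (auto simp: fun_eq_iff)
  ultimately show ?case
    using Suc by simp
qed simp

lemma cpoly_homogeneous:
  assumes "P \<in> cpoly m"
  shows "P (c *\<^sub>C x) = c ^ m * P x"
proof -
  obtain A where A: "multilinear_form m A" and P: "P = (\<lambda>x. A (\<lambda>_. x))"
    using assms by (auto simp: cpoly_def)
  have "A (\<lambda>_. c *\<^sub>C x) = A (\<lambda>i. if i < m then c *\<^sub>C x else x)"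
    using A by (auto simp: multilinear_form_def)
  then show ?thesis
    using multilinear_form_scale_prefix[OF A order.refl] P by simp
qed

lemma taylor_series_at_sums:
  assumes "taylor_series_at f a P"
  shows "\<exists>r>0. \<forall>z. norm z < r \<longrightarrow> (\<lambda>m. P m x * z ^ m) sums f (a + z *\<^sub>C x)"
proof -
  obtain r where r: "r > 0"
    and lim: "uniform_limit (ball 0 r) (\<lambda>n x. \<Sum>m<n. P m x) (\<lambda>x. f (a + x)) sequentially"
    and P: "\<And>m. P m \<in> cpoly m"
    using assms by (auto simp: taylor_series_at_def)
  show ?thesis
  proof (intro exI conjI allI impI)
    show "0 < r / (norm x + 1)"
      using r by (simp add: add_nonneg_pos)
    fix z :: complex
    assume z: "norm z < r / (norm x + 1)"
    have "norm (z *\<^sub>C x) = norm z * norm x"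
      by (rule norm_scaleC)
    also have "\<dots> \<le> norm z * (norm x + 1)"
      by (simp add: mult_left_mono)
    also have "\<dots> < r"
      using z by (simp add: pos_less_divide_eq add_nonneg_pos)
    finally have "z *\<^sub>C x \<in> ball 0 r"
      by simp
    from tendsto_uniform_limitI[OF lim this]
    show "(\<lambda>m. P m x * z ^ m) sums f (a + z *\<^sub>C x)"
      by (simp add: sums_def cpoly_homogeneous[OF P] mult.commute)
  qed
qed

lemma taylor_series_at_unique:
  assumes "taylor_series_at f a P" and "taylor_series_at f a Q"
  shows "P = Q"
proof (intro ext)
  fix m x
  obtain r where r: "r > 0"
    and P: "\<And>z. norm z < r \<Longrightarrow> (\<lambda>m. P m x * z ^ m) sums f (a + z *\<^sub>C x)"
    using taylor_series_at_sums[OF assms(1)] by blast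
  obtain s where s: "s > 0"
    and Q: "\<And>z. norm z < s \<Longrightarrow> (\<lambda>m. Q m x * z ^ m) sums f (a + z *\<^sub>C x)"
    using taylor_series_at_sums[OF assms(2)] by blast
  define t where "t = min r s"
  have t: "t > 0"
    using r s by (simp add: t_def)
  define d where "d = (\<lambda>m. P m x - Q m x)"
  have d: "(\<lambda>m. d m * z ^ m) sums 0" if "norm z < t" for z
    using sums_diff[OF P[of z] Q[of z]] that by (simp add: t_def d_def left_diff_distrib)
  have "d m = 0" for m
  proof (induction m rule: less_induct)
    case (less n)
    have "(\<lambda>k. d (k + n) * z ^ k) sums 0" if z: "z \<noteq> 0" "norm z < t" for z
    proof -
      have "(\<lambda>k. d (k + n) * z ^ (k + n)) sums (0 - (\<Sum>i<n. d i * z ^ i))"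
        by (rule sums_split_initial_segment[OF d[OF z(2)]])
      then have "(\<lambda>k. d (k + n) * z ^ (k + n) / z ^ n) sums (0 / z ^ n)"
        using less by (intro sums_divide) simp
      then show ?thesis
        using z by (simp add: power_add)
    qed
    from powser_limit_0_strong[where a = "\<lambda>k. d (k + n)" and f = "\<lambda>_. 0", OF t this]
    have "((\<lambda>_::complex. 0) \<longlongrightarrow> d n) (at 0)"
      by simp
    then show ?case
      by (simp add: tendsto_const_iff)
  qed
  then show "P m x = Q m x"
    by (simp add: d_def)
qed

section \<open>Holomorphy types\<close>

text \<open>A normed space of functions is a carrier \<open>V\<close> with a norm \<open>N\<close>, whose values outside \<open>V\<close>
  are irrelevant. Since \<^locale>\<open>Metric_space\<close> asks for a nonnegative symmetric distance on the
  whole type, the distance has to be set to a default value outside \<open>V\<close>.\<close>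

definition normed_function_space ::
    "('a \<Rightarrow> complex) set \<Rightarrow> (('a \<Rightarrow> complex) \<Rightarrow> real) \<Rightarrow> bool"
  where "normed_function_space V N \<longleftrightarrow>
    cfun.subspace V \<and>
    (\<forall>p\<in>V. 0 \<le> N p \<and> (N p = 0 \<longleftrightarrow> p = 0)) \<and>
    (\<forall>p\<in>V. \<forall>c. N (fscale c p) = cmod c * N p) \<and>
    (\<forall>p\<in>V. \<forall>q\<in>V. N (p + q) \<le> N p + N q)"

definition norm_dist ::
    "('a \<Rightarrow> complex) set \<Rightarrow> (('a \<Rightarrow> complex) \<Rightarrow> real) \<Rightarrow> ('a \<Rightarrow> complex) \<Rightarrow> ('a \<Rightarrow> complex) \<Rightarrow> real"
  where "norm_dist V N p q = (if p \<in> V \<and> q \<in> V then N (p - q) else 0)"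

lemma Metric_space_norm_dist:
  assumes "normed_function_space V N"
  shows "Metric_space V (norm_dist V N)"
proof
  have V: "cfun.subspace V"
    and nonneg: "\<And>p. p \<in> V \<Longrightarrow> 0 \<le> N p"
    and zero: "\<And>p. p \<in> V \<Longrightarrow> N p = 0 \<longleftrightarrow> p = 0"
    and scale: "\<And>p c. p \<in> V \<Longrightarrow> N (fscale c p) = cmod c * N p"
    and tri: "\<And>p q. p \<in> V \<Longrightarrow> q \<in> V \<Longrightarrow> N (p + q) \<le> N p + N q"
    using assms by (auto simp: normed_function_space_def)
  note diff = cfun.subspace_diff[OF V]
  fix p q r
  show "0 \<le> norm_dist V N p q"
    by (simp add: norm_dist_def nonneg diff)
  have "N (p - q) = N (q - p)" if "p \<in> V" "q \<in> V"
    using scale[OF diff[OF that], of "-1"] by (simp add: cfun.scale_minus_left)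
  then show "norm_dist V N p q = norm_dist V N q p"
    by (simp add: norm_dist_def)
  show "norm_dist V N p q = 0 \<longleftrightarrow> p = q" if "p \<in> V" "q \<in> V"
    using that by (simp add: norm_dist_def zero diff)
  show "norm_dist V N p r \<le> norm_dist V N p q + norm_dist V N q r"
    if "p \<in> V" "q \<in> V" "r \<in> V"
    using that tri[of "p - q" "q - r"] by (simp add: norm_dist_def diff)
qed

definition banach_function_space ::
    "('a \<Rightarrow> complex) set \<Rightarrow> (('a \<Rightarrow> complex) \<Rightarrow> real) \<Rightarrow> bool"
  where "banach_function_space V N \<longleftrightarrow>
    normed_function_space V N \<and> Metric_space.mcomplete V (norm_dist V N)"

text \<open>A holomorphy type is given by its carriers \<open>\<Theta> m\<close> and norms \<open>N m\<close>.\<close>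

definition holomorphy_type ::
    "(nat \<Rightarrow> ('a::complex_banach \<Rightarrow> complex) set) \<Rightarrow> (nat \<Rightarrow> ('a \<Rightarrow> complex) \<Rightarrow> real) \<Rightarrow> bool"
  where "holomorphy_type \<Theta> N \<longleftrightarrow>
    (\<forall>m. banach_function_space (\<Theta> m) (N m)) \<and>
    (\<forall>m. \<Theta> m \<subseteq> cpoly m) \<and>
    \<Theta> 0 = range (\<lambda>c _. c) \<and> (\<forall>c. N 0 (\<lambda>_. c) = cmod c) \<and>
    (\<exists>\<sigma>\<ge>1. \<forall>m. \<forall>k\<le>m. \<forall>a. \<forall>P\<in>\<Theta> m.
      dhat k P a \<in> \<Theta> k \<and>
      N k (fscale (1 / fact k) (dhat k P a)) \<le> \<sigma> ^ m * N m P * norm a ^ (m - k))"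

definition pi1_holomorphy_type ::
    "(nat \<Rightarrow> ('a::complex_banach \<Rightarrow> complex) set) \<Rightarrow> (nat \<Rightarrow> ('a \<Rightarrow> complex) \<Rightarrow> real) \<Rightarrow> bool"
  where "pi1_holomorphy_type \<Theta> N \<longleftrightarrow>
    holomorphy_type \<Theta> N \<and>
    (\<forall>m. cpoly_finite_type m \<subseteq> \<Theta> m) \<and>
    (\<exists>K>0. \<forall>\<phi>\<in>cdual. \<forall>b. \<forall>m\<ge>1.
      N m (\<lambda>x. blinfun_apply \<phi> x ^ m * b) \<le> K ^ m * norm \<phi> ^ m * cmod b) \<and>
    (\<forall>m. Metric_space.mtopology (\<Theta> m) (norm_dist (\<Theta> m) (N m)) closure_of cpoly_finite_type m
      = \<Theta> m)"

section \<open>Entire functions of \<open>\<Theta>\<close>-bounded type\<close>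

definition HTb ::
    "(nat \<Rightarrow> ('a::complex_banach \<Rightarrow> complex) set) \<Rightarrow> (nat \<Rightarrow> ('a \<Rightarrow> complex) \<Rightarrow> real) \<Rightarrow>
      ('a \<Rightarrow> complex) set"
  where "HTb \<Theta> N = {f \<in> entire.
    (\<forall>m. fscale (1 / fact m) (dhat m f 0) \<in> \<Theta> m) \<and>
    (\<lambda>m. root m (1 / fact m * N m (dhat m f 0))) \<longlonglongrightarrow> 0}"

definition HTb_seminorm ::
    "(nat \<Rightarrow> ('a::complex_banach \<Rightarrow> complex) \<Rightarrow> real) \<Rightarrow> real \<Rightarrow> ('a \<Rightarrow> complex) \<Rightarrow> real"
  where "HTb_seminorm N \<rho> f = (\<Sum>m. \<rho> ^ m / fact m * N m (dhat m f 0))"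

definition HTb_topology ::
    "(nat \<Rightarrow> ('a::complex_banach \<Rightarrow> complex) set) \<Rightarrow> (nat \<Rightarrow> ('a \<Rightarrow> complex) \<Rightarrow> real) \<Rightarrow>
      ('a \<Rightarrow> complex) topology"
  where "HTb_topology \<Theta> N = topology_generated_by
    {{g \<in> HTb \<Theta> N. HTb_seminorm N \<rho> (g - f) < \<epsilon>} | f \<rho> \<epsilon>. f \<in> HTb \<Theta> N \<and> 0 < \<rho> \<and> 0 < \<epsilon>}"

section \<open>Convolution operators and hypercyclicity\<close>

definition translate :: "'a::ab_group_add \<Rightarrow> ('a \<Rightarrow> complex) \<Rightarrow> 'a \<Rightarrow> complex"
  where "translate a f = (\<lambda>x. f (x - a))"

text \<open>Only the values of \<open>L\<close> on \<open>HTb \<Theta> N\<close> matter.\<close>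

definition convolution_operator ::
    "(nat \<Rightarrow> ('a::complex_banach \<Rightarrow> complex) set) \<Rightarrow> (nat \<Rightarrow> ('a \<Rightarrow> complex) \<Rightarrow> real) \<Rightarrow>
      (('a \<Rightarrow> complex) \<Rightarrow> ('a \<Rightarrow> complex)) \<Rightarrow> bool"
  where "convolution_operator \<Theta> N L \<longleftrightarrow>
    L \<in> HTb \<Theta> N \<rightarrow> HTb \<Theta> N \<and>
    (\<forall>f\<in>HTb \<Theta> N. \<forall>g\<in>HTb \<Theta> N. L (f + g) = L f + L g) \<and>
    (\<forall>c. \<forall>f\<in>HTb \<Theta> N. L (fscale c f) = fscale c (L f)) \<and>
    continuous_map (HTb_topology \<Theta> N) (HTb_topology \<Theta> N) L \<and>
    (\<forall>a. \<forall>f\<in>HTb \<Theta> N. L (translate a f) = translate a (L f))"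

definition hypercyclic :: "'b topology \<Rightarrow> ('b \<Rightarrow> 'b) \<Rightarrow> bool"
  where "hypercyclic X T \<longleftrightarrow>
    (\<exists>x \<in> topspace X. X closure_of (range (\<lambda>n. (T ^^ n) x)) = topspace X)"

end

theory Submission
  imports Defs "HOL-Complex_Analysis.Complex_Analysis"
begin

text \<open>The exponentials \<open>e\<^sub>\<phi> = exp \<circ> \<phi>\<close> of functionals \<open>\<phi>\<close> are eigenvectors of a convolution operator \<open>L\<close>,
  because translations multiply them by constants. The eigenvalue \<open>\<lambda>(\<phi>)\<close> is an entire function of
  \<open>\<phi>\<close> along every complex line. If it were constant, \<open>L\<close> would be a multiple of the identity, since the
  exponentials span a dense subspace; so by Liouville's theorem it takes values inside and outside the
  closed unit disc. A closed subspace that contains \<open>e\<^sub>\<phi>\<close> for all \<open>\<phi>\<close> near some point already contains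
  every \<open>e\<^sub>\<phi>\<close>, hence all polynomials of finite type, hence everything. Therefore the vectors whose
  forward orbit tends to 0 and the vectors with a backward orbit that tends to 0 are both dense, and
  these two facts, separability and completeness yield a vector with dense orbit.\<close>

section \<open>Taylor expansions of homogeneous polynomials\<close>

text \<open>The axioms estimate the \<Theta>-norm of pure powers of functionals only, whereas the
  Taylor coefficients of z -> exp(\<phi> + z \<psi>) contain mixed products of \<phi> and \<psi>.
  Averaging over circles in z turns the first estimate into one for the second; the resulting bound
  C^m/m! in degree m is summable against every radius, so exponentials, their coefficients and their
  remainders get explicit seminorm bounds. Membership in the space is defined by entire functions
  and derivatives, but every argument runs on the sequence of Taylor terms at 0, where the space is
  a weighted l1-sum of Banach spaces. The price is to show that each such sequence sums to a
  function with a Taylor expansion at every point; the derivative estimate with its constant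
  \<sigma> enters here. Density is obtained without duality: derivatives of the exponential curve
  are formed inside a given closed subspace, as limits of difference quotients. Only complex lines
  are considered, with a radius that may depend on the line, so that one-variable function theory is
  enough for the eigenvalue.\<close>

lemma coefficient_extraction:
  fixes k m :: nat
  assumes "k \<le> m"
  shows "\<exists>(M::nat) z w. (\<forall>j<M. cmod (z j) = 1) \<and> (\<Sum>j<M. cmod (w j)) = 1 \<and>
    (\<forall>c. (\<Sum>j<M. w j * (\<Sum>i\<le>m. c i * z j ^ i)) = c k)"
proof -
  \<comment> \<open>A discrete Cauchy formula: with m + 1 roots of unity the exponents 0..m stay
    distinct modulo \<open>M\<close>, so averaging the values times z^(-k) isolates degree
    \<open>k\<close>. The weights \<open>w\<close> have total modulus 1, so a bound for the values
    on the unit circle passes unchanged to the coefficient.\<close>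
  define M where "M = Suc m"
  define \<zeta> where "\<zeta> = cis (2 * pi / real M)"
  define w where "w = (\<lambda>j. inverse ((\<zeta> ^ j) ^ k) / of_nat M)"
  have M0: "of_nat M \<noteq> (0 :: complex)"
    by (simp add: M_def del: of_nat_Suc)
  have \<zeta>1: "cmod \<zeta> = 1"
    by (simp add: \<zeta>_def)
  then have \<zeta>0: "\<zeta> \<noteq> 0"
    by auto
  have pow: "\<zeta> ^ i = cis (2 * pi * real i / real M)" for i
    by (simp add: \<zeta>_def Complex.DeMoivre mult_ac)
  have \<zeta>M: "\<zeta> ^ M = 1"
    unfolding pow by (simp add: M_def del: of_nat_Suc)
  have inj: "inj_on (\<lambda>i. \<zeta> ^ i) {..<M}"
    using Complex.bij_betw_roots_unity[of M] unfolding pow by (simp add: M_def bij_betw_def)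
  have orth: "(\<Sum>j<M. w j * (\<zeta> ^ j) ^ i) = (if i = k then 1 else 0)" if "i \<le> m" for i
  proof -
    define q where "q = \<zeta> ^ i / \<zeta> ^ k"
    have swap: "(\<zeta> ^ j) ^ n = (\<zeta> ^ n) ^ j" for j n
      by (simp add: mult.commute flip: power_mult)
    have "w j * (\<zeta> ^ j) ^ i = q ^ j / of_nat M" for j
      unfolding w_def q_def swap[of j] by (simp add: divide_inverse power_mult_distrib power_inverse)
    then have *: "(\<Sum>j<M. w j * (\<zeta> ^ j) ^ i) = (\<Sum>j<M. q ^ j) / of_nat M"
      by (simp add: sum_divide_distrib)
    show ?thesis
    proof (cases "i = k")
      case True
      then have "q = 1"
        using \<zeta>0 by (simp add: q_def)
      then show ?thesis
        unfolding * using True M0 by simp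
    next
      case False
      have "\<zeta> ^ i \<noteq> \<zeta> ^ k"
        using inj that assms False by (auto simp: inj_on_def M_def)
      then have q: "q \<noteq> 1"
        using \<zeta>0 by (simp add: q_def)
      have "q ^ M = (\<zeta> ^ M) ^ i / (\<zeta> ^ M) ^ k"
        by (simp add: q_def power_divide swap)
      then have "q ^ M = 1"
        by (simp add: \<zeta>M)
      then have "(\<Sum>j<M. q ^ j) = 0"
        using geometric_sum[OF q, of M] by simp
      then show ?thesis
        unfolding * using False by simp
    qed
  qed
  have "(\<Sum>j<M. w j * (\<Sum>i\<le>m. c i * (\<zeta> ^ j) ^ i)) = c k" for c
  proof -
    have "(\<Sum>j<M. w j * (\<Sum>i\<le>m. c i * (\<zeta> ^ j) ^ i))
        = (\<Sum>i\<le>m. c i * (\<Sum>j<M. w j * (\<zeta> ^ j) ^ i))"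
      by (simp add: sum_distrib_left mult_ac) (rule sum.swap)
    also have "\<dots> = (\<Sum>i\<le>m. if i = k then c k else 0)"
      by (intro sum.cong) (auto simp: orth)
    finally show ?thesis
      using assms by simp
  qed
  moreover have "(\<Sum>j<M. cmod (w j)) = 1"
    using M0 by (simp add: w_def norm_divide norm_inverse norm_power \<zeta>1)
  moreover have "cmod (\<zeta> ^ j) = 1" for j
    by (simp add: norm_power \<zeta>1)
  ultimately show ?thesis
    by (intro exI[of _ M] exI[of _ "\<lambda>j. \<zeta> ^ j"] exI[of _ w]) simp
qed

lemma bounded_linear_scaleC: "bounded_linear (\<lambda>x::'a::complex_normed_vector. c *\<^sub>C x)"
proof (rule bounded_linear_intro)
  fix r :: real and x :: 'a
  show "c *\<^sub>C (r *\<^sub>R x) = r *\<^sub>R (c *\<^sub>C x)"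
    by (simp add: scaleC_scaleC mult.commute flip: scaleC_of_real)
  show "norm (c *\<^sub>C x) \<le> norm x * cmod c"
    by (simp add: norm_scaleC)
qed (rule scaleC_add_right)

lemma clinear_iff:
  "Vector_Spaces.linear (*\<^sub>C) (*) (f :: 'a::complex_normed_vector \<Rightarrow> complex) \<longleftrightarrow>
    (\<forall>x y. f (x + y) = f x + f y) \<and> (\<forall>c x. f (c *\<^sub>C x) = c * f x)"
proof -
  have "vector_space ((*) :: complex \<Rightarrow> complex \<Rightarrow> complex)"
    by standard (simp_all add: algebra_simps)
  then show ?thesis
    by (simp add: Vector_Spaces.linear_iff cvec.vector_space_axioms)
qed

lemma multilinear_form_linear:
  assumes "multilinear_form m A" and "k < m"
  shows "Vector_Spaces.linear (*\<^sub>C) (*) (\<lambda>v. A (x(k := v)))"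
  using assms unfolding multilinear_form_def by blast

lemma multilinear_form_update:
  assumes "multilinear_form m A" and "k < m"
  shows "A (x(k := u + v)) = A (x(k := u)) + A (x(k := v))"
  using multilinear_form_linear[OF assms] unfolding clinear_iff by blast

lemma multilinear_form_cong:
  assumes "multilinear_form m A" and "\<And>i. i < m \<Longrightarrow> x i = y i"
  shows "A x = A y"
  using assms unfolding multilinear_form_def by blast

lemma multilinear_form_sum:
  fixes A :: "'i \<Rightarrow> (nat \<Rightarrow> 'a::complex_normed_vector) \<Rightarrow> complex"
  assumes A: "\<And>i. i \<in> I \<Longrightarrow> multilinear_form m (A i)"
  shows "multilinear_form m (\<lambda>x. \<Sum>i\<in>I. A i x)"
  unfolding multilinear_form_def
proof (intro conjI allI impI)
  fix x y :: "nat \<Rightarrow> 'a" assume "\<forall>i<m. x i = y i"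
  then show "(\<Sum>i\<in>I. A i x) = (\<Sum>i\<in>I. A i y)"
    by (intro sum.cong refl multilinear_form_cong[OF A]) auto
next
  fix k and x :: "nat \<Rightarrow> 'a" assume "k < m"
  then have "Vector_Spaces.linear (*\<^sub>C) (*) (\<lambda>v. A i (x(k := v)))" if "i \<in> I" for i
    using A that multilinear_form_linear by blast
  then show "Vector_Spaces.linear (*\<^sub>C) (*) (\<lambda>v. \<Sum>i\<in>I. A i (x(k := v)))"
    by (simp add: clinear_iff sum.distrib sum_distrib_left)
qed

text \<open>\<open>A\<close> is not assumed symmetric, so the expansion is indexed by the set
  \<open>S\<close> of coordinates that receive \<open>x\<close> instead of by their number.\<close>

lemma multilinear_form_binomial:
  assumes A: "multilinear_form m A"
  shows "A (\<lambda>_. a + x) = (\<Sum>S\<in>Pow {..<m}. A (\<lambda>i. if i \<in> S then x else a))"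
proof -
  \<comment> \<open>The coordinates from \<open>k\<close> on come from an arbitrary
    \<open>y\<close>, so that the induction step can store \<open>a + x\<close> in coordinate
    \<open>k\<close> of \<open>y\<close> and split it by additivity.\<close>
  have "A (\<lambda>i. if i < k then a + x else y i) =
      (\<Sum>S\<in>Pow {..<k}. A (\<lambda>i. if i < k then (if i \<in> S then x else a) else y i))"
    if "k \<le> m" for k y
    using that
  proof (induction k arbitrary: y)
    case (Suc k)
    let ?z = "\<lambda>S i. if i < k then (if i \<in> S then x else a) else y i"
    let ?t = "\<lambda>S i. if i < Suc k then (if i \<in> S then x else a) else y i"
    have "A (\<lambda>i. if i < Suc k then a + x else y i) = A (\<lambda>i. if i < k then a + x else (y(k := a + x)) i)"
      by (rule arg_cong[of _ _ A]) (auto simp: fun_eq_iff)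
    also have "\<dots> = (\<Sum>S\<in>Pow {..<k}. A (\<lambda>i. if i < k then (if i \<in> S then x else a) else (y(k := a + x)) i))"
      using Suc by simp
    also have "\<dots> = (\<Sum>S\<in>Pow {..<k}. A ((?z S)(k := a + x)))"
      by (intro sum.cong refl arg_cong[of _ _ A]) (auto simp: fun_eq_iff)
    also have "\<dots> = (\<Sum>S\<in>Pow {..<k}. A ((?z S)(k := a))) + (\<Sum>S\<in>Pow {..<k}. A ((?z S)(k := x)))"
      using Suc.prems by (simp add: multilinear_form_update[OF A] sum.distrib)
    also have "(\<Sum>S\<in>Pow {..<k}. A ((?z S)(k := a))) = (\<Sum>S\<in>Pow {..<k}. A (?t S))"
      by (intro sum.cong refl arg_cong[of _ _ A]) (auto simp: fun_eq_iff)
    also have "(\<Sum>S\<in>Pow {..<k}. A ((?z S)(k := x))) = (\<Sum>S\<in>insert k ` Pow {..<k}. A (?t S))"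
    proof (subst sum.reindex)
      show "inj_on (insert k) (Pow {..<k})"
        by (auto simp: inj_on_def)
    qed (auto simp: fun_eq_iff intro!: sum.cong arg_cong[of _ _ A])
    also have "(\<Sum>S\<in>Pow {..<k}. A (?t S)) + (\<Sum>S\<in>insert k ` Pow {..<k}. A (?t S))
        = (\<Sum>S\<in>Pow {..<Suc k}. A (?t S))"
      by (subst sum.union_disjoint[symmetric]) (auto simp: lessThan_Suc Pow_insert)
    finally show ?case .
  qed simp
  from this[of m "\<lambda>_. a + x"] have "A (\<lambda>_. a + x) =
      (\<Sum>S\<in>Pow {..<m}. A (\<lambda>i. if i < m then (if i \<in> S then x else a) else a + x))"
    by simp
  also have "\<dots> = (\<Sum>S\<in>Pow {..<m}. A (\<lambda>i. if i \<in> S then x else a))"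
    by (intro sum.cong refl multilinear_form_cong[OF A]) auto
  finally show ?thesis .
qed

text \<open>Freezing the coordinates outside \<open>S\<close> leaves a form in the remaining ones;
  since \<open>multilinear_form\<close> counts its variables from 0, they are renumbered by a
  bijection \<open>h\<close> with inverse \<open>g\<close>.\<close>

lemma multilinear_form_restrict:
  assumes A: "multilinear_form m A" and S: "S \<subseteq> {..<m}"
  shows "\<exists>B. multilinear_form (card S) B \<and> (\<forall>x. B (\<lambda>_. x) = A (\<lambda>i. if i \<in> S then x else a))"
proof -
  have "finite S"
    using S finite_subset by blast
  then obtain h where h: "bij_betw h {..<card S} S"
    using ex_bij_betw_nat_finite[of S] by (auto simp: atLeast0LessThan)
  define g where "g = inv_into {..<card S} h"
  have g: "g i < card S" if "i \<in> S" for i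
    using that h bij_betwE[OF bij_betw_inv_into[OF h]] by (auto simp: g_def)
  have gh: "g i = j \<longleftrightarrow> i = h j" if "i \<in> S" "j < card S" for i j
    using that h unfolding g_def
    by (metis bij_betw_inv_into_left bij_betw_inv_into_right lessThan_iff)
  have hS: "h j \<in> S" if "j < card S" for j
    using h that by (auto simp: bij_betw_def)
  let ?B = "\<lambda>y. A (\<lambda>i. if i \<in> S then y (g i) else a)"
  have "multilinear_form (card S) ?B"
    unfolding multilinear_form_def
  proof (intro conjI allI impI)
    fix x y :: "nat \<Rightarrow> 'a" assume "\<forall>i<card S. x i = y i"
    then show "?B x = ?B y"
      using g by (intro multilinear_form_cong[OF A]) auto
  next
    fix j and x :: "nat \<Rightarrow> 'a" assume j: "j < card S"
    have "(\<lambda>v. ?B (x(j := v))) = (\<lambda>v. A ((\<lambda>i. if i \<in> S then x (g i) else a)(h j := v)))"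
      using j gh hS by (intro ext arg_cong[of _ _ A]) auto
    moreover have "h j < m"
      using hS[OF j] S by auto
    ultimately show "Vector_Spaces.linear (*\<^sub>C) (*) (\<lambda>v. ?B (x(j := v)))"
      using multilinear_form_linear[OF A] by simp
  qed
  then show ?thesis
    by blast
qed

text \<open>Degree \<open>k\<close> collects the sets \<open>S\<close> of size \<open>k\<close>. The
  difficulty is the continuity of each part, because only the diagonal \<open>P\<close> of the form
  \<open>A\<close> is known to be continuous. By \<open>coefficient_extraction\<close>, each part is
  a finite combination of maps x -> P(a + z x), so it inherits continuity from
  \<open>P\<close>.\<close>

lemma cpoly_expansion:
  fixes P :: "'a::complex_normed_vector \<Rightarrow> complex"
  assumes P: "P \<in> cpoly m"
  shows "\<exists>Q. (\<forall>k. Q k \<in> cpoly k) \<and> (\<forall>k>m. Q k = 0) \<and> (\<forall>x. P (a + x) = (\<Sum>k\<le>m. Q k x))"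
proof -
  obtain A where A: "multilinear_form m A" and PA: "P = (\<lambda>x. A (\<lambda>_. x))"
    and cont: "continuous_on UNIV P"
    using P by (auto simp: cpoly_def)
  define J where "J = (\<lambda>k. {S \<in> Pow {..<m}. card S = k})"
  define Q where "Q = (\<lambda>k x. \<Sum>S\<in>J k. A (\<lambda>i. if i \<in> S then x else a))"
  have ml: "\<exists>B. multilinear_form k B \<and> Q k = (\<lambda>x. B (\<lambda>_. x))" for k
  proof -
    have "\<exists>B. multilinear_form k B \<and> (\<forall>x. B (\<lambda>_. x) = A (\<lambda>i. if i \<in> S then x else a))"
      if "S \<in> J k" for S
      using multilinear_form_restrict[OF A, of S a] that by (auto simp: J_def)
    then obtain B where B: "\<And>S. S \<in> J k \<Longrightarrow> multilinear_form k (B S)"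
      and BA: "\<And>S x. S \<in> J k \<Longrightarrow> B S (\<lambda>_. x) = A (\<lambda>i. if i \<in> S then x else a)"
      by metis
    have "multilinear_form k (\<lambda>x. \<Sum>S\<in>J k. B S x)"
      by (rule multilinear_form_sum[OF B])
    moreover have "Q k = (\<lambda>x. \<Sum>S\<in>J k. B S (\<lambda>_. x))"
      by (simp add: Q_def BA)
    ultimately show ?thesis
      by blast
  qed
  have expand: "P (a + x) = (\<Sum>k\<le>m. Q k x)" for x
  proof -
    have "card ` Pow {..<m} \<subseteq> {..m}"
      using card_mono[of "{..<m}"] by auto
    from sum.group[OF _ _ this, of "\<lambda>S. A (\<lambda>i. if i \<in> S then x else a)"]
    have "(\<Sum>k\<le>m. Q k x) = (\<Sum>S\<in>Pow {..<m}. A (\<lambda>i. if i \<in> S then x else a))"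
      by (simp add: Q_def J_def)
    then show ?thesis
      unfolding PA multilinear_form_binomial[OF A] by simp
  qed
  have zero: "Q k = 0" if "k > m" for k
  proof -
    have "card S \<noteq> k" if "S \<subseteq> {..<m}" for S
      using that card_mono[OF finite_lessThan that] \<open>k > m\<close> by simp
    then have "J k = {}"
      by (auto simp: J_def)
    then show ?thesis
      unfolding Q_def zero_fun_def by simp
  qed
  have "continuous_on UNIV (Q k)" for k
  proof (cases "k \<le> m")
    case True
    obtain M :: nat and z w :: "nat \<Rightarrow> complex"
      where *: "\<forall>c. (\<Sum>j<M. w j * (\<Sum>i\<le>m. c i * z j ^ i)) = c k"
      using coefficient_extraction[OF True] by (elim exE conjE) (rule that)
    have hom: "Q i (c *\<^sub>C x) = c ^ i * Q i x" for c i x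
    proof -
      obtain B where B: "multilinear_form i B" and QB: "Q i = (\<lambda>x. B (\<lambda>_. x))"
        using ml by blast
      have "B (\<lambda>_. c *\<^sub>C x) = B (\<lambda>j. if j < i then c *\<^sub>C x else x)"
        by (rule multilinear_form_cong[OF B]) simp
      then show ?thesis
        using multilinear_form_scale_prefix[OF B order.refl] unfolding QB by simp
    qed
    have "Q k = (\<lambda>x. \<Sum>j<M. w j * P (a + z j *\<^sub>C x))"
    proof
      fix x
      have "(\<Sum>j<M. w j * P (a + z j *\<^sub>C x)) = (\<Sum>j<M. w j * (\<Sum>i\<le>m. Q i x * z j ^ i))"
        unfolding expand hom by (simp only: mult.commute)
      then show "Q k x = (\<Sum>j<M. w j * P (a + z j *\<^sub>C x))"
        using *[rule_format, of "\<lambda>i. Q i x"] by simp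
    qed
    moreover have "continuous_on UNIV (\<lambda>x. P (a + c *\<^sub>C x))" for c
      by (intro continuous_on_compose2[OF cont] continuous_intros
          bounded_linear.continuous_on[OF bounded_linear_scaleC]) simp
    ultimately show ?thesis
      by (simp only:) (intro continuous_intros)
  next
    case False
    then have "Q k = (\<lambda>_. 0)"
      using zero[of k] unfolding zero_fun_def by (simp only: not_le)
    then show ?thesis
      by simp
  qed
  with ml have "\<forall>k. Q k \<in> cpoly k"
    by (auto simp: cpoly_def)
  with expand zero show ?thesis
    by blast
qed

section \<open>Entire functions given by rapidly decreasing Taylor coefficients\<close>

definition taylor_coeff :: "('a::complex_normed_vector \<Rightarrow> complex) \<Rightarrow> 'a \<Rightarrow> nat \<Rightarrow> 'a \<Rightarrow> complex"
  where "taylor_coeff f a m = fscale (1 / fact m) (dhat m f a)"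

lemma dhat_taylor_coeff: "dhat m f a = fscale (fact m) (taylor_coeff f a m)"
  by (simp add: taylor_coeff_def fscale_def)

lemma taylor_coeff_eqI:
  assumes "taylor_series_at f a P"
  shows "taylor_coeff f a = P"
proof -
  have "(THE P. taylor_series_at f a P) = P"
    using assms taylor_series_at_unique by blast
  then show ?thesis
    by (simp add: taylor_coeff_def dhat_def fscale_def fun_eq_iff)
qed

lemma sum_fun_apply: "sum f I x = (\<Sum>i\<in>I. f i x)"
  for f :: "'i \<Rightarrow> 'b \<Rightarrow> complex"
  by (induction I rule: infinite_finite_induct) simp_all

lemma cpoly_at_0:
  assumes "P \<in> cpoly m" and "m > 0"
  shows "P 0 = 0"
  using cpoly_homogeneous[OF assms(1), of 0 0] assms(2) by (simp add: power_0_left)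

lemma taylor_coeff_cpoly:
  fixes P :: "'a::complex_normed_vector \<Rightarrow> complex"
  assumes P: "P \<in> cpoly m"
  shows "P (a + x) = (\<Sum>k\<le>m. taylor_coeff P a k x)"
    and "taylor_coeff P a 0 = (\<lambda>_. P a)"
proof -
  obtain Q where Q: "\<And>k. Q k \<in> cpoly k" and Q0: "\<And>k. k > m \<Longrightarrow> Q k = 0"
    and expand: "\<And>x. P (a + x) = (\<Sum>k\<le>m. Q k x)"
    using cpoly_expansion[OF P, of a] by blast
  have "(\<Sum>k<n. Q k x) = P (a + x)" if "n > m" for n x
    unfolding expand using that Q0 by (intro sum.mono_neutral_right) auto
  then have "\<forall>\<^sub>F n in sequentially. \<forall>x\<in>ball 0 1. (\<Sum>k<n. Q k x) = P (a + x)"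
    by (auto intro!: eventually_mono[OF eventually_gt_at_top[of m]])
  then have "uniform_limit (ball 0 1) (\<lambda>n x. \<Sum>k<n. Q k x) (\<lambda>x. P (a + x)) sequentially"
    by (subst uniform_limit_cong) (auto intro: uniform_limit_const)
  then have ts: "taylor_series_at P a Q"
    using Q unfolding taylor_series_at_def by (auto intro!: exI[of _ 1])
  show "P (a + x) = (\<Sum>k\<le>m. taylor_coeff P a k x)"
    by (simp add: taylor_coeff_eqI[OF ts] expand)
  have "P a = (\<Sum>k\<le>m. Q k 0)"
    using expand[of 0] by simp
  also have "\<dots> = (\<Sum>k\<in>{0}. Q k 0)"
    using cpoly_at_0[OF Q] by (intro sum.mono_neutral_right) auto
  \<comment> \<open>Homogeneity with scalar 0, where \<open>0 ^ 0 = 1\<close>, shows that the part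
    of degree 0 is constant.\<close>
  also have "\<dots> = Q 0 x" for x
    using cpoly_homogeneous[OF Q[of 0], of 0 x] by simp
  finally show "taylor_coeff P a 0 = (\<lambda>_. P a)"
    by (auto simp: taylor_coeff_eqI[OF ts])
qed

text \<open>The Taylor series at 0 is only known to converge near 0. On the line through
  \<open>x\<close> the local expansions at all points make z -> f(z x) an entire function of one
  variable, whose power series converges everywhere and has the same coefficients.\<close>

lemma entire_sums:
  fixes f :: "'a::complex_normed_vector \<Rightarrow> complex"
  assumes f: "f \<in> entire"
  shows "(\<lambda>m. taylor_coeff f 0 m x) sums f x"
proof -
  have ts: "taylor_series_at f a (taylor_coeff f a)" for a
  proof -
    obtain P where "taylor_series_at f a P"
      using f by (auto simp: entire_def)
    then show ?thesis
      using taylor_coeff_eqI by metis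
  qed
  define h where "h = (\<lambda>z. f (z *\<^sub>C x))"
  have "\<exists>r>0. h holomorphic_on ball w r" for w
  proof -
    obtain r where r: "r > 0" and
      s: "\<And>z. norm z < r \<Longrightarrow> (\<lambda>m. taylor_coeff f (w *\<^sub>C x) m x * z ^ m) sums f (w *\<^sub>C x + z *\<^sub>C x)"
      using taylor_series_at_sums[OF ts[of "w *\<^sub>C x"], of x] by blast
    have "h holomorphic_on ball w r"
    proof (rule power_series_holomorphic)
      fix v assume "v \<in> ball w r"
      then show "(\<lambda>m. taylor_coeff f (w *\<^sub>C x) m x * (v - w) ^ m) sums h v"
        using s[of "v - w"] by (simp add: h_def dist_norm norm_minus_commute flip: scaleC_add_left)
    qed
    with r show ?thesis
      by blast
  qed
  then have hol: "h holomorphic_on UNIV"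
    by (metis centre_in_ball holomorphic_on_imp_differentiable_at holomorphic_onI
        field_differentiable_at_within open_ball)
  obtain r where r: "r > 0" and
    s: "\<And>z. norm z < r \<Longrightarrow> (\<lambda>m. taylor_coeff f 0 m x * z ^ m) sums f (0 + z *\<^sub>C x)"
    using taylor_series_at_sums[OF ts[of 0], of x] by blast
  define c where "c = (\<lambda>m. (deriv ^^ m) h 0 / fact m)"
  have hs: "(\<lambda>m. c m * z ^ m) sums h z" for z
    using holomorphic_power_series[of h 0 "norm z + 1" z] holomorphic_on_subset[OF hol]
    by (simp add: c_def)
  have "taylor_coeff f 0 m x = c m" for m
  proof -
    define d where "d = (\<lambda>m. taylor_coeff f 0 m x - c m)"
    have "(\<lambda>m. d m * z ^ m) sums 0" if "norm z < r" for z
      using sums_diff[OF s[OF that] hs[of z]] by (simp add: h_def d_def left_diff_distrib)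
    then have *: "norm (z - 0) < r \<Longrightarrow> (\<lambda>m. d m * (z - 0) ^ m) sums 0" for z
      by simp
    have "d m = 0"
    proof (cases "m = 0")
      case True
      then show ?thesis
        using *[of 0] r by simp
    next
      case False
      show ?thesis
      proof (rule ccontr)
        assume "d m \<noteq> 0"
        \<comment> \<open>The series has sum 0, yet a nonzero coefficient would force its sum to be
          nonzero in a punctured disc around 0.\<close>
        then obtain t where "0 < t" "\<And>z::complex. z \<in> cball 0 t - {0} \<Longrightarrow> (0::complex) \<noteq> 0"
          using powser_0_nonzero[of r 0 d "\<lambda>_. 0" m] r * False by blast
        from this(2)[of "of_real t"] this(1) show False
          by simp
      qed
    qed
    then show ?thesis
      by (simp add: d_def)
  qed
  then show ?thesis
    using hs[of 1] by (simp add: h_def)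
qed

text \<open>With the converse below, this trades the root condition in the definition of the space
  for finiteness of all seminorms; smallness \<open>e\<close> of the roots corresponds to the radius
  \<open>1 / e\<close>.\<close>

lemma summable_imp_root_tendsto_0:
  fixes a :: "nat \<Rightarrow> real"
  assumes a: "\<And>m. a m \<ge> 0" and sm: "\<And>\<rho>. \<rho> > 0 \<Longrightarrow> summable (\<lambda>m. \<rho> ^ m * a m)"
  shows "(\<lambda>m. root m (a m)) \<longlonglongrightarrow> 0"
proof (rule tendstoI)
  fix e :: real assume e: "e > 0"
  then have "(\<lambda>m. (1 / e) ^ m * a m) \<longlonglongrightarrow> 0"
    using summable_LIMSEQ_zero[OF sm] by simp
  then have "\<forall>\<^sub>F m in sequentially. (1 / e) ^ m * a m < 1"
    by (rule order_tendstoD) simp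
  with eventually_gt_at_top[of 0] show "\<forall>\<^sub>F m in sequentially. dist (root m (a m)) 0 < e"
  proof eventually_elim
    case (elim m)
    then have "a m < e ^ m"
      using e by (simp add: power_divide field_simps)
    then have "root m (a m) < root m (e ^ m)"
      using elim by simp
    then show ?case
      using elim e a by (simp add: real_root_power_cancel)
  qed
qed

lemma root_tendsto_0_imp_summable:
  fixes a :: "nat \<Rightarrow> real"
  assumes a: "\<And>m. a m \<ge> 0" and lim: "(\<lambda>m. root m (a m)) \<longlonglongrightarrow> 0" and \<rho>: "\<rho> > 0"
  shows "summable (\<lambda>m. \<rho> ^ m * a m)"
proof (rule summable_comparison_test_ev)
  \<comment> \<open>This margin leaves the geometric majorant \<open>(1 / 2) ^ m\<close>.\<close>
  have "\<forall>\<^sub>F m in sequentially. root m (a m) < 1 / (2 * \<rho>)"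
    using order_tendstoD(2)[OF lim, of "1 / (2 * \<rho>)"] \<rho> by simp
  with eventually_gt_at_top[of 0]
  show "\<forall>\<^sub>F m in sequentially. norm (\<rho> ^ m * a m) \<le> (1 / 2) ^ m"
  proof eventually_elim
    case (elim m)
    have "root m (a m) ^ m \<le> (1 / (2 * \<rho>)) ^ m"
      using elim a by (intro power_mono) auto
    then have "a m \<le> (1 / (2 * \<rho>)) ^ m"
      using elim a by simp
    then have "\<rho> ^ m * a m \<le> \<rho> ^ m * (1 / (2 * \<rho>)) ^ m"
      using \<rho> by simp
    also have "\<dots> = (1 / 2) ^ m"
      using \<rho> by (simp flip: power_mult_distrib)
    finally show ?case
      using \<rho> a by simp
  qed
qed (simp add: summable_geometric)

text \<open>The constant of the derivative axiom becomes the parameter \<open>\<sigma>\<close>, and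
  the axiom is stated for Taylor terms, free of factorials.\<close>

locale holomorphy_type_on =
  fixes \<Theta> :: "nat \<Rightarrow> ('a::complex_banach \<Rightarrow> complex) set"
    and N :: "nat \<Rightarrow> ('a \<Rightarrow> complex) \<Rightarrow> real"
    and \<sigma> :: real
  assumes banach: "banach_function_space (\<Theta> m) (N m)"
    and subset_cpoly: "\<Theta> m \<subseteq> cpoly m"
    and N_const: "N 0 (\<lambda>_. c) = cmod c"
    and sigma_ge_1: "\<sigma> \<ge> 1"
    and taylor_coeff_mem: "k \<le> m \<Longrightarrow> P \<in> \<Theta> m \<Longrightarrow> taylor_coeff P a k \<in> \<Theta> k"
    and taylor_coeff_bound:
      "k \<le> m \<Longrightarrow> P \<in> \<Theta> m \<Longrightarrow> N k (taylor_coeff P a k) \<le> \<sigma> ^ m * N m P * norm a ^ (m - k)"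
begin

section \<open>Estimates and completeness inside a single space of the type\<close>

lemma subspace: "cfun.subspace (\<Theta> m)"
  and N_nonneg: "P \<in> \<Theta> m \<Longrightarrow> 0 \<le> N m P"
  and N_eq_0: "P \<in> \<Theta> m \<Longrightarrow> N m P = 0 \<longleftrightarrow> P = 0"
  and N_scale: "P \<in> \<Theta> m \<Longrightarrow> N m (fscale c P) = cmod c * N m P"
  and N_add: "P \<in> \<Theta> m \<Longrightarrow> Q \<in> \<Theta> m \<Longrightarrow> N m (P + Q) \<le> N m P + N m Q"
  using banach[of m] by (auto simp: banach_function_space_def normed_function_space_def)

lemmas Theta_0 = cfun.subspace_0[OF subspace]
  and Theta_add = cfun.subspace_add[OF subspace]
  and Theta_diff = cfun.subspace_diff[OF subspace]
  and Theta_scale = cfun.subspace_scale[OF subspace]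
  and Theta_sum = cfun.subspace_sum[OF subspace]

lemma N_minus: "P \<in> \<Theta> m \<Longrightarrow> N m (- P) = N m P"
  using N_scale[of P m "-1"] by (simp add: cfun.scale_minus_left)

lemma N_0: "N m 0 = 0"
  using N_eq_0[OF Theta_0] by simp

lemma N_diff: "P \<in> \<Theta> m \<Longrightarrow> Q \<in> \<Theta> m \<Longrightarrow> N m (P - Q) \<le> N m P + N m Q"
  using N_add[of P m "- Q"] by (simp add: N_minus cfun.subspace_neg[OF subspace])

lemma N_sum: "(\<And>i. i \<in> I \<Longrightarrow> P i \<in> \<Theta> m) \<Longrightarrow> N m (sum P I) \<le> (\<Sum>i\<in>I. N m (P i))"
proof (induction I rule: infinite_finite_induct)
  case (insert i I)
  have "sum P I \<in> \<Theta> m"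
    using insert.prems by (intro Theta_sum) simp
  then have "N m (P i + sum P I) \<le> N m (P i) + N m (sum P I)"
    using insert.prems by (intro N_add) simp_all
  moreover have "N m (sum P I) \<le> (\<Sum>i\<in>I. N m (P i))"
    using insert.prems by (intro insert.IH) simp
  ultimately show ?case
    unfolding sum.insert[OF insert.hyps] by linarith
qed (simp_all add: N_0)

text \<open>This is the derivative axiom for \<open>k = 0\<close>: the term of degree 0 at
  \<open>x\<close> is the constant \<open>P x\<close>, and on constants the norm is the
  modulus.\<close>

lemma eval_bound:
  assumes P: "P \<in> \<Theta> m"
  shows "cmod (P x) \<le> \<sigma> ^ m * N m P * norm x ^ m"
proof -
  have "P \<in> cpoly m"
    using P subset_cpoly by blast
  then show ?thesis
    using taylor_coeff_bound[OF _ P, of 0 x] by (simp add: taylor_coeff_cpoly(2) N_const)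
qed

lemma Cauchy_limit:
  assumes q: "\<And>j. q j \<in> \<Theta> k"
    and C: "\<And>e. e > 0 \<Longrightarrow> \<exists>J. \<forall>i\<ge>J. \<forall>j\<ge>J. N k (q i - q j) < e"
  shows "\<exists>p\<in>\<Theta> k. (\<lambda>j. N k (q j - p)) \<longlonglongrightarrow> 0"
proof -
  interpret M: Metric_space "\<Theta> k" "norm_dist (\<Theta> k) (N k)"
    using banach[of k] by (simp add: banach_function_space_def Metric_space_norm_dist)
  have "M.MCauchy q"
    using q C by (auto simp: M.MCauchy_def norm_dist_def)
  then obtain p where "limitin M.mtopology q p sequentially"
    using banach[of k] by (auto simp: banach_function_space_def M.mcomplete_def)
  then have p: "p \<in> \<Theta> k" and lim: "(\<lambda>j. norm_dist (\<Theta> k) (N k) (q j) p) \<longlonglongrightarrow> 0"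
    by (simp_all add: M.limitin_metric_dist_null)
  with q show ?thesis
    by (auto simp: norm_dist_def)
qed

lemma eval_tendsto:
  assumes q: "\<And>j. q j \<in> \<Theta> k" and p: "p \<in> \<Theta> k" and lim: "(\<lambda>j. N k (q j - p)) \<longlonglongrightarrow> 0"
  shows "(\<lambda>j. q j x) \<longlonglongrightarrow> p x"
proof -
  have "(\<lambda>j. q j x - p x) \<longlonglongrightarrow> 0"
  proof (rule Lim_null_comparison)
    show "(\<lambda>j. \<sigma> ^ k * N k (q j - p) * norm x ^ k) \<longlonglongrightarrow> 0"
      using tendsto_mult[OF tendsto_mult[OF tendsto_const lim] tendsto_const] by simp
    show "\<forall>\<^sub>F j in sequentially. norm (q j x - p x) \<le> \<sigma> ^ k * N k (q j - p) * norm x ^ k"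
      using eval_bound[OF Theta_diff[OF q p]] by (auto intro!: always_eventually)
  qed
  then show ?thesis
    by (simp add: LIM_zero_iff)
qed

lemma summable_series:
  assumes q: "\<And>j. q j \<in> \<Theta> k" and sm: "summable (\<lambda>j. N k (q j))"
  shows "\<exists>p\<in>\<Theta> k. \<forall>x. (\<lambda>j. q j x) sums p x"
proof -
  have s: "(\<Sum>j<n. q j) \<in> \<Theta> k" for n
    using q by (intro Theta_sum)
  have "\<exists>J. \<forall>i\<ge>J. \<forall>j\<ge>J. N k ((\<Sum>l<i. q l) - (\<Sum>l<j. q l)) < e" if "e > 0" for e
  proof -
    obtain J where J: "\<And>m n. m \<ge> J \<Longrightarrow> norm (\<Sum>j=m..<n. N k (q j)) < e"
      using sm \<open>e > 0\<close> unfolding summable_Cauchy by blast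
    have main: "N k ((\<Sum>l<i. q l) - (\<Sum>l<j. q l)) < e" if "j \<ge> J" "j \<le> i" for i j
    proof -
      have "(\<Sum>l<i. q l) - (\<Sum>l<j. q l) = (\<Sum>l=j..<i. q l)"
        using that sum_diff_nat_ivl[of 0 j i q] by (simp add: lessThan_atLeast0)
      then have "N k ((\<Sum>l<i. q l) - (\<Sum>l<j. q l)) \<le> (\<Sum>l=j..<i. N k (q l))"
        using N_sum[of "{j..<i}" q k] q by simp
      also have "\<dots> < e"
        using J[of j i] that by simp
      finally show ?thesis .
    qed
    have "N k ((\<Sum>l<i. q l) - (\<Sum>l<j. q l)) < e" if "i \<ge> J" "j \<ge> J" for i j
      using main[of i j] main[of j i] that N_minus[OF Theta_diff[OF s[of i] s[of j]]]
      by (cases "i \<le> j") auto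
    then show ?thesis
      by blast
  qed
  from Cauchy_limit[OF s this] obtain p where p: "p \<in> \<Theta> k"
    and lim: "(\<lambda>n. N k ((\<Sum>j<n. q j) - p)) \<longlonglongrightarrow> 0"
    by blast
  have "(\<lambda>j. q j x) sums p x" for x
    using eval_tendsto[OF s p lim, of x] by (simp add: sums_def sum_fun_apply)
  with p show ?thesis
    by blast
qed

text \<open>The model of the space on the side of Taylor terms at 0: a weighted l1-condition for
  every radius. \<open>HTb_iff\<close> identifies the two sides.\<close>

definition rapid :: "(nat \<Rightarrow> 'a \<Rightarrow> complex) \<Rightarrow> bool"
  where "rapid P \<longleftrightarrow> (\<forall>m. P m \<in> \<Theta> m) \<and> (\<forall>\<rho>>0. summable (\<lambda>m. \<rho> ^ m * N m (P m)))"

definition power_sum :: "(nat \<Rightarrow> 'a \<Rightarrow> complex) \<Rightarrow> 'a \<Rightarrow> complex"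
  where "power_sum P = (\<lambda>x. \<Sum>m. P m x)"

lemma rapidD:
  assumes "rapid P"
  shows "P m \<in> \<Theta> m" and "\<rho> \<ge> 0 \<Longrightarrow> summable (\<lambda>m. \<rho> ^ m * N m (P m))"
proof -
  show "summable (\<lambda>m. \<rho> ^ m * N m (P m))" if "\<rho> \<ge> 0"
  proof (cases "\<rho> = 0")
    case True
    then show ?thesis
      using summable_0_powser[of "\<lambda>m. N m (P m)"] by (simp add: mult.commute)
  qed (use assms that in \<open>auto simp: rapid_def\<close>)
qed (use assms in \<open>simp add: rapid_def\<close>)

text \<open>Geometric factors are harmless because every radius is allowed: \<open>C\<close> is
  absorbed into \<open>\<rho>\<close>.\<close>

lemma rapid_le:
  assumes "\<And>m. Q m \<in> \<Theta> m" and "C > 0" and "\<And>m. N m (Q m) \<le> C ^ m * a m" 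
    and "\<And>\<rho>. \<rho> > 0 \<Longrightarrow> summable (\<lambda>m. \<rho> ^ m * a m)"
  shows "rapid Q"
  unfolding rapid_def
proof (intro conjI allI impI)
  fix \<rho> :: real assume "\<rho> > 0"
  have "summable (\<lambda>m. (\<rho> * C) ^ m * a m)"
    using assms(2,4) \<open>\<rho> > 0\<close> by simp
  then show "summable (\<lambda>m. \<rho> ^ m * N m (Q m))"
  proof (rule summable_comparison_test'[where N = 0])
    fix m
    have "\<rho> ^ m * N m (Q m) \<le> \<rho> ^ m * (C ^ m * a m)"
      using assms(3)[of m] \<open>\<rho> > 0\<close> by (intro mult_left_mono) auto
    then show "norm (\<rho> ^ m * N m (Q m)) \<le> (\<rho> * C) ^ m * a m"
      using N_nonneg[OF assms(1)] \<open>\<rho> > 0\<close> by (simp add: power_mult_distrib mult_ac)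
  qed
qed (rule assms(1))

lemma rapid_eval_bound:
  assumes "rapid P"
  shows "cmod (P m x) \<le> (\<sigma> * norm x) ^ m * N m (P m)"
  using eval_bound[OF rapidD(1)[OF assms]] by (simp add: power_mult_distrib mult_ac)

lemma rapid_sums:
  assumes "rapid P"
  shows "(\<lambda>m. P m x) sums power_sum P x"
proof -
  have "summable (\<lambda>m. (\<sigma> * norm x) ^ m * N m (P m))"
    using rapidD(2)[OF assms] sigma_ge_1 by simp
  then have "summable (\<lambda>m. P m x)"
    by (rule summable_comparison_test') (rule rapid_eval_bound[OF assms])
  then show ?thesis
    unfolding power_sum_def by (rule summable_sums)
qed

lemma power_sum_taylor_at_0:
  assumes "rapid P"
  shows "taylor_series_at (power_sum P) 0 P"
  unfolding taylor_series_at_def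
proof (intro conjI allI exI[of _ 1])
  show "P m \<in> cpoly m" for m
    using rapidD(1)[OF assms] subset_cpoly by blast
  have "uniform_limit (ball 0 1) (\<lambda>n x. \<Sum>m<n. P m x) (\<lambda>x. suminf (\<lambda>m. P m x)) sequentially"
  proof (rule Weierstrass_m_test)
    show "summable (\<lambda>m. \<sigma> ^ m * N m (P m))"
      using rapidD(2)[OF assms] sigma_ge_1 by simp
    fix m x assume "x \<in> ball (0::'a) 1"
    then have "(\<sigma> * norm x) ^ m \<le> \<sigma> ^ m"
      using sigma_ge_1 by (intro power_mono) (auto simp: mult_left_le)
    then have "(\<sigma> * norm x) ^ m * N m (P m) \<le> \<sigma> ^ m * N m (P m)"
      using N_nonneg[OF rapidD(1)[OF assms]] by (rule mult_right_mono)
    with rapid_eval_bound[OF assms, of m x] show "cmod (P m x) \<le> \<sigma> ^ m * N m (P m)"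
      by linarith
  qed
  then show "uniform_limit (ball 0 1) (\<lambda>n x. \<Sum>m<n. P m x) (\<lambda>x. power_sum P (0 + x)) sequentially"
    by (simp add: power_sum_def)
qed simp

text \<open>The degree \<open>k\<close> part at \<open>a\<close> is the sum over \<open>m\<close> of the degree \<open>k\<close> parts of the \<open>P m\<close>; it
  converges in \<open>\<Theta> k\<close>, which is where completeness of \<open>\<Theta> k\<close> enters.\<close>

lemma power_sum_taylor_at:
  assumes P: "rapid P"
  shows "\<exists>Q. taylor_series_at (power_sum P) a Q"
proof -
  note PT = rapidD(1)[OF P]
  \<comment> \<open>Being at least 1, \<open>s\<close> has increasing powers, so
    \<open>norm a ^ (m - k) \<le> s ^ m\<close> for all \<open>k\<close> at once.\<close>
  define s where "s = max 1 (norm a)"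
  define t where "t = (\<lambda>m k. if k \<le> m then taylor_coeff (P m) a k else 0)"
  define B where "B = (\<lambda>m. (\<sigma> * s) ^ m * N m (P m))"
  \<comment> \<open>One \<open>\<sigma>\<close> pays for the derivative at \<open>a\<close>, the
    other for evaluation at \<open>x\<close>, and \<open>2 ^ m\<close> for the number of degrees in
    \<open>P m\<close>.\<close>
  define C where "C = (\<lambda>m. (2 * \<sigma> * \<sigma> * s) ^ m * N m (P m))"
  have s: "s \<ge> 1" "norm a \<le> s"
    by (auto simp: s_def)
  have B: "summable B"
    using rapidD(2)[OF P, of "\<sigma> * s"] sigma_ge_1 s by (simp add: B_def)
  have C: "summable C"
    using rapidD(2)[OF P, of "2 * \<sigma> * \<sigma> * s"] sigma_ge_1 s by (simp add: C_def)
  have B0: "B m \<ge> 0" for m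
    using N_nonneg[OF PT] sigma_ge_1 s by (simp add: B_def)
  have tT: "t m k \<in> \<Theta> k" for m k
    using taylor_coeff_mem[OF _ PT] Theta_0 by (simp add: t_def)
  have tB: "N k (t m k) \<le> B m" for m k
  proof (cases "k \<le> m")
    case True
    have "norm a ^ (m - k) \<le> s ^ (m - k)"
      using s by (intro power_mono) auto
    also have "\<dots> \<le> s ^ m"
      using s by (intro power_increasing) auto
    finally have "\<sigma> ^ m * N m (P m) * norm a ^ (m - k) \<le> \<sigma> ^ m * N m (P m) * s ^ m"
      using sigma_ge_1 N_nonneg[OF PT] by (intro mult_left_mono) auto
    then show ?thesis
      using taylor_coeff_bound[OF True PT, of a] True
      by (simp add: t_def B_def power_mult_distrib mult_ac)
  qed (simp add: t_def N_0 B0)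
  have "\<exists>Q\<in>\<Theta> k. \<forall>x. (\<lambda>m. t m k x) sums Q x" for k
    using tB N_nonneg[OF tT] by (intro summable_series[OF tT] summable_comparison_test'[OF B]) auto
  then obtain Q where Q: "\<And>k. Q k \<in> \<Theta> k" and Qs: "\<And>k x. (\<lambda>m. t m k x) sums Q k x"
    by metis
  \<comment> \<open>For \<open>m < n\<close> the polynomial \<open>P m\<close> is already exhausted
    by its parts of degree below \<open>n\<close>, so only the indices \<open>m \<ge> n\<close>
    contribute to the error; the resulting bound is uniform in \<open>x\<close>.\<close>
  have tail: "dist (\<Sum>k<n. Q k x) (power_sum P (a + x)) \<le> (\<Sum>m. if m \<in> {n..} then C m else 0)"
    (is "_ \<le> suminf ?C") if x: "norm x < 1" for n x
  proof -
    have teval: "cmod (t m k x) \<le> (\<sigma> * \<sigma> * s) ^ m * N m (P m)" if "k \<le> m" for m k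
    proof -
      have "cmod (t m k x) \<le> \<sigma> ^ k * N k (t m k) * norm x ^ k"
        by (rule eval_bound[OF tT])
      also have "\<dots> \<le> \<sigma> ^ m * B m * 1"
        using sigma_ge_1 tB that x N_nonneg[OF tT] B0
        by (intro mult_mono power_increasing power_le_one mult_nonneg_nonneg) auto
      finally show ?thesis
        by (simp add: B_def power_mult_distrib mult_ac)
    qed
    have expand: "P m (a + x) = (\<Sum>k\<le>m. t m k x)" for m
      using taylor_coeff_cpoly(1)[of "P m" m a x] PT subset_cpoly by (auto simp: t_def)
    have "cmod (P m (a + x) - (\<Sum>k<n. t m k x)) \<le> ?C m" for m
    proof (cases "m \<in> {n..}")
      case True
      then have "P m (a + x) - (\<Sum>k<n. t m k x) = (\<Sum>k=n..m. t m k x)"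
        using sum_diff_nat_ivl[of 0 n "Suc m" "\<lambda>k. t m k x"]
        by (simp add: expand lessThan_atLeast0 atLeastLessThanSuc_atLeastAtMost atLeast0AtMost)
      also have "cmod \<dots> \<le> (\<Sum>k=n..m. (\<sigma> * \<sigma> * s) ^ m * N m (P m))"
        using teval by (intro sum_norm_le) auto
      also have "\<dots> = real (Suc m - n) * ((\<sigma> * \<sigma> * s) ^ m * N m (P m))"
        by simp
      also have "\<dots> \<le> 2 ^ m * ((\<sigma> * \<sigma> * s) ^ m * N m (P m))"
      proof (rule mult_right_mono)
        have "m < 2 ^ m"
          by simp
        then have "Suc m - n \<le> 2 ^ m"
          by linarith
        then show "real (Suc m - n) \<le> 2 ^ m"
          by (metis of_nat_le_iff of_nat_numeral of_nat_power)
      qed (use sigma_ge_1 s N_nonneg[OF PT] in simp)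
      also have "\<dots> = C m"
        by (simp add: C_def power_mult_distrib)
      finally show ?thesis
        using True by simp
    next
      case False
      then have "(\<Sum>k<n. t m k x) = (\<Sum>k\<le>m. t m k x)"
        by (intro sum.mono_neutral_right) (auto simp: t_def)
      with False show ?thesis
        by (simp add: expand)
    qed
    moreover have "(\<lambda>m. P m (a + x) - (\<Sum>k<n. t m k x)) sums (power_sum P (a + x) - (\<Sum>k<n. Q k x))"
      by (intro sums_diff rapid_sums[OF P] sums_sum Qs)
    moreover have "summable ?C"
      using N_nonneg[OF PT] sigma_ge_1 s by (intro summable_comparison_test'[OF C]) (auto simp: C_def)
    ultimately show ?thesis
      using norm_suminf_le[of "\<lambda>m. P m (a + x) - (\<Sum>k<n. t m k x)" ?C]
      by (simp add: sums_iff dist_norm norm_minus_commute)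
  qed
  have "(\<lambda>n. \<Sum>m. if m \<in> {n..} then C m else 0) \<longlonglongrightarrow> 0"
  proof -
    have "(\<Sum>m. if m \<in> {n..} then C m else 0) = (\<Sum>m. C (m + n))" for n
    proof -
      have "(\<lambda>m. C (m + n)) sums (\<Sum>m. C (m + n))"
        by (intro summable_sums summable_ignore_initial_segment C)
      then have "(\<lambda>m. if m + n \<in> {n..} then C (m + n) else 0) sums (\<Sum>m. C (m + n))"
        by simp
      then have "(\<lambda>m. if m \<in> {n..} then C m else 0) sums
          ((\<Sum>m. C (m + n)) + (\<Sum>m<n. if m \<in> {n..} then C m else 0))"
        by (subst (asm) sums_iff_shift) simp
      then show ?thesis
        by (simp add: sums_iff)
    qed
    moreover have "(\<lambda>n. \<Sum>m. C (m + n)) \<longlonglongrightarrow> 0"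
      by (rule suminf_exist_split2[OF C])
    ultimately show ?thesis
      by simp
  qed
  then have "uniform_limit (ball 0 1) (\<lambda>n x. \<Sum>k<n. Q k x) (\<lambda>x. power_sum P (a + x)) sequentially"
    unfolding uniform_limit_iff
  proof (intro allI impI)
    fix e :: real assume lim: "(\<lambda>n. \<Sum>m. if m \<in> {n..} then C m else 0) \<longlonglongrightarrow> 0" and "e > 0"
    then have "\<forall>\<^sub>F n in sequentially. (\<Sum>m. if m \<in> {n..} then C m else 0) < e"
      by (rule order_tendstoD)
    then show "\<forall>\<^sub>F n in sequentially. \<forall>x\<in>ball 0 1. dist (\<Sum>k<n. Q k x) (power_sum P (a + x)) < e"
    proof eventually_elim
      case (elim n)
      show ?case
      proof
        fix x :: 'a assume "x \<in> ball 0 1"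
        then have "norm x < 1"
          by simp
        from le_less_trans[OF tail[OF this] elim]
        show "dist (\<Sum>k<n. Q k x) (power_sum P (a + x)) < e" .
      qed
    qed
  qed
  moreover have "Q k \<in> cpoly k" for k
    using Q subset_cpoly by blast
  ultimately show ?thesis
    unfolding taylor_series_at_def by (intro exI[of _ Q]) (auto intro!: exI[of _ 1])
qed

section \<open>The space as a weighted sequence space\<close>

lemma taylor_coeff_power_sum: "rapid P \<Longrightarrow> taylor_coeff (power_sum P) 0 = P"
  by (rule taylor_coeff_eqI[OF power_sum_taylor_at_0])

text \<open>From left to right \<open>entire_sums\<close> recovers \<open>f\<close> from its Taylor
  terms on the whole space; from right to left \<open>power_sum_taylor_at\<close> supplies
  expansions at all points.\<close>

lemma HTb_iff: "f \<in> HTb \<Theta> N \<longleftrightarrow> (\<exists>P. rapid P \<and> f = power_sum P)"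
proof
  assume f: "f \<in> HTb \<Theta> N"
  define P where "P = taylor_coeff f 0"
  have P: "P m \<in> \<Theta> m" for m
    using f by (simp add: HTb_def P_def taylor_coeff_def)
  have "1 / fact m * N m (dhat m f 0) = N m (P m)" for m
    using N_scale[OF P] by (simp add: dhat_taylor_coeff P_def)
  then have "(\<lambda>m. root m (N m (P m))) \<longlonglongrightarrow> 0"
    using f by (simp add: HTb_def)
  then have "rapid P"
    using P N_nonneg[OF P] by (auto simp: rapid_def intro!: root_tendsto_0_imp_summable)
  moreover have "f = power_sum P"
    using entire_sums[of f] f by (auto simp: HTb_def power_sum_def sums_iff P_def)
  ultimately show "\<exists>P. rapid P \<and> f = power_sum P"
    by blast
next
  assume "\<exists>P. rapid P \<and> f = power_sum P"
  then obtain P where P: "rapid P" and f: "f = power_sum P"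
    by blast
  note PT = rapidD(1)[OF P]
  have tc: "taylor_coeff f 0 = P"
    by (simp add: f taylor_coeff_power_sum[OF P])
  have "1 / fact m * N m (dhat m f 0) = N m (P m)" for m
    using N_scale[OF PT] by (simp add: dhat_taylor_coeff tc)
  moreover have "(\<lambda>m. root m (N m (P m))) \<longlonglongrightarrow> 0"
    using N_nonneg[OF PT] P by (intro summable_imp_root_tendsto_0) (auto simp: rapid_def)
  moreover have "f \<in> entire"
    using power_sum_taylor_at[OF P] by (simp add: entire_def f)
  ultimately show "f \<in> HTb \<Theta> N"
    using PT by (simp add: HTb_def tc flip: taylor_coeff_def)
qed

lemma HTb_taylor_coeff:
  assumes "f \<in> HTb \<Theta> N"
  shows "rapid (taylor_coeff f 0)" and "power_sum (taylor_coeff f 0) = f"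
  using assms by (auto simp: HTb_iff taylor_coeff_power_sum)

lemma HTb_seminorm_power_sum:
  assumes "rapid P"
  shows "HTb_seminorm N \<rho> (power_sum P) = (\<Sum>m. \<rho> ^ m * N m (P m))"
  using N_scale[OF rapidD(1)[OF assms]]
  by (simp add: HTb_seminorm_def dhat_taylor_coeff taylor_coeff_power_sum[OF assms])

lemma HTb_seminorm_le:
  assumes "rapid P" and "\<rho> \<ge> 0" and "\<And>m. \<rho> ^ m * N m (P m) \<le> a m" and "a sums s"
  shows "HTb_seminorm N \<rho> (power_sum P) \<le> s"
  using suminf_le[of "\<lambda>m. \<rho> ^ m * N m (P m)" a] rapidD(2)[OF assms(1,2)] assms(3,4)
  by (simp add: HTb_seminorm_power_sum[OF assms(1)] sums_iff)

lemma rapid_add: "rapid P \<Longrightarrow> rapid Q \<Longrightarrow> rapid (\<lambda>m. P m + Q m)"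
  and rapid_scale: "rapid P \<Longrightarrow> rapid (\<lambda>m. fscale c (P m))"
proof -
  show "rapid (\<lambda>m. P m + Q m)" if "rapid P" "rapid Q"
  proof (rule rapid_le[where C = 1 and a = "\<lambda>m. N m (P m) + N m (Q m)"])
    show "summable (\<lambda>m. \<rho> ^ m * (N m (P m) + N m (Q m)))" if "\<rho> > 0" for \<rho>
      using \<open>rapid P\<close> \<open>rapid Q\<close> that unfolding rapid_def distrib_left by (intro summable_add) auto
  qed (use that rapidD in \<open>auto intro: Theta_add N_add\<close>)
  show "rapid (\<lambda>m. fscale c (P m))" if "rapid P"
  proof (rule rapid_le[where C = 1 and a = "\<lambda>m. cmod c * N m (P m)"])
    show "summable (\<lambda>m. \<rho> ^ m * (cmod c * N m (P m)))" if "\<rho> > 0" for \<rho>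
      using summable_mult[of "\<lambda>m. \<rho> ^ m * N m (P m)" "cmod c"] \<open>rapid P\<close> that
      by (simp add: rapid_def mult_ac)
  qed (use that rapidD in \<open>auto intro: Theta_scale simp: N_scale\<close>)
qed

lemma rapid_0: "rapid (\<lambda>_. 0)"
  by (simp add: rapid_def Theta_0 N_0)

lemma power_sum_0: "power_sum (\<lambda>_. 0) = 0"
  by (rule ext) (simp add: power_sum_def)

lemma power_sum_add: "rapid P \<Longrightarrow> rapid Q \<Longrightarrow> power_sum P + power_sum Q = power_sum (\<lambda>m. P m + Q m)"
  using sums_add[OF rapid_sums[of P] rapid_sums[of Q]]
  by (auto simp: fun_eq_iff sums_iff power_sum_def)

lemma power_sum_scale: "rapid P \<Longrightarrow> fscale c (power_sum P) = power_sum (\<lambda>m. fscale c (P m))"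
  using sums_mult[OF rapid_sums[of P], of c]
  by (auto simp: fun_eq_iff sums_iff power_sum_def fscale_def)

lemma subspace_HTb: "cfun.subspace (HTb \<Theta> N)"
proof (rule cfun.subspaceI)
  show "0 \<in> HTb \<Theta> N"
    unfolding HTb_iff using rapid_0 power_sum_0 by metis
next
  fix f g assume "f \<in> HTb \<Theta> N" "g \<in> HTb \<Theta> N"
  then obtain P Q where "rapid P" "f = power_sum P" "rapid Q" "g = power_sum Q"
    unfolding HTb_iff by blast
  then show "f + g \<in> HTb \<Theta> N"
    unfolding HTb_iff by (intro exI[of _ "\<lambda>m. P m + Q m"]) (simp add: power_sum_add rapid_add)
next
  fix c f assume "f \<in> HTb \<Theta> N"
  then obtain P where "rapid P" "f = power_sum P"
    unfolding HTb_iff by blast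
  then show "fscale c f \<in> HTb \<Theta> N"
    unfolding HTb_iff by (intro exI[of _ "\<lambda>m. fscale c (P m)"]) (simp add: power_sum_scale rapid_scale)
qed

lemma seminorm_nonneg:
  assumes "f \<in> HTb \<Theta> N" "\<rho> \<ge> 0"
  shows "0 \<le> HTb_seminorm N \<rho> f"
proof -
  obtain P where P: "rapid P" "f = power_sum P"
    using assms by (auto simp: HTb_iff)
  show ?thesis
    unfolding P HTb_seminorm_power_sum[OF P(1)]
    using assms rapidD[OF P(1)] N_nonneg by (intro suminf_nonneg) auto
qed

lemma seminorm_scale:
  assumes "f \<in> HTb \<Theta> N" "\<rho> \<ge> 0"
  shows "HTb_seminorm N \<rho> (fscale c f) = cmod c * HTb_seminorm N \<rho> f"
proof -
  obtain P where P: "rapid P" "f = power_sum P"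
    using assms by (auto simp: HTb_iff)
  have eq: "\<rho> ^ m * N m (fscale c (P m)) = cmod c * (\<rho> ^ m * N m (P m))" for m
    by (simp add: N_scale[OF rapidD(1)[OF P(1)]])
  from suminf_mult[OF rapidD(2)[OF P(1) assms(2)], of "cmod c"] show ?thesis
    unfolding P(2) power_sum_scale[OF P(1)] HTb_seminorm_power_sum[OF P(1)]
      HTb_seminorm_power_sum[OF rapid_scale[OF P(1)]] eq .
qed

lemma seminorm_add:
  assumes "f \<in> HTb \<Theta> N" "g \<in> HTb \<Theta> N" "\<rho> \<ge> 0"
  shows "HTb_seminorm N \<rho> (f + g) \<le> HTb_seminorm N \<rho> f + HTb_seminorm N \<rho> g"
proof -
  obtain P Q where P: "rapid P" "f = power_sum P" and Q: "rapid Q" "g = power_sum Q"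
    using assms by (auto simp: HTb_iff)
  have "HTb_seminorm N \<rho> (f + g) \<le> (\<Sum>m. \<rho> ^ m * N m (P m)) + (\<Sum>m. \<rho> ^ m * N m (Q m))"
    unfolding P Q power_sum_add[OF P(1) Q(1)]
  proof (rule HTb_seminorm_le)
    show "(\<lambda>m. \<rho> ^ m * N m (P m) + \<rho> ^ m * N m (Q m)) sums
        ((\<Sum>m. \<rho> ^ m * N m (P m)) + (\<Sum>m. \<rho> ^ m * N m (Q m)))"
      using rapidD(2) P Q assms by (intro sums_add summable_sums) auto
    show "\<rho> ^ m * N m (P m + Q m) \<le> \<rho> ^ m * N m (P m) + \<rho> ^ m * N m (Q m)" for m
      using N_add[OF rapidD(1)[OF P(1)] rapidD(1)[OF Q(1)], of m] assms
      by (simp add: mult_left_mono flip: distrib_left)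
  qed (use P Q assms in \<open>auto intro: rapid_add\<close>)
  then show ?thesis
    by (simp add: P Q HTb_seminorm_power_sum)
qed

lemma seminorm_mono:
  assumes "f \<in> HTb \<Theta> N" "0 \<le> \<rho>" "\<rho> \<le> \<rho>'"
  shows "HTb_seminorm N \<rho> f \<le> HTb_seminorm N \<rho>' f"
proof -
  obtain P where P: "rapid P" "f = power_sum P"
    using assms by (auto simp: HTb_iff)
  show ?thesis
    unfolding P HTb_seminorm_power_sum[OF P(1)] using assms rapidD[OF P(1)] N_nonneg
    by (intro suminf_le mult_right_mono power_mono) auto
qed

lemma eval_le_seminorm:
  assumes "f \<in> HTb \<Theta> N"
  shows "cmod (f x) \<le> HTb_seminorm N (\<sigma> * norm x) f"
proof -
  obtain P where P: "rapid P" "f = power_sum P"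
    using assms by (auto simp: HTb_iff)
  have "summable (\<lambda>m. (\<sigma> * norm x) ^ m * N m (P m))"
    using rapidD(2)[OF P(1)] sigma_ge_1 by simp
  then show ?thesis
    unfolding P HTb_seminorm_power_sum[OF P(1)] unfolding power_sum_def
    by (rule norm_suminf_le[OF rapid_eval_bound[OF P(1)]])
qed

text \<open>The proof of completeness for weighted l1-sums: terms converge degree by degree in the
  Banach spaces \<open>\<Theta> m\<close>, and seminorm estimates survive the limit because they are
  made for finite partial sums. Integer radii reach every radius, since seminorms increase with
  it.\<close>

lemma HTb_complete:
  assumes s: "\<And>i. s i \<in> HTb \<Theta> N"
    and C: "\<And>n e. e > 0 \<Longrightarrow> \<exists>J. \<forall>i\<ge>J. \<forall>j\<ge>J. HTb_seminorm N (real (Suc n)) (s i - s j) < e"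
  shows "\<exists>f\<in>HTb \<Theta> N. \<forall>n. (\<lambda>i. HTb_seminorm N (real (Suc n)) (s i - f)) \<longlonglongrightarrow> 0"
proof -
  define T where "T = (\<lambda>i. taylor_coeff (s i) 0)"
  have T: "rapid (T i)" and sT: "s i = power_sum (T i)" for i
    using HTb_taylor_coeff[OF s] by (simp_all add: T_def)
  note TT = rapidD(1)[OF T]
  have rd: "rapid (\<lambda>m. T i m - Q m)" if "rapid Q" for i Q
    using rapid_add[OF T[of i] rapid_scale[OF that, of "-1"]] by (simp add: cfun.scale_minus_left)
  have sd: "s i - power_sum Q = power_sum (\<lambda>m. T i m - Q m)" if "rapid Q" for i Q
    using power_sum_add[OF T[of i] rapid_scale[OF that, of "-1"]]
    unfolding power_sum_scale[OF that, symmetric] by (simp add: cfun.scale_minus_left sT)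
  have partial: "(\<Sum>m\<in>I. real (Suc n) ^ m * N m (T i m - T j m)) \<le> HTb_seminorm N (real (Suc n)) (s i - s j)"
    if "finite I" for n i j I
    unfolding sT[of j] sd[OF T] HTb_seminorm_power_sum[OF rd[OF T]]
    using that by (intro sum_le_suminf rapidD rd T) (auto intro!: mult_nonneg_nonneg N_nonneg Theta_diff TT)
  have "\<exists>p\<in>\<Theta> m. (\<lambda>i. N m (T i m - p)) \<longlonglongrightarrow> 0" for m
  proof (rule Cauchy_limit[OF TT])
    fix e :: real assume "e > 0"
    then obtain J where J: "\<And>i j. i \<ge> J \<Longrightarrow> j \<ge> J \<Longrightarrow> HTb_seminorm N (real (Suc 0)) (s i - s j) < e"
      using C[of e 0] by blast
    have "N m (T i m - T j m) \<le> HTb_seminorm N (real (Suc 0)) (s i - s j)" for i j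
      using partial[of "{m}" 0 i j] by simp
    with J show "\<exists>J. \<forall>i\<ge>J. \<forall>j\<ge>J. N m (T i m - T j m) < e"
      by (meson le_less_trans)
  qed
  then obtain P where PT: "\<And>m. P m \<in> \<Theta> m" and lim: "\<And>m. (\<lambda>i. N m (T i m - P m)) \<longlonglongrightarrow> 0"
    by metis
  \<comment> \<open>Letting \<open>j\<close> tend to infinity is legitimate in a finite sum; as
    \<open>J\<close> does not depend on \<open>M\<close>, the bound holds for the whole
    series.\<close>
  have key: "\<exists>J. \<forall>i\<ge>J. \<forall>M. (\<Sum>m<M. real (Suc n) ^ m * N m (T i m - P m)) \<le> e" if e: "e > 0" for n e
  proof -
    obtain J where J: "\<And>i j. i \<ge> J \<Longrightarrow> j \<ge> J \<Longrightarrow> HTb_seminorm N (real (Suc n)) (s i - s j) < e"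
      using C[OF e, of n] by blast
    have "(\<Sum>m<M. real (Suc n) ^ m * N m (T i m - P m)) \<le> e" if i: "i \<ge> J" for i M
    proof -
      have "(\<lambda>j. N m (T i m - T j m)) \<longlonglongrightarrow> N m (T i m - P m)" for m
      proof -
        have "\<bar>N m (T i m - T j m) - N m (T i m - P m)\<bar> \<le> N m (T j m - P m)" for j
        proof -
          have *: "T i m - T j m = (T i m - P m) - (T j m - P m)" "T i m - P m = (T i m - T j m) + (T j m - P m)"
            by simp_all
          show ?thesis
            using N_diff[OF Theta_diff[OF TT[of i m] PT] Theta_diff[OF TT[of j m] PT]]
              N_add[OF Theta_diff[OF TT[of i m] TT[of j m]] Theta_diff[OF TT[of j m] PT]]
            by (simp flip: *)
        qed
        then have "(\<lambda>j. N m (T i m - T j m) - N m (T i m - P m)) \<longlonglongrightarrow> 0"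
          by (intro Lim_null_comparison[OF _ lim[of m]]) simp
        then show ?thesis
          by (simp add: LIM_zero_iff)
      qed
      then have "(\<lambda>j. \<Sum>m<M. real (Suc n) ^ m * N m (T i m - T j m))
          \<longlonglongrightarrow> (\<Sum>m<M. real (Suc n) ^ m * N m (T i m - P m))"
        by (intro tendsto_intros)
      moreover have "(\<Sum>m<M. real (Suc n) ^ m * N m (T i m - T j m)) \<le> e" if "j \<ge> J" for j
        using partial[of "{..<M}" n i j] J[OF i that] by simp
      ultimately show ?thesis
        by (intro LIMSEQ_le_const2) auto
    qed
    then show ?thesis
      by blast
  qed
  have nn: "real (Suc n) ^ m * N m (T i m - P m) \<ge> 0" for n m i
    using N_nonneg[OF Theta_diff[OF TT PT]] by simp
  have P: "rapid P"
    unfolding rapid_def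
  proof (intro conjI allI impI PT)
    fix \<rho> :: real assume \<rho>: "\<rho> > 0"
    obtain n where n: "\<rho> \<le> real n"
      using real_arch_simple by blast
    \<comment> \<open>Membership of the limit follows from one \<open>T i\<close> at finite distance
      from it.\<close>
    obtain i where i: "\<And>M. (\<Sum>m<M. real (Suc n) ^ m * N m (T i m - P m)) \<le> 1"
      using key[of 1 n] by auto
    have "summable (\<lambda>m. real (Suc n) ^ m * N m (T i m - P m))"
      using nn i[of "Suc _", unfolded lessThan_Suc_atMost] by (rule bounded_imp_summable)
    then have sm: "summable (\<lambda>m. real (Suc n) ^ m * N m (T i m) + real (Suc n) ^ m * N m (T i m - P m))"
      by (intro summable_add rapidD(2)[OF T]) auto
    have "norm (\<rho> ^ m * N m (P m)) \<le> real (Suc n) ^ m * N m (T i m) + real (Suc n) ^ m * N m (T i m - P m)" for m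
    proof -
      have "P m = T i m - (T i m - P m)"
        by simp
      then have "N m (P m) \<le> N m (T i m) + N m (T i m - P m)"
        using N_diff[OF TT[of i m] Theta_diff[OF TT[of i m] PT]] by simp
      moreover have "\<rho> ^ m \<le> real (Suc n) ^ m"
        using n \<rho> by (intro power_mono) auto
      ultimately have "\<rho> ^ m * N m (P m) \<le> real (Suc n) ^ m * (N m (T i m) + N m (T i m - P m))"
        using N_nonneg[OF PT] by (intro mult_mono) auto
      then show ?thesis
        using \<rho> N_nonneg[OF PT] by (simp add: distrib_left)
    qed
    then show "summable (\<lambda>m. \<rho> ^ m * N m (P m))"
      by (intro summable_comparison_test'[OF sm, where N = 0])
  qed
  have "(\<lambda>i. HTb_seminorm N (real (Suc n)) (s i - power_sum P)) \<longlonglongrightarrow> 0" for n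
  proof (rule tendstoI)
    fix e :: real assume e: "e > 0"
    then obtain J where J: "\<And>i M. i \<ge> J \<Longrightarrow> (\<Sum>m<M. real (Suc n) ^ m * N m (T i m - P m)) \<le> e / 2"
      using key[of "e / 2" n] by auto
    have "dist (HTb_seminorm N (real (Suc n)) (s i - power_sum P)) 0 < e" if "i \<ge> J" for i
    proof -
      have "HTb_seminorm N (real (Suc n)) (s i - power_sum P) \<le> e / 2"
        unfolding sd[OF P] HTb_seminorm_power_sum[OF rd[OF P]]
        using J[OF that] rapidD(2)[OF rd[OF P]] by (intro suminf_le_const) auto
      moreover have "HTb_seminorm N (real (Suc n)) (s i - power_sum P) \<ge> 0"
        unfolding sd[OF P] using rd[OF P] by (intro seminorm_nonneg) (auto simp: HTb_iff)
      ultimately show ?thesis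
        using e by simp
    qed
    then show "\<forall>\<^sub>F i in sequentially. dist (HTb_seminorm N (real (Suc n)) (s i - power_sum P)) 0 < e"
      unfolding eventually_sequentially by blast
  qed
  moreover have "power_sum P \<in> HTb \<Theta> N"
    using P by (auto simp: HTb_iff)
  ultimately show ?thesis
    by blast
qed

end

section \<open>A hypercyclicity criterion\<close>

text \<open>The criterion is carried out for a group with an increasing sequence of seminorms.
  Monotonicity lets finitely many smallness conditions be merged into one with a large
  index.\<close>

locale seminormed_group =
  fixes X :: "'b::ab_group_add set" and p :: "nat \<Rightarrow> 'b \<Rightarrow> real"
  assumes zero_mem: "0 \<in> X"
    and diff_mem: "f \<in> X \<Longrightarrow> g \<in> X \<Longrightarrow> f - g \<in> X"
    and p_zero: "p n 0 = 0"
    and p_diff: "f \<in> X \<Longrightarrow> g \<in> X \<Longrightarrow> p n (f - g) \<le> p n f + p n g"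
    and p_mono: "f \<in> X \<Longrightarrow> m \<le> n \<Longrightarrow> p m f \<le> p n f"
begin

lemma minus_mem: "f \<in> X \<Longrightarrow> - f \<in> X"
  using diff_mem[OF zero_mem] by simp

lemma add_mem: "f \<in> X \<Longrightarrow> g \<in> X \<Longrightarrow> f + g \<in> X"
  using diff_mem[OF _ minus_mem] by simp

lemma p_minus: "f \<in> X \<Longrightarrow> p n (- f) = p n f"
  using p_diff[OF zero_mem, of f n] p_diff[OF zero_mem minus_mem, of f n] by (simp add: p_zero)

lemma p_nonneg: "f \<in> X \<Longrightarrow> 0 \<le> p n f"
  using p_diff[of f f n] by (simp add: p_zero)

lemma p_add: "f \<in> X \<Longrightarrow> g \<in> X \<Longrightarrow> p n (f + g) \<le> p n f + p n g"
  using p_diff[OF _ minus_mem, of f g n] by (simp add: p_minus)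

lemma p_commute: "f \<in> X \<Longrightarrow> g \<in> X \<Longrightarrow> p n (f - g) = p n (g - f)"
  using p_minus[OF diff_mem, of f g n] by simp

lemma p_triangle: "f \<in> X \<Longrightarrow> g \<in> X \<Longrightarrow> h \<in> X \<Longrightarrow> p n (f - h) \<le> p n (f - g) + p n (g - h)"
  using p_add[OF diff_mem diff_mem, of f g g h n] by simp

text \<open>Approximation in one seminorm at a time gives the full closure because the seminorms
  increase.\<close>

definition cl :: "'b set \<Rightarrow> 'b set"
  where "cl V = {f \<in> X. \<forall>n. \<forall>e>0. \<exists>g\<in>V. p n (f - g) < e}"

lemma clI:
  assumes "f \<in> X" and "\<And>n e. e > 0 \<Longrightarrow> \<exists>g\<in>V. p n (f - g) < e"
  shows "f \<in> cl V"
  using assms by (simp add: cl_def)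

lemma clD:
  assumes "f \<in> cl V"
  shows "f \<in> X" and "e > 0 \<Longrightarrow> \<exists>g\<in>V. p n (f - g) < e"
  using assms by (auto simp: cl_def)

lemma cl_superset: "V \<subseteq> X \<Longrightarrow> V \<subseteq> cl V"
  by (force intro: clI simp: p_zero)

lemma cl_cl:
  assumes "V \<subseteq> X"
  shows "cl (cl V) \<subseteq> cl V"
proof
  fix f assume f: "f \<in> cl (cl V)"
  show "f \<in> cl V"
  proof (rule clI)
    show "f \<in> X"
      using f by (rule clD)
    fix n and e :: real assume "e > 0"
    then obtain g where g: "g \<in> cl V" "p n (f - g) < e / 2"
      using clD(2)[OF f, of "e / 2" n] by auto
    then obtain h where h: "h \<in> V" "p n (g - h) < e / 2"
      using clD(2)[OF g(1), of "e / 2" n] \<open>e > 0\<close> by auto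
    then have "p n (f - h) < e"
      using p_triangle[OF clD(1)[OF f] clD(1)[OF g(1)], of h n] g h assms by force
    then show "\<exists>g\<in>V. p n (f - g) < e"
      using h by blast
  qed
qed

lemma cl_limit:
  assumes V: "V \<subseteq> X" and f: "f \<in> X" and s: "\<And>k. s k \<in> cl V"
    and lim: "\<And>n. (\<lambda>k. p n (f - s k)) \<longlonglongrightarrow> 0"
  shows "f \<in> cl V"
proof -
  have "f \<in> cl (cl V)"
  proof (rule clI[OF f])
    fix n and e :: real assume "e > 0"
    then have "\<forall>\<^sub>F k in sequentially. p n (f - s k) < e"
      by (rule order_tendstoD[OF lim])
    then show "\<exists>g\<in>cl V. p n (f - g) < e"
      using s eventually_happens'[OF sequentially_bot] by blast
  qed
  then show ?thesis
    using cl_cl[OF V] by blast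
qed

lemma cl_add:
  assumes V: "V \<subseteq> X" "\<And>f g. f \<in> V \<Longrightarrow> g \<in> V \<Longrightarrow> f + g \<in> V"
    and f: "f \<in> cl V" and g: "g \<in> cl V"
  shows "f + g \<in> cl V"
proof (rule clI)
  show "f + g \<in> X"
    using clD(1)[OF f] clD(1)[OF g] by (rule add_mem)
  fix n and e :: real assume "e > 0"
  then obtain f' g' where f': "f' \<in> V" "p n (f - f') < e / 2" and g': "g' \<in> V" "p n (g - g') < e / 2"
    using clD(2)[OF f, of "e / 2" n] clD(2)[OF g, of "e / 2" n] by auto
  have "p n ((f - f') + (g - g')) \<le> p n (f - f') + p n (g - g')"
    using f' g' V clD(1)[OF f] clD(1)[OF g] by (intro p_add diff_mem) auto
  moreover have "(f - f') + (g - g') = (f + g) - (f' + g')"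
    by simp
  ultimately have "p n ((f + g) - (f' + g')) < e"
    using f' g' by simp
  then show "\<exists>h\<in>V. p n (f + g - h) < e"
    using V(2)[OF f'(1) g'(1)] by blast
qed

text \<open>Every point can be moved slightly so that a suitable iterate of \<open>L\<close> comes close to a
  prescribed target; corrections that are small enough do not destroy what was achieved before,
  and their sum is the hypercyclic vector. This replaces the Baire category argument.\<close>

lemma hypercyclic_vector:
  fixes L :: "'b \<Rightarrow> 'b"
  assumes complete: "\<And>s. (\<And>i. s i \<in> X) \<Longrightarrow>
      (\<And>n e. e > 0 \<Longrightarrow> \<exists>J. \<forall>i\<ge>J. \<forall>j\<ge>J. p n (s i - s j) < e) \<Longrightarrow>
      \<exists>f\<in>X. \<forall>n. (\<lambda>i. p n (s i - f)) \<longlonglongrightarrow> 0"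
    and L_mem: "\<And>f. f \<in> X \<Longrightarrow> L f \<in> X"
    and L_add: "\<And>f g. f \<in> X \<Longrightarrow> g \<in> X \<Longrightarrow> L (f + g) = L f + L g"
    and L_cont: "\<And>n e. e > 0 \<Longrightarrow> \<exists>m d. d > 0 \<and> (\<forall>f\<in>X. p m f < d \<longrightarrow> p n (L f) < e)"
    and D: "countable D" "D \<noteq> {}" "D \<subseteq> X" "cl D = X"
    and A: "A \<subseteq> X" "cl A = X" "\<And>a n. a \<in> A \<Longrightarrow> (\<lambda>k. p n ((L ^^ k) a)) \<longlonglongrightarrow> 0"
    and B: "B \<subseteq> X" "cl B = X" "\<And>b. b \<in> B \<Longrightarrow>
      \<exists>s. (\<forall>k. s k \<in> X \<and> (L ^^ k) (s k) = b) \<and> (\<forall>n. (\<lambda>k. p n (s k)) \<longlonglongrightarrow> 0)"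
  shows "\<exists>x\<in>X. \<forall>y\<in>X. \<forall>n. \<forall>e>0. \<exists>k. p n ((L ^^ k) x - y) < e"
proof -
  \<comment> \<open>The first component of the pair code makes each element of \<open>D\<close> the
    target at infinitely many stages, hence with arbitrarily small errors.\<close>
  define y where "y = (\<lambda>j. from_nat_into D (fst (prod_decode j)))"
  have yX: "y j \<in> X" for j
    using from_nat_into[OF D(2)] D(3) by (auto simp: y_def)
  have Lk_mem: "(L ^^ k) f \<in> X" if "f \<in> X" for k f
    using that by (induction k) (auto intro: L_mem)
  have Lk_add: "(L ^^ k) (f + g) = (L ^^ k) f + (L ^^ k) g" if "f \<in> X" "g \<in> X" for k f g
    using that by (induction k) (auto simp: L_add Lk_mem)
  have Lk_cont: "\<exists>m d. d > 0 \<and> (\<forall>f\<in>X. p m f < d \<longrightarrow> p n ((L ^^ k) f) < e)" if "e > 0" for k n e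
    using that
  proof (induction k arbitrary: n e)
    case (Suc k)
    obtain m d where md: "d > 0" "\<And>f. f \<in> X \<Longrightarrow> p m f < d \<Longrightarrow> p n (L f) < e"
      using L_cont[OF Suc.prems, of n] by blast
    obtain m' d' where "d' > 0" "\<And>f. f \<in> X \<Longrightarrow> p m' f < d' \<Longrightarrow> p m ((L ^^ k) f) < d"
      using Suc.IH[OF md(1), of m] by blast
    with md show ?case
      by (intro exI[of _ m'] exI[of _ d']) (auto intro: Lk_mem)
  qed auto
  \<comment> \<open>A state holds the current point, the index of the seminorm in which later
    corrections are measured, and a bound for the next one. Halving the bounds keeps the sum of
    later corrections below \<open>2 * e'\<close>; the factor 3 leaves \<open>e'\<close> for the
    passage to the limit.\<close>
  define good where "good = (\<lambda>j (s, M, e) (s', M', e'). \<exists>k.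
    p M (s' - s) < e \<and> p j ((L ^^ k) s' - y j) < (1 / 2) ^ j \<and>
    (\<forall>f\<in>X. p M' f < 3 * e' \<longrightarrow> p j ((L ^^ k) f) < (1 / 2) ^ j) \<and> M \<le> M' \<and> e' \<le> e / 2)"
  have step: "\<exists>t'. (case t' of (s', M', e') \<Rightarrow> s' \<in> X \<and> e' > 0 \<and> Suc j \<le> M') \<and> good j t t'"
    if "case t of (s, M, e) \<Rightarrow> s \<in> X \<and> e > 0 \<and> j \<le> M" for t :: "'b \<times> nat \<times> real" and j :: nat
  proof -
    obtain s M e where t: "t = (s, M, e)"
      by (cases t)
    have s: "s \<in> X" and e: "e > 0" and M: "j \<le> M"
      using that by (auto simp: t)
    define h where "h = (1 / 2 :: real) ^ j / 2"
    have h: "h > 0"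
      by (simp add: h_def)
    obtain b where b: "b \<in> B" "p j (y j - b) < h"
      using clD(2)[of "y j" B h j] yX B(2) h by auto
    obtain a where a: "a \<in> A" "p M (s - a) < e / 2"
      using clD(2)[of s A "e / 2" M] s A(2) e by auto
    obtain u where u: "\<And>k. u k \<in> X" "\<And>k. (L ^^ k) (u k) = b" "\<And>n. (\<lambda>k. p n (u k)) \<longlonglongrightarrow> 0"
      using B(3)[OF b(1)] by blast
    have "\<forall>\<^sub>F k in sequentially. p M (u k) < e / 2"
      using order_tendstoD(2)[OF u(3)[of M], of "e / 2"] e by simp
    moreover have "\<forall>\<^sub>F k in sequentially. p j ((L ^^ k) a) < h"
      using order_tendstoD(2)[OF A(3)[OF a(1)] h] .
    ultimately have "\<forall>\<^sub>F k in sequentially. p M (u k) < e / 2 \<and> p j ((L ^^ k) a) < h"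
      by (rule eventually_conj)
    from eventually_happens'[OF sequentially_bot this] obtain k where k: "p M (u k) < e / 2" "p j ((L ^^ k) a) < h"
      by blast
    \<comment> \<open>\<open>a\<close> is close to \<open>s\<close> and its orbit dies out,
      \<open>u k\<close> is small and hits \<open>b\<close> after \<open>k\<close> steps: the sum
      stays near \<open>s\<close> while its \<open>k\<close>-th iterate is near \<open>b\<close>,
      hence near the target.\<close>
    define s' where "s' = a + u k"
    have mem: "a \<in> X" "b \<in> X" "s' \<in> X"
      using a b A(1) B(1) u(1) by (auto simp: s'_def intro: add_mem)
    obtain M' d where d: "d > 0" "\<And>f. f \<in> X \<Longrightarrow> p M' f < d \<Longrightarrow> p j ((L ^^ k) f) < (1 / 2) ^ j"
      using Lk_cont[of "(1 / 2) ^ j" j k] by auto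
    have eq: "s' - s = u k - (s - a)"
      by (simp add: s'_def)
    have 1: "p M (s' - s) < e"
      unfolding eq using p_diff[OF u(1)[of k] diff_mem[OF s mem(1)], of M] a(2) k(1) by linarith
    have eq: "(L ^^ k) s' - y j = (L ^^ k) a - (y j - b)"
      using mem u by (simp add: s'_def Lk_add)
    have "p j ((L ^^ k) s' - y j) < 2 * h"
      unfolding eq
      using p_diff[OF Lk_mem[OF mem(1)] diff_mem[OF yX mem(2)], of j k j] b(2) k(2) by linarith
    then have 2: "p j ((L ^^ k) s' - y j) < (1 / 2) ^ j"
      by (simp add: h_def)
    \<comment> \<open>\<open>d / 3\<close> matches the factor 3 in \<open>good\<close>,
      \<open>e / 2\<close> gives the halving, and \<open>Suc j\<close> lets the seminorm index grow
      beyond every bound.\<close>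
    let ?M = "max M' (max M (Suc j))" and ?e = "min (e / 2) (d / 3)"
    have 3: "p j ((L ^^ k) f) < (1 / 2) ^ j" if "f \<in> X" "p ?M f < 3 * ?e" for f
    proof -
      have "p M' f \<le> p ?M f"
        by (intro p_mono that) simp
      also have "\<dots> < d"
        using that(2) by linarith
      finally show ?thesis
        using d that by blast
    qed
    have g: "good j t (s', ?M, ?e)"
      unfolding t good_def prod.case
    proof (intro exI[of _ k] conjI ballI impI)
      show "M \<le> ?M" "?e \<le> e / 2"
        by simp_all
    qed (fact 1 2 3)+
    have inv: "case (s', ?M, ?e) of (s', M', e') \<Rightarrow> s' \<in> X \<and> e' > 0 \<and> Suc j \<le> M'"
      using mem e d by simp
    show ?thesis
      by (rule exI, rule conjI[OF inv g])
  qed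
  define inv where "inv = (\<lambda>j (s, M, e). s \<in> X \<and> (0::real) < e \<and> (j::nat) \<le> M)"
  have "\<exists>t. \<forall>j. inv j (t j) \<and> good j (t j) (t (Suc j))"
  proof (rule dependent_nat_choice[where P = inv and Q = good])
    have "inv 0 (0, 0, 1)"
      by (simp add: inv_def zero_mem)
    then show "\<exists>t. inv 0 t"
      by (rule exI)
  next
    fix t j assume "inv j t"
    then show "\<exists>t'. inv (Suc j) t' \<and> good j t t'"
      unfolding inv_def by (rule step)
  qed
  then obtain t where t: "\<And>j. inv j (t j)" "\<And>j. good j (t j) (t (Suc j))"
    by blast
  define s M e where "s = (\<lambda>j. fst (t j))" and "M = (\<lambda>j. fst (snd (t j)))" and "e = (\<lambda>j. snd (snd (t j)))"
  have tj: "t j = (s j, M j, e j)" for j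
    by (simp add: s_def M_def e_def)
  have s: "s j \<in> X" and e: "e j > 0" and M: "j \<le> M j" for j
    using t(1)[of j] by (auto simp: tj inv_def)
  have "\<forall>j. \<exists>k. p (M j) (s (Suc j) - s j) < e j \<and> p j ((L ^^ k) (s (Suc j)) - y j) < (1 / 2) ^ j \<and>
      (\<forall>f\<in>X. p (M (Suc j)) f < 3 * e (Suc j) \<longrightarrow> p j ((L ^^ k) f) < (1 / 2) ^ j) \<and>
      M j \<le> M (Suc j) \<and> e (Suc j) \<le> e j / 2"
    using t(2) unfolding tj good_def prod.case by (rule allI)
  from choice[OF this] obtain k where k: "\<And>j. p (M j) (s (Suc j) - s j) < e j"
    "\<And>j. p j ((L ^^ k j) (s (Suc j)) - y j) < (1 / 2) ^ j"
    "\<And>j f. f \<in> X \<Longrightarrow> p (M (Suc j)) f < 3 * e (Suc j) \<Longrightarrow> p j ((L ^^ k j) f) < (1 / 2) ^ j"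
    "\<And>j. M j \<le> M (Suc j)" "\<And>j. e (Suc j) \<le> e j / 2"
    by blast
  have Mmono: "M i \<le> M j" if "i \<le> j" for i j
    using that k(4) by (rule lift_Suc_mono_le[rotated])
  \<comment> \<open>The bound telescopes: halving gives
    \<open>e j \<le> 2 * (e j - e (Suc j))\<close>, which is exactly the room for one more
    step.\<close>
  have dist: "p (M i) (s j - s i) \<le> 2 * (e i - e j)" if "i \<le> j" for i j
    using that
  proof (induction j rule: dec_induct)
    case (step j)
    have "p (M i) (s (Suc j) - s i) \<le> p (M i) (s (Suc j) - s j) + p (M i) (s j - s i)"
      by (intro p_triangle s)
    moreover have "p (M i) (s (Suc j) - s j) \<le> p (M j) (s (Suc j) - s j)"
      by (intro p_mono diff_mem s Mmono step)
    moreover have "p (M j) (s (Suc j) - s j) < e j" "2 * e (Suc j) \<le> e j"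
      using k(1)[of j] k(5)[of j] by simp_all
    ultimately show ?case
      using step.IH unfolding right_diff_distrib by linarith
  qed (simp add: p_zero)
  have e_le: "e j \<le> e 0 * (1 / 2) ^ j" for j
  proof (induction j)
    case (Suc j)
    then show ?case
      using k(5)[of j] by simp
  qed simp
  have e_lim: "e \<longlonglongrightarrow> 0"
  proof (rule Lim_null_comparison)
    show "\<forall>\<^sub>F j in sequentially. norm (e j) \<le> e 0 * (1 / 2) ^ j"
      using e e_le by (simp add: less_imp_le)
    show "(\<lambda>j. e 0 * (1 / 2) ^ j) \<longlonglongrightarrow> 0"
      by (intro tendsto_mult_right_zero LIMSEQ_realpow_zero) simp_all
  qed
  have "\<exists>J. \<forall>i\<ge>J. \<forall>j\<ge>J. p n (s i - s j) < \<epsilon>" if "\<epsilon> > 0" for n \<epsilon>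
  proof -
    have "\<forall>\<^sub>F j in sequentially. e j < \<epsilon> / 4"
      using order_tendstoD(2)[OF e_lim, of "\<epsilon> / 4"] that by simp
    with eventually_ge_at_top[of n] have "\<forall>\<^sub>F j in sequentially. n \<le> j \<and> e j < \<epsilon> / 4"
      by eventually_elim simp
    from eventually_happens'[OF sequentially_bot this] obtain J where J: "n \<le> J" "e J < \<epsilon> / 4"
      by blast
    have *: "p n (s i - s J) < \<epsilon> / 2" if "i \<ge> J" for i
    proof -
      have "p n (s i - s J) \<le> p (M J) (s i - s J)"
        using J M[of J] by (intro p_mono diff_mem s) simp
      with dist[OF that] J e[of i] show ?thesis
        by simp
    qed
    have "p n (s i - s j) < \<epsilon>" if "i \<ge> J" "j \<ge> J" for i j
      using p_triangle[OF s[of i] s[of J] s[of j], of n] p_commute[OF s[of J] s[of j], of n] *[OF that(1)] *[OF that(2)] by simp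
    then show ?thesis
      by blast
  qed
  from complete[OF s this] obtain x where x: "x \<in> X" and lim: "\<And>n. (\<lambda>i. p n (s i - x)) \<longlonglongrightarrow> 0"
    by blast
  \<comment> \<open>All corrections after stage \<open>j\<close> together stay below the tolerance
    \<open>3 * e (Suc j)\<close>, under which the \<open>k j\<close>-th iterate moves by less than
    \<open>(1 / 2) ^ j\<close>.\<close>
  have close: "p j ((L ^^ k j) x - y j) < 2 * (1 / 2) ^ j" for j
  proof -
    let ?M = "M (Suc j)" and ?e = "e (Suc j)"
    have "\<forall>\<^sub>F i in sequentially. p ?M (s i - x) < ?e"
      using order_tendstoD(2)[OF lim e] .
    with eventually_ge_at_top[of "Suc j"] have "\<forall>\<^sub>F i in sequentially. Suc j \<le> i \<and> p ?M (s i - x) < ?e"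
      by eventually_elim simp
    from eventually_happens'[OF sequentially_bot this] obtain i where i: "Suc j \<le> i" "p ?M (s i - x) < ?e"
      by blast
    have "p ?M (x - s (Suc j)) < 3 * ?e"
      using p_triangle[OF x s[of i] s[of "Suc j"], of ?M] p_commute[OF x s[of i], of ?M] i(2) dist[OF i(1)] e[of i]
      unfolding right_diff_distrib by linarith
    then have *: "p j ((L ^^ k j) (x - s (Suc j))) < (1 / 2) ^ j"
      using k(3) diff_mem[OF x s] by blast
    have "(L ^^ k j) x = (L ^^ k j) (x - s (Suc j)) + (L ^^ k j) (s (Suc j))"
      by (simp add: diff_mem x s flip: Lk_add)
    then have eq: "(L ^^ k j) x - y j = (L ^^ k j) (x - s (Suc j)) + ((L ^^ k j) (s (Suc j)) - y j)"
      by simp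
    show ?thesis
      unfolding eq using p_add[OF Lk_mem[OF diff_mem[OF x s[of "Suc j"]], of "k j"]
          diff_mem[OF Lk_mem[OF s[of "Suc j"], of "k j"] yX[of j]], of j]
        * k(2)[of j] by linarith
  qed
  have "\<exists>k. p n ((L ^^ k) x - z) < \<epsilon>" if z: "z \<in> X" and \<epsilon>: "\<epsilon> > 0" for z n \<epsilon>
  proof -
    obtain d where d: "d \<in> D" "p n (z - d) < \<epsilon> / 2"
      using clD(2)[of z D "\<epsilon> / 2" n] z D(4) \<epsilon> by auto
    obtain i where i: "d = from_nat_into D i"
      using from_nat_into_surj[OF D(1) d(1)] by metis
    have "(\<lambda>j. 2 * (1 / 2 :: real) ^ j) \<longlonglongrightarrow> 0"
      by (intro tendsto_mult_right_zero LIMSEQ_realpow_zero) simp_all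
    from order_tendstoD(2)[OF this, of "\<epsilon> / 2"] \<epsilon>
    have "\<forall>\<^sub>F j in sequentially. 2 * (1 / 2 :: real) ^ j < \<epsilon> / 2"
      by simp
    with eventually_ge_at_top[of n] have "\<forall>\<^sub>F j in sequentially. n \<le> j \<and> 2 * (1 / 2 :: real) ^ j < \<epsilon> / 2"
      by eventually_elim simp
    from eventually_happens'[OF sequentially_bot this] obtain l where l: "n \<le> l" "2 * (1 / 2 :: real) ^ l < \<epsilon> / 2"
      by blast
    \<comment> \<open>This stage has target \<open>d\<close> and, since \<open>l \<le> j\<close>, a
      seminorm index and an accuracy at least as good as those of \<open>l\<close>.\<close>
    define j where "j = prod_encode (i, l)"
    have j: "y j = d" "l \<le> j"
      by (simp_all add: y_def j_def i le_prod_encode_2)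
    have "p n ((L ^^ k j) x - d) \<le> p j ((L ^^ k j) x - d)"
      using l j d D(3) by (intro p_mono diff_mem Lk_mem x) auto
    also have "\<dots> < 2 * (1 / 2) ^ j"
      using close[of j] j by simp
    also have "\<dots> \<le> 2 * (1 / 2) ^ l"
      using j by (simp add: power_decreasing)
    finally have "p n ((L ^^ k j) x - d) < \<epsilon> / 2"
      using l by simp
    moreover have dX: "d \<in> X"
      using d D(3) by blast
    ultimately have "p n ((L ^^ k j) x - z) < \<epsilon>"
      using p_triangle[OF Lk_mem[OF x] dX z, of n "k j"] p_commute[OF dX z, of n] d by simp
    then show ?thesis
      by blast
  qed
  with x show ?thesis
    by blast
qed

end

section \<open>Exponentials\<close>

lemma cdual_iff: "\<phi> \<in> cdual \<longleftrightarrow> (\<forall>c x. blinfun_apply \<phi> (c *\<^sub>C x) = c * blinfun_apply \<phi> x)"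
  by (simp add: cdual_def clinear_iff blinfun.add_right)

lemma cdual_0: "0 \<in> cdual"
  by (simp add: cdual_iff)

lemma cdual_add: "\<phi> \<in> cdual \<Longrightarrow> \<psi> \<in> cdual \<Longrightarrow> \<phi> + \<psi> \<in> cdual"
  and cdual_diff: "\<phi> \<in> cdual \<Longrightarrow> \<psi> \<in> cdual \<Longrightarrow> \<phi> - \<psi> \<in> cdual"
  by (simp_all add: cdual_iff blinfun.add_left blinfun.diff_left distrib_left right_diff_distrib)

text \<open>Bounded operators form a real vector space here, so complex multiples of a functional
  are formed by composition with a multiplication.\<close>

definition cmult :: "complex \<Rightarrow> ('a::real_normed_vector \<Rightarrow>\<^sub>L complex) \<Rightarrow> 'a \<Rightarrow>\<^sub>L complex"
  where "cmult c \<phi> = blinfun_mult_right c o\<^sub>L \<phi>"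

lemma cmult_apply [simp]: "blinfun_apply (cmult c \<phi>) x = c * blinfun_apply \<phi> x"
  by (simp add: cmult_def)

lemma cdual_cmult: "\<phi> \<in> cdual \<Longrightarrow> cmult c \<phi> \<in> cdual"
  by (simp add: cdual_iff)

lemma norm_cmult_le: "norm (cmult c \<phi>) \<le> cmod c * norm \<phi>"
  by (rule norm_blinfun_bound) (simp_all add: norm_mult mult.assoc mult_left_mono norm_blinfun)

text \<open>The coefficient of z^n in the m-th power of \<phi> + z \<psi>. It vanishes for
  \<open>n > m\<close> because the binomial coefficient does, which is used when a fixed
  \<open>n\<close> meets small \<open>m\<close>.\<close>

definition binomial_term :: "('a::real_normed_vector \<Rightarrow>\<^sub>L complex) \<Rightarrow> ('a \<Rightarrow>\<^sub>L complex) \<Rightarrow> nat \<Rightarrow> nat \<Rightarrow> 'a \<Rightarrow> complex"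
  where "binomial_term \<phi> \<psi> m n =
    (\<lambda>x. of_nat (m choose n) * blinfun_apply \<phi> x ^ (m - n) * blinfun_apply \<psi> x ^ n)"

lemma binomial_term_sum:
  "(\<Sum>n\<le>m. binomial_term \<phi> \<psi> m n x * z ^ n) = blinfun_apply (\<phi> + cmult z \<psi>) x ^ m"
proof -
  have "blinfun_apply (\<phi> + cmult z \<psi>) x ^ m = (z * blinfun_apply \<psi> x + blinfun_apply \<phi> x) ^ m"
    by (simp add: blinfun.add_left add.commute)
  also have "\<dots> = (\<Sum>n\<le>m. of_nat (m choose n) * (z * blinfun_apply \<psi> x) ^ n * blinfun_apply \<phi> x ^ (m - n))"
    by (rule binomial_ring)
  finally show ?thesis
    by (simp add: binomial_term_def power_mult_distrib mult_ac)
qed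

lemma binomial_term_cmult: "binomial_term \<phi> (cmult c \<psi>) m n = fscale (c ^ n) (binomial_term \<phi> \<psi> m n)"
  by (rule ext) (simp add: binomial_term_def fscale_def power_mult_distrib)

definition expo :: "('a::real_normed_vector \<Rightarrow>\<^sub>L complex) \<Rightarrow> 'a \<Rightarrow> complex"
  where "expo \<phi> = (\<lambda>x. exp (blinfun_apply \<phi> x))"

text \<open>\<open>expo_coeff \<phi> \<psi> n\<close> is the coefficient of \<open>z ^ n\<close> in \<open>exp (\<phi> + z * \<psi>)\<close>.\<close>

definition expo_coeff :: "('a::real_normed_vector \<Rightarrow>\<^sub>L complex) \<Rightarrow> ('a \<Rightarrow>\<^sub>L complex) \<Rightarrow> nat \<Rightarrow> 'a \<Rightarrow> complex"
  where "expo_coeff \<phi> \<psi> n = (\<lambda>x. exp (blinfun_apply \<phi> x) * blinfun_apply \<psi> x ^ n / fact n)"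

lemma expo_coeff_cmult: "expo_coeff \<phi> (cmult c \<psi>) n = fscale (c ^ n) (expo_coeff \<phi> \<psi> n)"
  by (rule ext) (simp add: expo_coeff_def fscale_def power_mult_distrib)

lemma expo_coeff_0: "expo_coeff \<phi> \<psi> 0 = expo \<phi>"
  by (simp add: expo_coeff_def expo_def)

text \<open>In degree m + n the binomial coefficient divided by (m + n)! equals 1/(m! n!), so the
  series is the exponential series of \<phi> times \<psi>^n/n!, shifted by \<open>n\<close>
  degrees.\<close>

lemma expo_coeff_sums:
  "(\<lambda>m. fscale (1 / fact m) (binomial_term \<phi> \<psi> m n) x) sums expo_coeff \<phi> \<psi> n x"
proof -
  have "(\<lambda>m. (blinfun_apply \<phi> x ^ m /\<^sub>R fact m) * (blinfun_apply \<psi> x ^ n / fact n)) sums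
      (exp (blinfun_apply \<phi> x) * (blinfun_apply \<psi> x ^ n / fact n))"
    by (intro sums_mult2 exp_converges)
  moreover have "(blinfun_apply \<phi> x ^ m /\<^sub>R fact m) * (blinfun_apply \<psi> x ^ n / fact n) =
      fscale (1 / fact (m + n)) (binomial_term \<phi> \<psi> (m + n) n) x" for m
  proof -
    have "(of_nat (m + n choose n) :: complex) = fact (m + n) / (fact n * fact m)"
      using binomial_fact[of n "m + n", where 'a = complex] by simp
    then have eq: "1 / fact (m + n) * of_nat (m + n choose n) = 1 / (fact n * fact m :: complex)"
      by simp
    have "fscale (1 / fact (m + n)) (binomial_term \<phi> \<psi> (m + n) n) x =
        (1 / fact (m + n) * of_nat (m + n choose n)) * (blinfun_apply \<phi> x ^ m * blinfun_apply \<psi> x ^ n)"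
      by (simp add: fscale_def binomial_term_def)
    then show ?thesis
      unfolding eq by (simp add: scaleR_conv_of_real divide_inverse mult_ac)
  qed
  ultimately have "(\<lambda>m. fscale (1 / fact (m + n)) (binomial_term \<phi> \<psi> (m + n) n) x) sums expo_coeff \<phi> \<psi> n x"
    by (simp add: expo_coeff_def)
  moreover have "fscale (1 / fact m) (binomial_term \<phi> \<psi> m n) x = 0" if "m < n" for m
    using that by (simp add: fscale_def binomial_term_def)
  ultimately show ?thesis
    by (subst (asm) sums_zero_iff_shift) auto
qed

text \<open>Condition (a1) appears with \<open>b = 1\<close> and includes degree 0, where both sides
  are 1; (a2) is put in terms of approximation.\<close>

locale pi1_type_on = holomorphy_type_on +
  fixes K :: real
  assumes K_pos: "K > 0"
    and finite_type_subset: "cpoly_finite_type m \<subseteq> \<Theta> m"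
    and N_power: "\<phi> \<in> cdual \<Longrightarrow> N m (\<lambda>x. blinfun_apply \<phi> x ^ m) \<le> K ^ m * norm \<phi> ^ m"
    and finite_type_dense: "P \<in> \<Theta> m \<Longrightarrow> e > 0 \<Longrightarrow> \<exists>Q\<in>cpoly_finite_type m. N m (P - Q) < e"
begin

lemma power_finite_type: "\<phi> \<in> cdual \<Longrightarrow> (\<lambda>x. blinfun_apply \<phi> x ^ m) \<in> cpoly_finite_type m"
  unfolding cpoly_finite_type_def by (rule cfun.span_base) blast

text \<open>The binomial terms are extracted from the powers of \<open>\<phi> + z * \<psi>\<close> with \<open>z\<close> on the unit circle.\<close>

lemma binomial_term_bound_1:
  assumes \<phi>: "\<phi> \<in> cdual" and \<psi>: "\<psi> \<in> cdual"
  shows "binomial_term \<phi> \<psi> m n \<in> \<Theta> m"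
    and "N m (binomial_term \<phi> \<psi> m n) \<le> (K * (norm \<phi> + norm \<psi>)) ^ m"
proof -
  let ?P = "\<lambda>z x. blinfun_apply (\<phi> + cmult z \<psi>) x ^ m"
  have "binomial_term \<phi> \<psi> m n \<in> \<Theta> m \<and> N m (binomial_term \<phi> \<psi> m n) \<le> (K * (norm \<phi> + norm \<psi>)) ^ m"
  proof (cases "n \<le> m")
    case True
    obtain M :: nat and z w :: "nat \<Rightarrow> complex"
      where z: "\<forall>j<M. cmod (z j) = 1" and w: "(\<Sum>j<M. cmod (w j)) = 1"
        and *: "\<forall>c. (\<Sum>j<M. w j * (\<Sum>i\<le>m. c i * z j ^ i)) = c n"
      using coefficient_extraction[OF True] by (elim exE conjE) (rule that)
    have eq: "binomial_term \<phi> \<psi> m n = (\<Sum>j<M. fscale (w j) (?P (z j)))"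
    proof
      fix x
      show "binomial_term \<phi> \<psi> m n x = (\<Sum>j<M. fscale (w j) (?P (z j))) x"
        using *[rule_format, of "\<lambda>n. binomial_term \<phi> \<psi> m n x"]
        by (simp add: sum_fun_apply fscale_def binomial_term_sum)
    qed
    have mem: "?P z \<in> \<Theta> m" for z
      using power_finite_type[OF cdual_add[OF \<phi> cdual_cmult[OF \<psi>]]] finite_type_subset by blast
    have "N m (fscale (w j) (?P (z j))) \<le> cmod (w j) * (K * (norm \<phi> + norm \<psi>)) ^ m" if "j < M" for j
    proof -
      have "norm (\<phi> + cmult (z j) \<psi>) \<le> norm \<phi> + norm \<psi>"
        using norm_triangle_ineq[of \<phi> "cmult (z j) \<psi>"] norm_cmult_le[of "z j" \<psi>] z that by simp
      then have "norm (\<phi> + cmult (z j) \<psi>) ^ m \<le> (norm \<phi> + norm \<psi>) ^ m"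
        by (intro power_mono) simp_all
      then have "K ^ m * norm (\<phi> + cmult (z j) \<psi>) ^ m \<le> K ^ m * (norm \<phi> + norm \<psi>) ^ m"
        using K_pos by (intro mult_left_mono) simp_all
      with N_power[OF cdual_add[OF \<phi> cdual_cmult[OF \<psi>]], of m "z j"]
      have "N m (?P (z j)) \<le> (K * (norm \<phi> + norm \<psi>)) ^ m"
        unfolding power_mult_distrib by linarith
      then show ?thesis
        unfolding N_scale[OF mem] by (intro mult_left_mono) simp_all
    qed
    then have "(\<Sum>j<M. N m (fscale (w j) (?P (z j)))) \<le> (\<Sum>j<M. cmod (w j) * (K * (norm \<phi> + norm \<psi>)) ^ m)"
      by (intro sum_mono) simp
    also have "\<dots> = (K * (norm \<phi> + norm \<psi>)) ^ m"
      by (simp add: w flip: sum_distrib_right)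
    finally have "N m (binomial_term \<phi> \<psi> m n) \<le> (K * (norm \<phi> + norm \<psi>)) ^ m"
      using N_sum[of "{..<M}" "\<lambda>j. fscale (w j) (?P (z j))" m, OF Theta_scale[OF mem]]
      unfolding eq by linarith
    then show ?thesis
      unfolding eq using Theta_sum[of "{..<M}" "\<lambda>j. fscale (w j) (?P (z j))" m] Theta_scale[OF mem] by simp
  next
    case False
    have "binomial_term \<phi> \<psi> m n = 0"
      by (rule ext) (use False in \<open>simp add: binomial_term_def\<close>)
    then show ?thesis
      using Theta_0 K_pos by (simp only: N_0) simp
  qed
  then show "binomial_term \<phi> \<psi> m n \<in> \<Theta> m"
    and "N m (binomial_term \<phi> \<psi> m n) \<le> (K * (norm \<phi> + norm \<psi>)) ^ m"
    by simp_all
qed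

text \<open>The Cauchy estimate on the circle of radius \<open>r\<close>, obtained from the unit
  circle by replacing \<psi> with r \<psi>, which multiplies the term by
  \<open>r ^ n\<close>.\<close>

lemma binomial_term_bound:
  assumes \<phi>: "\<phi> \<in> cdual" and \<psi>: "\<psi> \<in> cdual" and r: "r > 0"
  shows "N m (binomial_term \<phi> \<psi> m n) \<le> (K * (norm \<phi> + r * norm \<psi>)) ^ m / r ^ n"
proof -
  have "r ^ n * N m (binomial_term \<phi> \<psi> m n) = N m (binomial_term \<phi> (cmult (of_real r) \<psi>) m n)"
    using r N_scale[OF binomial_term_bound_1(1)[OF \<phi> \<psi>], of m "of_real r ^ n" n]
    by (simp add: binomial_term_cmult norm_power)
  also have "\<dots> \<le> (K * (norm \<phi> + norm (cmult (of_real r) \<psi>))) ^ m"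
    by (rule binomial_term_bound_1(2)[OF \<phi> cdual_cmult[OF \<psi>]])
  also have "\<dots> \<le> (K * (norm \<phi> + r * norm \<psi>)) ^ m"
    using K_pos norm_cmult_le[of "of_real r" \<psi>] r
    by (intro power_mono mult_left_mono mult_nonneg_nonneg) simp_all
  finally show ?thesis
    using r by (simp add: pos_le_divide_eq mult.commute)
qed

text \<open>Dividing by m! beats every radius: the majorant is the exponential series. The seminorm
  bounds for exponentials and their remainders come from here.\<close>

lemma rapid_exponential_bound:
  assumes Q: "\<And>m. Q m \<in> \<Theta> m" and C: "C \<ge> 0" and b: "\<And>m. N m (Q m) \<le> C ^ m / fact m * d"
  shows "rapid Q" and "\<rho> \<ge> 0 \<Longrightarrow> HTb_seminorm N \<rho> (power_sum Q) \<le> exp (\<rho> * C) * d"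
proof -
  have s: "(\<lambda>m. (\<rho> * C) ^ m / fact m * d) sums (exp (\<rho> * C) * d)" for \<rho>
    using sums_mult2[OF exp_converges[of "\<rho> * C"], of d] by (simp add: divide_inverse mult.commute)
  have le: "\<rho> ^ m * N m (Q m) \<le> (\<rho> * C) ^ m / fact m * d" if "\<rho> \<ge> 0" for \<rho> m
    using mult_left_mono[OF b[of m], of "\<rho> ^ m"] that by (simp add: power_mult_distrib)
  show rQ: "rapid Q"
    unfolding rapid_def
  proof (intro conjI allI impI Q)
    fix \<rho> :: real assume \<rho>: "\<rho> > 0"
    show "summable (\<lambda>m. \<rho> ^ m * N m (Q m))"
    proof (rule summable_comparison_test'[OF sums_summable[OF s[of \<rho>]], where N = 0])
      fix m
      have "0 \<le> \<rho> ^ m * N m (Q m)"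
        using \<rho> N_nonneg[OF Q] by simp
      then show "norm (\<rho> ^ m * N m (Q m)) \<le> (\<rho> * C) ^ m / fact m * d"
        using le[of \<rho> m] \<rho> by simp
    qed
  qed
  show "HTb_seminorm N \<rho> (power_sum Q) \<le> exp (\<rho> * C) * d" if "\<rho> \<ge> 0"
    by (rule HTb_seminorm_le[OF rQ that le[OF that] s])
qed

lemma expo_coeff_mem:
  assumes \<phi>: "\<phi> \<in> cdual" and \<psi>: "\<psi> \<in> cdual"
  shows "expo_coeff \<phi> \<psi> n \<in> HTb \<Theta> N"
proof -
  let ?Q = "\<lambda>m. fscale (1 / fact m) (binomial_term \<phi> \<psi> m n)"
  have "N m (?Q m) \<le> (K * (norm \<phi> + norm \<psi>)) ^ m / fact m * 1" for m
    using binomial_term_bound_1(2)[OF \<phi> \<psi>, of m n]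
    unfolding N_scale[OF binomial_term_bound_1(1)[OF \<phi> \<psi>]] by (simp add: norm_divide divide_right_mono)
  then have "rapid ?Q"
    using K_pos binomial_term_bound_1(1)[OF \<phi> \<psi>]
    by (intro rapid_exponential_bound(1)[of ?Q "K * (norm \<phi> + norm \<psi>)" 1] Theta_scale) simp_all
  moreover have "expo_coeff \<phi> \<psi> n = power_sum ?Q"
    unfolding power_sum_def by (rule ext) (rule sums_unique[OF expo_coeff_sums])
  ultimately show ?thesis
    unfolding HTb_iff by blast
qed

lemma expo_mem: "\<phi> \<in> cdual \<Longrightarrow> expo \<phi> \<in> HTb \<Theta> N"
  using expo_coeff_mem[of \<phi> \<phi> 0] by (simp add: expo_coeff_0)

text \<open>The central estimate, a Cauchy bound for the Taylor remainder of z -> exp(\<phi> + z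
  \<psi>) at z = 1. The condition \<open>r \<ge> 2\<close> makes the geometric tail at most
  \<open>2 / r ^ n\<close>. With \<open>r = 2\<close> and growing \<open>n\<close> it gives
  convergence of the series; with \<open>r\<close> the reciprocal of a small increment and fixed
  \<open>n\<close> it controls continuity and difference quotients.\<close>

lemma expo_remainder:
  assumes \<phi>: "\<phi> \<in> cdual" and \<psi>: "\<psi> \<in> cdual" and r: "r \<ge> 2" and \<rho>: "\<rho> \<ge> 0"
  shows "HTb_seminorm N \<rho> (expo (\<phi> + \<psi>) - (\<Sum>k<n. expo_coeff \<phi> \<psi> k))
    \<le> exp (\<rho> * (K * (norm \<phi> + r * norm \<psi>))) * (2 / r ^ n)"
proof -
  define C where "C = K * (norm \<phi> + r * norm \<psi>)"
  let ?b = "binomial_term \<phi> \<psi>"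
  let ?Q = "\<lambda>m. fscale (1 / fact m) (\<Sum>k=n..m. ?b m k)"
  have C: "C \<ge> 0"
    using K_pos r by (simp add: C_def)
  have mem: "(\<Sum>k=n..m. ?b m k) \<in> \<Theta> m" for m
    by (intro Theta_sum binomial_term_bound_1 \<phi> \<psi>)
  have "N m (?Q m) \<le> C ^ m / fact m * (2 / r ^ n)" for m
  proof -
    have geometric: "(\<Sum>k=n..m. 1 / r ^ k) \<le> 2 / r ^ n"
    proof (cases "n \<le> m")
      case True
      have "(\<Sum>k=n..m. 1 / r ^ k) = (\<Sum>j\<le>m - n. (1 / r ^ n) * (1 / r) ^ j)"
        by (rule sum.reindex_bij_witness[of _ "\<lambda>j. j + n" "\<lambda>k. k - n"])
          (use True in \<open>auto simp: power_divide simp flip: power_add\<close>)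
      also have "\<dots> \<le> (\<Sum>j\<le>m - n. (1 / r ^ n) * (1 / 2) ^ j)"
        using r by (intro sum_mono mult_left_mono power_mono) (simp_all add: field_simps)
      also have "\<dots> \<le> (1 / r ^ n) * 2"
      proof -
        have "(\<Sum>j\<le>m - n. (1 / 2 :: real) ^ j) \<le> (\<Sum>j. (1 / 2) ^ j)"
          by (intro sum_le_suminf summable_geometric) simp_all
        also have "\<dots> = 2"
          by (simp add: suminf_geometric)
        finally show ?thesis
          unfolding sum_distrib_left[symmetric] using r by (intro mult_left_mono) simp_all
      qed
      finally show ?thesis
        by simp
    qed (use r in simp)
    have "N m (\<Sum>k=n..m. ?b m k) \<le> (\<Sum>k=n..m. N m (?b m k))"
      by (intro N_sum binomial_term_bound_1 \<phi> \<psi>)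
    also have "\<dots> \<le> (\<Sum>k=n..m. C ^ m * (1 / r ^ k))"
      using binomial_term_bound[OF \<phi> \<psi>, of r m] r by (intro sum_mono) (simp add: C_def)
    also have "\<dots> \<le> C ^ m * (2 / r ^ n)"
      unfolding sum_distrib_left[symmetric] using C by (intro mult_left_mono geometric) simp
    finally have "N m (\<Sum>k=n..m. ?b m k) / fact m \<le> C ^ m * (2 / r ^ n) / fact m"
      by (intro divide_right_mono) simp_all
    then show ?thesis
      unfolding N_scale[OF mem] by (simp add: norm_divide mult.commute)
  qed
  from rapid_exponential_bound(2)[OF Theta_scale[OF mem] C this \<rho>]
  have "HTb_seminorm N \<rho> (power_sum ?Q) \<le> exp (\<rho> * C) * (2 / r ^ n)" .
  \<comment> \<open>In degree \<open>m\<close> the subtraction cancels the parts with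
    \<open>k < n\<close> in the binomial expansion; for \<open>m < n\<close> nothing
    remains.\<close>
  moreover have "power_sum ?Q = expo (\<phi> + \<psi>) - (\<Sum>k<n. expo_coeff \<phi> \<psi> k)"
  proof
    fix x
    have "(\<lambda>m. blinfun_apply (\<phi> + \<psi>) x ^ m /\<^sub>R fact m - (\<Sum>k<n. fscale (1 / fact m) (?b m k) x)) sums
        (exp (blinfun_apply (\<phi> + \<psi>) x) - (\<Sum>k<n. expo_coeff \<phi> \<psi> k x))"
      by (intro sums_diff exp_converges sums_sum expo_coeff_sums)
    moreover have "blinfun_apply (\<phi> + \<psi>) x ^ m /\<^sub>R fact m - (\<Sum>k<n. fscale (1 / fact m) (?b m k) x) = ?Q m x" for m
    proof -
      have 1: "blinfun_apply (\<phi> + \<psi>) x ^ m = (\<Sum>k\<le>m. ?b m k x)"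
        using binomial_term_sum[of \<phi> \<psi> m x 1] by (simp add: blinfun.add_left)
      have "(\<Sum>k\<le>m. ?b m k x) - (\<Sum>k<n. ?b m k x) = (\<Sum>k=n..m. ?b m k x)"
      proof (cases "n \<le> m")
        case True
        then show ?thesis
          using sum_diff_nat_ivl[of 0 n "Suc m" "\<lambda>k. ?b m k x"]
          by (simp add: lessThan_atLeast0 atLeastLessThanSuc_atLeastAtMost atLeast0AtMost)
      next
        case False
        then have "(\<Sum>k<n. ?b m k x) = (\<Sum>k\<le>m. ?b m k x)"
          by (intro sum.mono_neutral_right) (auto simp: binomial_term_def)
        with False show ?thesis
          by simp
      qed
      moreover have "(\<Sum>k<n. fscale (1 / fact m) (?b m k) x) = (1 / fact m) * (\<Sum>k<n. ?b m k x)"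
        by (simp add: fscale_def sum_divide_distrib)
      moreover have "?Q m x = (1 / fact m) * (\<Sum>k=n..m. ?b m k x)"
        by (simp add: fscale_def sum_fun_apply)
      ultimately show ?thesis
        unfolding 1 by (simp add: scaleR_conv_of_real field_simps)
    qed
    ultimately have "(\<lambda>m. ?Q m x) sums (exp (blinfun_apply (\<phi> + \<psi>) x) - (\<Sum>k<n. expo_coeff \<phi> \<psi> k x))"
      by simp
    then show "power_sum ?Q x = (expo (\<phi> + \<psi>) - (\<Sum>k<n. expo_coeff \<phi> \<psi> k)) x"
      unfolding power_sum_def by (simp add: sums_iff expo_def sum_fun_apply)
  qed
  ultimately show ?thesis
    by (simp add: C_def)
qed

section \<open>Seminorms, closures and closed subspaces\<close>

lemma seminorm_0: "HTb_seminorm N \<rho> 0 = 0"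
  using HTb_seminorm_power_sum[OF rapid_0, of \<rho>] unfolding power_sum_0
  by (simp only: N_0 mult_zero_right suminf_zero)

lemma seminorm_diff:
  assumes "f \<in> HTb \<Theta> N" "g \<in> HTb \<Theta> N" "\<rho> \<ge> 0"
  shows "HTb_seminorm N \<rho> (f - g) \<le> HTb_seminorm N \<rho> f + HTb_seminorm N \<rho> g"
  using seminorm_add[OF assms(1) cfun.subspace_scale[OF subspace_HTb assms(2), of "-1"] assms(3)]
    seminorm_scale[OF assms(2,3), of "-1"]
  by (simp add: cfun.scale_minus_left)

text \<open>Index \<open>n\<close> stands for radius n + 1: these radii are positive and unbounded,
  so countably many seminorms describe the topology.\<close>

sublocale seminormed_group "HTb \<Theta> N" "\<lambda>n. HTb_seminorm N (real (Suc n))"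
  by unfold_locales
    (intro cfun.subspace_0 cfun.subspace_diff subspace_HTb seminorm_0 seminorm_diff seminorm_mono; simp)+

lemma homogeneous_mem:
  assumes P: "P \<in> \<Theta> m"
  shows "P \<in> HTb \<Theta> N" and "\<rho> \<ge> 0 \<Longrightarrow> HTb_seminorm N \<rho> P = \<rho> ^ m * N m P"
proof -
  let ?Q = "\<lambda>k. if k = m then P else 0"
  have single: "(\<lambda>k. \<rho> ^ k * N k (?Q k)) sums (\<rho> ^ m * N m P)" for \<rho>
  proof -
    have "(\<lambda>k. \<rho> ^ k * N k (?Q k)) = (\<lambda>k. if k = m then \<rho> ^ k * N k P else 0)"
      by (rule ext) (simp add: N_0)
    then show ?thesis
      using sums_single[of m "\<lambda>k. \<rho> ^ k * N k P"] by simp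
  qed
  have rapid: "rapid ?Q"
    unfolding rapid_def using P Theta_0 single sums_summable by auto
  have eq: "power_sum ?Q = P"
  proof
    fix x
    have "(\<lambda>k. if k = m then P x else 0) sums P x"
      using sums_single[of m "\<lambda>_. P x"] by simp
    moreover have "(\<lambda>k. if k = m then P x else 0) = (\<lambda>k. ?Q k x)"
      by (rule ext) simp
    ultimately show "power_sum ?Q x = P x"
      by (simp add: power_sum_def sums_iff)
  qed
  show "P \<in> HTb \<Theta> N"
    unfolding HTb_iff using rapid eq by metis
  show "HTb_seminorm N \<rho> P = \<rho> ^ m * N m P" if "\<rho> \<ge> 0"
    using HTb_seminorm_power_sum[OF rapid, of \<rho>] sums_unique[OF single[of \<rho>]] unfolding eq by simp
qed

lemma partial_sums_converge:
  assumes P: "rapid P" and \<rho>: "\<rho> \<ge> 0"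
  shows "(\<lambda>n. HTb_seminorm N \<rho> (power_sum P - (\<Sum>k<n. P k))) \<longlonglongrightarrow> 0"
proof -
  let ?Q = "\<lambda>n m. if m < n then 0 else P m"
  let ?a = "\<lambda>m. \<rho> ^ m * N m (P m)"
  have rapid: "rapid (?Q n)" for n
  proof (rule rapid_le[where C = 1 and a = "\<lambda>m. N m (P m)"])
    show "summable (\<lambda>m. \<rho> ^ m * N m (P m))" if "\<rho> > 0" for \<rho>
      using P that by (simp add: rapid_def)
  qed (use rapidD(1)[OF P] N_nonneg Theta_0 in \<open>simp_all add: N_0\<close>)
  have eq: "power_sum (?Q n) = power_sum P - (\<Sum>k<n. P k)" for n
  proof
    fix x
    have "(\<lambda>m. P m x - (if m \<in> {..<n} then P m x else 0)) sums (power_sum P x - (\<Sum>m<n. P m x))"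
      by (intro sums_diff rapid_sums[OF P] sums_If_finite_set) simp
    moreover have "(\<lambda>m. P m x - (if m \<in> {..<n} then P m x else 0)) = (\<lambda>m. ?Q n m x)"
      by (rule ext) simp
    ultimately show "power_sum (?Q n) x = (power_sum P - (\<Sum>k<n. P k)) x"
      by (simp add: power_sum_def sums_iff sum_fun_apply)
  qed
  have "HTb_seminorm N \<rho> (power_sum (?Q n)) \<le> (\<Sum>m. ?a (m + n))" for n
  proof (rule HTb_seminorm_le[OF rapid \<rho> order.refl])
    have "(\<lambda>m. \<rho> ^ (m + n) * N (m + n) (?Q n (m + n))) sums (\<Sum>m. ?a (m + n))"
      using summable_sums[OF summable_ignore_initial_segment[OF rapidD(2)[OF P \<rho>]]] by simp
    moreover have "\<rho> ^ m * N m (?Q n m) = 0" if "m < n" for m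
      using that by (simp add: N_0)
    ultimately show "(\<lambda>m. \<rho> ^ m * N m (?Q n m)) sums (\<Sum>m. ?a (m + n))"
      by (subst (asm) sums_zero_iff_shift) auto
  qed
  then have le: "HTb_seminorm N \<rho> (power_sum P - (\<Sum>k<n. P k)) \<le> (\<Sum>m. ?a (m + n))" for n
    unfolding eq .
  have nonneg: "HTb_seminorm N \<rho> (power_sum P - (\<Sum>k<n. P k)) \<ge> 0" for n
    unfolding eq[symmetric] using rapid \<rho> by (intro seminorm_nonneg) (auto simp: HTb_iff)
  show ?thesis
    by (rule Lim_null_comparison[OF _ suminf_exist_split2[OF rapidD(2)[OF P \<rho>]]])
      (use le nonneg in \<open>auto intro!: always_eventually\<close>)
qed

lemma cl_subspace:
  assumes V: "V \<subseteq> HTb \<Theta> N" "cfun.subspace V"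
  shows "cfun.subspace (cl V)"
proof (rule cfun.subspaceI)
  have V0: "0 \<in> V"
    by (rule cfun.subspace_0[OF V(2)])
  then show "0 \<in> cl V"
    using cl_superset[OF V(1)] by blast
  show "f + g \<in> cl V" if "f \<in> cl V" "g \<in> cl V" for f g
    by (rule cl_add[OF V(1) cfun.subspace_add[OF V(2)] that])
  show "fscale c f \<in> cl V" if f: "f \<in> cl V" for c f
  proof (rule clI)
    note fX = clD(1)[OF f]
    show "fscale c f \<in> HTb \<Theta> N"
      by (rule cfun.subspace_scale[OF subspace_HTb fX])
    fix n and e :: real assume e: "e > 0"
    obtain g where g: "g \<in> V" "HTb_seminorm N (real (Suc n)) (f - g) < e / (cmod c + 1)"
      using clD(2)[OF f, of "e / (cmod c + 1)" n] e by (auto simp: add_nonneg_pos)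
    have fg: "f - g \<in> HTb \<Theta> N"
      using g V by (intro diff_mem fX) auto
    have "HTb_seminorm N (real (Suc n)) (fscale c f - fscale c g) = cmod c * HTb_seminorm N (real (Suc n)) (f - g)"
      using seminorm_scale[OF fg, of "real (Suc n)" c] by (simp add: cfun.scale_right_diff_distrib)
    also have "\<dots> \<le> (cmod c + 1) * HTb_seminorm N (real (Suc n)) (f - g)"
      using seminorm_nonneg[OF fg, of "real (Suc n)"] by (intro mult_right_mono) simp_all
    also have "\<dots> < e"
      using g(2) by (simp add: pos_less_divide_eq add_nonneg_pos mult.commute)
    finally show "\<exists>h\<in>V. HTb_seminorm N (real (Suc n)) (fscale c f - h) < e"
      using cfun.subspace_scale[OF V(2) g(1)] by blast
  qed
qed

text \<open>The remainder estimate with \<open>n = 1\<close> and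
  \<open>r = 1 / norm \<delta>\<close>; then \<open>r * norm \<delta> = 1\<close>, so the constant
  does not depend on \<delta>.\<close>

lemma expo_continuous:
  assumes \<phi>: "\<phi> \<in> cdual" and \<delta>: "\<delta> \<in> cdual" "norm \<delta> \<le> 1 / 2" and \<rho>: "\<rho> \<ge> 0"
  shows "HTb_seminorm N \<rho> (expo (\<phi> + \<delta>) - expo \<phi>) \<le> exp (\<rho> * (K * (norm \<phi> + 1))) * 2 * norm \<delta>"
proof (cases "\<delta> = 0")
  case False
  then have "1 / norm \<delta> \<ge> 2"
    using \<delta>(2) by (simp add: field_simps)
  from expo_remainder[OF \<phi> \<delta>(1) this \<rho>, of 1] False show ?thesis
    by (simp add: expo_coeff_0)
qed (simp add: seminorm_0)

lemma expo_series_converges: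
  assumes \<phi>: "\<phi> \<in> cdual" and \<psi>: "\<psi> \<in> cdual" and \<rho>: "\<rho> \<ge> 0"
  shows "(\<lambda>n. HTb_seminorm N \<rho> (expo (\<phi> + \<psi>) - (\<Sum>k<n. expo_coeff \<phi> \<psi> k))) \<longlonglongrightarrow> 0"
proof (rule Lim_null_comparison)
  let ?C = "exp (\<rho> * (K * (norm \<phi> + 2 * norm \<psi>)))"
  have mem: "expo (\<phi> + \<psi>) - (\<Sum>k<n. expo_coeff \<phi> \<psi> k) \<in> HTb \<Theta> N" for n
    by (intro diff_mem expo_mem cdual_add cfun.subspace_sum[OF subspace_HTb] expo_coeff_mem \<phi> \<psi>)
  show "\<forall>\<^sub>F n in sequentially. norm (HTb_seminorm N \<rho> (expo (\<phi> + \<psi>) - (\<Sum>k<n. expo_coeff \<phi> \<psi> k)))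
      \<le> ?C * (2 * (1 / 2) ^ n)"
  proof (rule always_eventually, rule allI)
    fix n
    show "norm (HTb_seminorm N \<rho> (expo (\<phi> + \<psi>) - (\<Sum>k<n. expo_coeff \<phi> \<psi> k))) \<le> ?C * (2 * (1 / 2) ^ n)"
      using expo_remainder[OF \<phi> \<psi> order.refl \<rho>, of n] seminorm_nonneg[OF mem \<rho>, of n]
      by (simp add: power_divide)
  qed
  show "(\<lambda>n. ?C * (2 * (1 / 2) ^ n)) \<longlonglongrightarrow> 0"
    by (intro tendsto_mult_right_zero LIMSEQ_realpow_zero) simp_all
qed

text \<open>Along a line, \<open>z \<mapsto> exp (\<phi> + z * \<psi>)\<close> is an entire function with values in the space; its
  Taylor coefficients are limits of difference quotients, so they stay in a closed subspace
  that contains its values near 0.\<close>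

lemma expo_coeff_in_closed:
  assumes W: "W \<subseteq> HTb \<Theta> N" "cfun.subspace W" "cl W \<subseteq> W"
    and \<phi>: "\<phi> \<in> cdual" and \<psi>: "\<psi> \<in> cdual" and \<epsilon>: "\<epsilon> > 0"
    and line: "\<And>z. cmod z < \<epsilon> \<Longrightarrow> expo (\<phi> + cmult z \<psi>) \<in> W"
  shows "expo_coeff \<phi> \<psi> n \<in> W"
proof (induction n rule: less_induct)
  case (less n)
  let ?c = "expo_coeff \<phi> \<psi>"
  \<comment> \<open>Increments tending to 0 inside the given disc; the bound 1/2 makes
    \<open>r = 1 / cmod (z j)\<close> admissible in \<open>expo_remainder\<close>.\<close>
  define z where "z = (\<lambda>j. complex_of_real (min (1 / 2) (\<epsilon> / 2) * (1 / 2) ^ j))"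
  have norm_z: "cmod (z j) = min (1 / 2) (\<epsilon> / 2) * (1 / 2) ^ j" for j
    using \<epsilon> unfolding z_def norm_of_real by (simp add: abs_mult)
  have pow_le: "(1 / 2 :: real) ^ j \<le> 1" for j
    by (simp add: power_le_one)
  have z_pos: "cmod (z j) > 0" for j
    using \<epsilon> unfolding norm_z by (simp add: min_def)
  have z_half: "cmod (z j) \<le> 1 / 2" and z_eps: "cmod (z j) < \<epsilon>" for j
  proof -
    have "cmod (z j) \<le> min (1 / 2) (\<epsilon> / 2)"
      unfolding norm_z using mult_left_mono[OF pow_le[of j], of "min (1 / 2) (\<epsilon> / 2)"] \<epsilon> by simp
    then show "cmod (z j) \<le> 1 / 2" "cmod (z j) < \<epsilon>"
      using \<epsilon> by linarith+
  qed
  have z_lim: "(\<lambda>j. cmod (z j)) \<longlonglongrightarrow> 0"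
    unfolding norm_z by (intro tendsto_mult_right_zero LIMSEQ_realpow_zero) simp_all
  define R where "R = (\<lambda>j n. expo (\<phi> + cmult (z j) \<psi>) - (\<Sum>k<n. expo_coeff \<phi> (cmult (z j) \<psi>) k))"
  define s where "s = (\<lambda>j. fscale (1 / z j ^ n) (R j n))"
  have RX: "R j m \<in> HTb \<Theta> N" for j m
    unfolding R_def
    by (intro diff_mem expo_mem cdual_add cdual_cmult cfun.subspace_sum[OF subspace_HTb] expo_coeff_mem \<phi> \<psi>)
  \<comment> \<open>The value on the line is in \<open>W\<close> by hypothesis, the subtracted terms
    are so by induction.\<close>
  have "R j n \<in> W" for j
    unfolding R_def expo_coeff_cmult
    by (intro cfun.subspace_diff[OF W(2)] cfun.subspace_sum[OF W(2)] cfun.subspace_scale[OF W(2)] line z_eps less)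
       simp
  then have "s j \<in> W" for j
    unfolding s_def by (rule cfun.subspace_scale[OF W(2)])
  then have s: "s j \<in> cl W" for j
    using cl_superset[OF W(1)] by blast
  have "?c n \<in> cl W"
  proof (rule cl_limit[OF W(1) expo_coeff_mem[OF \<phi> \<psi>] s])
    fix l
    let ?p = "HTb_seminorm N (real (Suc l))"
    let ?C = "exp (real (Suc l) * (K * (norm \<phi> + norm \<psi>)))"
    have bound: "?p (?c n - s j) \<le> 2 * ?C * cmod (z j)" for j
    proof -
      have z0: "z j \<noteq> 0"
        using z_pos[of j] by auto
      \<comment> \<open>Passing from \<open>n\<close> to \<open>Suc n\<close> subtracts the term of
        degree \<open>n\<close>, so the error of the quotient is the next remainder divided by
        \<open>z j ^ n\<close>: order \<open>cmod (z j) ^ Suc n\<close> over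
        \<open>cmod (z j) ^ n\<close>.\<close>
      have "?c n - s j = fscale (- 1 / z j ^ n) (R j (Suc n))"
        by (rule ext) (use z0 in \<open>simp add: s_def R_def fscale_def expo_coeff_cmult field_simps\<close>)
      then have "?p (?c n - s j) = ?p (R j (Suc n)) / cmod (z j) ^ n"
        using seminorm_scale[OF RX, of "real (Suc l)" "- 1 / z j ^ n" j "Suc n"]
        by (simp add: norm_divide norm_power)
      also have "\<dots> \<le> (?C * (2 * cmod (z j) ^ Suc n)) / cmod (z j) ^ n"
      proof (rule divide_right_mono)
        have r: "1 / cmod (z j) \<ge> 2"
          using z_half[of j] z_pos[of j] by (simp add: field_simps)
        have "norm \<phi> + 1 / cmod (z j) * norm (cmult (z j) \<psi>) \<le> norm \<phi> + norm \<psi>"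
          using norm_cmult_le[of "z j" \<psi>] z_pos[of j] by (simp add: field_simps)
        then have "exp (real (Suc l) * (K * (norm \<phi> + 1 / cmod (z j) * norm (cmult (z j) \<psi>)))) \<le> ?C"
          using K_pos by (subst exp_le_cancel_iff) (intro mult_left_mono; simp)
        then have "exp (real (Suc l) * (K * (norm \<phi> + 1 / cmod (z j) * norm (cmult (z j) \<psi>))))
            * (2 / (1 / cmod (z j)) ^ Suc n) \<le> ?C * (2 / (1 / cmod (z j)) ^ Suc n)"
          by (intro mult_right_mono) simp_all
        with expo_remainder[OF \<phi> cdual_cmult[OF \<psi>] r, of "real (Suc l)" "z j" "Suc n"]
        have "?p (R j (Suc n)) \<le> ?C * (2 / (1 / cmod (z j)) ^ Suc n)"
          unfolding R_def by simp
        then show "?p (R j (Suc n)) \<le> ?C * (2 * cmod (z j) ^ Suc n)"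
          by (simp add: power_divide)
      qed simp
      also have "\<dots> = 2 * ?C * cmod (z j)"
        using z_pos[of j] by simp
      finally show ?thesis .
    qed
    have nonneg: "?p (?c n - s j) \<ge> 0" for j
      using W(1) \<open>\<And>j. s j \<in> W\<close> by (intro seminorm_nonneg diff_mem expo_coeff_mem \<phi> \<psi>) auto
    show "(\<lambda>j. ?p (?c n - s j)) \<longlonglongrightarrow> 0"
    proof (rule Lim_null_comparison)
      show "\<forall>\<^sub>F j in sequentially. norm (?p (?c n - s j)) \<le> 2 * ?C * cmod (z j)"
        using bound nonneg by (intro always_eventually allI) (simp only: real_norm_def abs_of_nonneg)
      show "(\<lambda>j. 2 * ?C * cmod (z j)) \<longlonglongrightarrow> 0"
        by (rule tendsto_mult_right_zero[OF z_lim])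
    qed
  qed
  then show ?case
    using W(3) by blast
qed

text \<open>The disc of radius \<epsilon> may depend on the direction, so continuity along lines is
  enough to apply this. It yields separability, density of both families of orbits, and the
  recognition of scalar operators.\<close>

lemma closed_subspace_eq_HTb:
  assumes W: "W \<subseteq> HTb \<Theta> N" "cfun.subspace W" "cl W \<subseteq> W"
    and \<phi>: "\<phi> \<in> cdual"
    and line: "\<And>\<psi>. \<psi> \<in> cdual \<Longrightarrow> \<exists>\<epsilon>>0. \<forall>z. cmod z < \<epsilon> \<longrightarrow> expo (\<phi> + cmult z \<psi>) \<in> W"
  shows "W = HTb \<Theta> N"
proof
  have expo: "expo \<psi> \<in> W" if \<psi>: "\<psi> \<in> cdual" for \<psi>
  proof -
    have \<delta>: "\<psi> - \<phi> \<in> cdual"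
      by (rule cdual_diff[OF \<psi> \<phi>])
    \<comment> \<open>The direction \<psi> - \<phi> makes \<psi> the point z = 1 of the line, where
      the series still converges although \<open>W\<close> is only known to contain a small
      disc.\<close>
    obtain \<epsilon> where "\<epsilon> > 0" "\<And>z. cmod z < \<epsilon> \<Longrightarrow> expo (\<phi> + cmult z (\<psi> - \<phi>)) \<in> W"
      using line[OF \<delta>] by blast
    then have "expo_coeff \<phi> (\<psi> - \<phi>) k \<in> W" for k
      by (rule expo_coeff_in_closed[OF W \<phi> \<delta>])
    then have "(\<Sum>k<n. expo_coeff \<phi> (\<psi> - \<phi>) k) \<in> W" for n
      by (intro cfun.subspace_sum[OF W(2)])
    then have s: "(\<Sum>k<n. expo_coeff \<phi> (\<psi> - \<phi>) k) \<in> cl W" for n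
      using cl_superset[OF W(1)] by blast
    have "expo \<psi> \<in> cl W"
    proof (rule cl_limit[OF W(1) expo_mem[OF \<psi>] s])
      show "(\<lambda>n. HTb_seminorm N (real (Suc l)) (expo \<psi> - (\<Sum>k<n. expo_coeff \<phi> (\<psi> - \<phi>) k))) \<longlonglongrightarrow> 0" for l
        using expo_series_converges[OF \<phi> \<delta>, of "real (Suc l)"] by simp
    qed
    then show ?thesis
      using W(3) by blast
  qed
  have power: "(\<lambda>x. blinfun_apply \<psi> x ^ m) \<in> W" if \<psi>: "\<psi> \<in> cdual" for \<psi> m
  proof -
    \<comment> \<open>At base point 0 the coefficients are the powers of \<psi> divided by m!, as
      exp(0) = 1.\<close>
    have "expo_coeff 0 \<psi> m \<in> W"
      using expo cdual_add cdual_0 cdual_cmult[OF \<psi>]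
      by (intro expo_coeff_in_closed[OF W cdual_0 \<psi> zero_less_one]) auto
    then have "fscale (fact m) (expo_coeff 0 \<psi> m) \<in> W"
      by (rule cfun.subspace_scale[OF W(2)])
    moreover have "fscale (fact m) (expo_coeff 0 \<psi> m) = (\<lambda>x. blinfun_apply \<psi> x ^ m)"
      by (rule ext) (simp add: fscale_def expo_coeff_def)
    ultimately show ?thesis
      by simp
  qed
  have finite_type: "cpoly_finite_type m \<subseteq> W" for m
    unfolding cpoly_finite_type_def using power by (intro cfun.span_minimal W(2)) blast
  have homogeneous: "P \<in> W" if P: "P \<in> \<Theta> m" for P m
  proof -
    have "P \<in> cl W"
    proof (rule clI[OF homogeneous_mem(1)[OF P]])
      fix n and e :: real assume e: "e > 0"
      \<comment> \<open>On \<open>\<Theta> m\<close> the seminorm of radius \<open>Suc n\<close> is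
        the norm times \<open>Suc n ^ m\<close>, whence this tolerance.\<close>
      obtain Q where Q: "Q \<in> cpoly_finite_type m" "N m (P - Q) < e / real (Suc n) ^ m"
        using finite_type_dense[OF P, of "e / real (Suc n) ^ m"] e by auto
      have "P - Q \<in> \<Theta> m"
        using Q(1) finite_type_subset P by (intro Theta_diff) auto
      then have "HTb_seminorm N (real (Suc n)) (P - Q) = real (Suc n) ^ m * N m (P - Q)"
        by (rule homogeneous_mem(2)) simp
      also have "\<dots> < e"
        using Q(2) by (simp add: pos_less_divide_eq mult.commute)
      finally show "\<exists>g\<in>W. HTb_seminorm N (real (Suc n)) (P - g) < e"
        using finite_type Q(1) by blast
    qed
    then show ?thesis
      using W(3) by blast
  qed
  show "HTb \<Theta> N \<subseteq> W"
  proof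
    fix f assume f: "f \<in> HTb \<Theta> N"
    then obtain P where P: "rapid P" "f = power_sum P"
      unfolding HTb_iff by blast
    have "(\<Sum>k<n. P k) \<in> W" for n
      using homogeneous[OF rapidD(1)[OF P(1)]] by (intro cfun.subspace_sum[OF W(2)])
    then have s: "(\<Sum>k<n. P k) \<in> cl W" for n
      using cl_superset[OF W(1)] by blast
    have "f \<in> cl W"
      by (rule cl_limit[OF W(1) f s]) (unfold P(2), rule partial_sums_converge[OF P(1)], simp)
    then show "f \<in> W"
      using W(3) by blast
  qed
qed (rule W(1))

end

section \<open>Separability\<close>

definition gauss_rationals :: "complex set"
  where "gauss_rationals = range (\<lambda>(a, b). Complex (of_rat a) (of_rat b))"

lemma countable_gauss_rationals: "countable gauss_rationals"
  by (simp add: gauss_rationals_def)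

lemma gauss_rationals_mult:
  assumes "c \<in> gauss_rationals" "d \<in> gauss_rationals"
  shows "c * d \<in> gauss_rationals"
proof -
  obtain p q r s where "c = Complex (of_rat p) (of_rat q)" "d = Complex (of_rat r) (of_rat s)"
    using assms by (auto simp: gauss_rationals_def)
  then have "c * d = (\<lambda>(a, b). Complex (of_rat a) (of_rat b)) (p * r - q * s, p * s + q * r)"
    by (simp add: complex_eq_iff of_rat_diff of_rat_add of_rat_mult)
  then show ?thesis
    unfolding gauss_rationals_def by (rule range_eqI)
qed

lemma one_gauss_rational: "1 \<in> gauss_rationals"
  unfolding gauss_rationals_def by (rule range_eqI[of _ _ "(1, 0)"]) (simp add: complex_eq_iff)

lemma gauss_rationals_dense:
  assumes "e > 0"
  shows "\<exists>q\<in>gauss_rationals. cmod (c - q) < e"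
proof -
  obtain a where a: "Re c < of_rat a" "of_rat a < Re c + e / 2"
    using of_rat_dense[of "Re c" "Re c + e / 2"] assms by auto
  obtain b where b: "Im c < of_rat b" "of_rat b < Im c + e / 2"
    using of_rat_dense[of "Im c" "Im c + e / 2"] assms by auto
  have "cmod (c - Complex (of_rat a) (of_rat b)) < e"
    using cmod_le[of "c - Complex (of_rat a) (of_rat b)"] a b by simp
  moreover have "Complex (of_rat a) (of_rat b) \<in> gauss_rationals"
    unfolding gauss_rationals_def by (rule range_eqI[of _ _ "(a, b)"]) simp
  ultimately show ?thesis
    by blast
qed

lemma mult_less_if_less_divide: "a < b / c \<Longrightarrow> 0 < c \<Longrightarrow> a * c < b" for a b c :: real
  by (simp add: pos_less_divide_eq)

context pi1_type_on
begin

text \<open>The dense set consists of finite combinations, with Gaussian rational coefficients, of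
  exponentials at a countable dense set of functionals. It is closed under such scalars only, but
  its closure is a complex subspace, so \<open>closed_subspace_eq_HTb\<close> applies.\<close>

lemma HTb_separable:
  fixes \<Phi> :: "('a \<Rightarrow>\<^sub>L complex) set"
  assumes \<Phi>: "countable \<Phi>" "\<Phi> \<subseteq> cdual"
    and dense: "\<And>\<phi> e. \<phi> \<in> cdual \<Longrightarrow> e > 0 \<Longrightarrow> \<exists>\<eta>\<in>\<Phi>. norm (\<eta> - \<phi>) < e"
  shows "\<exists>D. countable D \<and> D \<noteq> {} \<and> D \<subseteq> HTb \<Theta> N \<and> cl D = HTb \<Theta> N"
proof -
  define lc :: "(complex \<times> ('a \<Rightarrow>\<^sub>L complex)) list \<Rightarrow> 'a \<Rightarrow> complex"
    where "lc = (\<lambda>xs. sum_list (map (\<lambda>(c, \<phi>). fscale c (expo \<phi>)) xs))"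
  define D where "D = lc ` lists (gauss_rationals \<times> \<Phi>)"
  have lc_Nil: "lc [] = 0" and lc_Cons: "lc ((c, \<phi>) # xs) = fscale c (expo \<phi>) + lc xs" for c \<phi> xs
    unfolding lc_def by simp_all
  have lc_append: "lc (xs @ ys) = lc xs + lc ys" for xs ys
    unfolding lc_def by simp
  have lc_scale: "lc (map (\<lambda>(c, \<phi>). (q * c, \<phi>)) xs) = fscale q (lc xs)" for q xs
  proof (induction xs)
    case (Cons y ys)
    obtain c \<phi> where "y = (c, \<phi>)"
      by (cases y)
    with Cons.IH show ?case
      by (simp only: list.map prod.case lc_Cons cfun.scale_right_distrib cfun.scale_scale)
  qed (simp only: list.map lc_Nil cfun.scale_zero_right)
  have D_scale: "fscale q g \<in> D" if "q \<in> gauss_rationals" "g \<in> D" for q g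
  proof -
    obtain xs where xs: "xs \<in> lists (gauss_rationals \<times> \<Phi>)" "g = lc xs"
      using \<open>g \<in> D\<close> by (auto simp: D_def)
    have "map (\<lambda>(c, \<phi>). (q * c, \<phi>)) xs \<in> lists (gauss_rationals \<times> \<Phi>)"
      using xs(1) that(1) by (auto simp: lists_eq_set gauss_rationals_mult subset_iff)
    then show ?thesis
      unfolding xs(2) lc_scale[symmetric] D_def by (rule imageI)
  qed
  have D_add: "f + g \<in> D" if "f \<in> D" "g \<in> D" for f g
  proof -
    obtain xs ys where "xs \<in> lists (gauss_rationals \<times> \<Phi>)" "ys \<in> lists (gauss_rationals \<times> \<Phi>)"
      "f = lc xs" "g = lc ys"
      using \<open>f \<in> D\<close> \<open>g \<in> D\<close> by (auto simp: D_def)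
    then have "f + g = lc (xs @ ys)" "xs @ ys \<in> lists (gauss_rationals \<times> \<Phi>)"
      by (simp_all only: lc_append append_in_lists_conv)
    then show ?thesis
      unfolding D_def by blast
  qed
  have D_expo: "expo \<eta> \<in> D" if "\<eta> \<in> \<Phi>" for \<eta>
  proof -
    have "lc [(1, \<eta>)] = expo \<eta>"
      by (simp only: lc_Cons lc_Nil cfun.scale_one add_0_right)
    moreover have "[(1, \<eta>)] \<in> lists (gauss_rationals \<times> \<Phi>)"
      using one_gauss_rational that by simp
    ultimately show ?thesis
      unfolding D_def by (metis imageI)
  qed
  have lc_mem: "lc xs \<in> HTb \<Theta> N" if "xs \<in> lists (gauss_rationals \<times> \<Phi>)" for xs
    using that
  proof (induction xs)
    case Nil
    then show ?case
      using zero_mem by (simp only: lc_Nil)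
  next
    case (Cons y ys)
    obtain c \<phi> where y: "y = (c, \<phi>)"
      by (cases y)
    have "fscale c (expo \<phi>) \<in> HTb \<Theta> N"
      using Cons \<Phi>(2) by (intro cfun.subspace_scale[OF subspace_HTb] expo_mem) (auto simp: y)
    then show ?case
      unfolding y lc_Cons by (rule add_mem) (fact Cons.IH)
  qed
  then have D: "D \<subseteq> HTb \<Theta> N"
    by (auto simp: D_def)
  have "countable (lists (gauss_rationals \<times> \<Phi>))"
    using countable_gauss_rationals \<Phi>(1) by (intro countable_lists countable_SIGMA)
  then have countable: "countable D"
    unfolding D_def by (rule countable_image)
  have D0: "0 \<in> D"
    unfolding D_def by (rule image_eqI[of _ _ "[]"]) (simp_all only: lc_Nil lists.Nil)
  have sub: "cfun.subspace (cl D)"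
  proof (rule cfun.subspaceI)
    show "0 \<in> cl D"
      using cl_superset[OF D] D0 by blast
    show "f + g \<in> cl D" if "f \<in> cl D" "g \<in> cl D" for f g
      by (rule cl_add[OF D D_add that])
    show "fscale c f \<in> cl D" if f: "f \<in> cl D" for c f
    proof (rule clI)
      note fX = clD(1)[OF f]
      show "fscale c f \<in> HTb \<Theta> N"
        by (rule cfun.subspace_scale[OF subspace_HTb fX])
      fix n and e :: real assume e: "e > 0"
      let ?p = "HTb_seminorm N (real (Suc n))"
      have f0: "?p f \<ge> 0"
        by (rule seminorm_nonneg[OF fX]) simp
      \<comment> \<open>The scalar \<open>q\<close> is chosen against the seminorm of
        \<open>f\<close>, and only afterwards \<open>g\<close> against the size of \<open>q\<close>;
        the added 1 avoids division by zero.\<close>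
      obtain q where q: "q \<in> gauss_rationals" "cmod (c - q) < e / 2 / (?p f + 1)"
        using gauss_rationals_dense[of "e / 2 / (?p f + 1)" c] e f0 by auto
      obtain g where g: "g \<in> D" "?p (f - g) < e / 2 / (cmod q + 1)"
        using clD(2)[OF f, of "e / 2 / (cmod q + 1)" n] e by (auto simp: add_nonneg_pos)
      have gX: "g \<in> HTb \<Theta> N" and fg: "f - g \<in> HTb \<Theta> N"
        using g D by (auto intro: diff_mem fX)
      have "fscale c f - fscale q g = fscale (c - q) f + fscale q (f - g)"
        by (rule ext) (simp add: fscale_def algebra_simps)
      then have "?p (fscale c f - fscale q g) \<le> cmod (c - q) * ?p f + cmod q * ?p (f - g)"
        using seminorm_add[of "fscale (c - q) f" "fscale q (f - g)" "real (Suc n)"]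
          seminorm_scale[OF fX, of "real (Suc n)" "c - q"] seminorm_scale[OF fg, of "real (Suc n)" q]
          cfun.subspace_scale[OF subspace_HTb fX] cfun.subspace_scale[OF subspace_HTb fg] by simp
      moreover have "cmod (c - q) * ?p f \<le> cmod (c - q) * (?p f + 1)"
        by (intro mult_left_mono) simp_all
      moreover have "cmod (c - q) * (?p f + 1) < e / 2"
        by (rule mult_less_if_less_divide[OF q(2)]) (use f0 in linarith)
      moreover have "cmod q * ?p (f - g) \<le> ?p (f - g) * (cmod q + 1)"
        using seminorm_nonneg[OF fg, of "real (Suc n)"]
        unfolding distrib_left mult.commute[of "cmod q"] by simp
      moreover have "?p (f - g) * (cmod q + 1) < e / 2"
        by (rule mult_less_if_less_divide[OF g(2)]) (simp add: add_nonneg_pos)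
      ultimately have "?p (fscale c f - fscale q g) < e"
        by linarith
      then show "\<exists>h\<in>D. ?p (fscale c f - h) < e"
        using D_scale[OF q(1) g(1)] by blast
    qed
  qed
  have expo: "expo \<phi> \<in> cl D" if \<phi>: "\<phi> \<in> cdual" for \<phi>
  proof (rule clI[OF expo_mem[OF \<phi>]])
    fix n and e :: real assume e: "e > 0"
    let ?C = "exp (real (Suc n) * (K * (norm \<phi> + 1))) * 2"
    \<comment> \<open>The bound 1/2 is the range of validity of
      \<open>expo_continuous\<close>.\<close>
    obtain \<eta> where \<eta>: "\<eta> \<in> \<Phi>" "norm (\<eta> - \<phi>) < min (1 / 2) (e / ?C)"
      using dense[OF \<phi>, of "min (1 / 2) (e / ?C)"] e by auto
    have \<eta>': "\<eta> \<in> cdual"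
      using \<eta> \<Phi> by blast
    have "HTb_seminorm N (real (Suc n)) (expo \<eta> - expo \<phi>) \<le> ?C * norm (\<eta> - \<phi>)"
      using expo_continuous[OF \<phi> cdual_diff[OF \<eta>' \<phi>], of "real (Suc n)"] \<eta>(2) by simp
    also have "\<dots> < e"
      using \<eta>(2) by (simp add: pos_less_divide_eq mult.commute)
    finally have "HTb_seminorm N (real (Suc n)) (expo \<phi> - expo \<eta>) < e"
      using p_commute[OF expo_mem[OF \<eta>'] expo_mem[OF \<phi>], of n] by simp
    then show "\<exists>g\<in>D. HTb_seminorm N (real (Suc n)) (expo \<phi> - g) < e"
      using D_expo[OF \<eta>(1)] by blast
  qed
  have "cl D = HTb \<Theta> N"
  proof (rule closed_subspace_eq_HTb[OF _ sub cl_cl[OF D] cdual_0])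
    show "cl D \<subseteq> HTb \<Theta> N"
      using clD(1) by blast
    show "\<exists>\<epsilon>>0. \<forall>z. cmod z < \<epsilon> \<longrightarrow> expo (0 + cmult z \<psi>) \<in> cl D" if "\<psi> \<in> cdual" for \<psi>
      using expo[OF cdual_add[OF cdual_0 cdual_cmult[OF that]]] zero_less_one by blast
  qed
  with countable D D0 show ?thesis
    by blast
qed

section \<open>The topology\<close>

lemma topspace_HTb: "topspace (HTb_topology \<Theta> N) = HTb \<Theta> N"
proof -
  let ?S = "{{g \<in> HTb \<Theta> N. HTb_seminorm N \<rho> (g - f) < \<epsilon>} | f \<rho> \<epsilon>. f \<in> HTb \<Theta> N \<and> 0 < \<rho> \<and> 0 < \<epsilon>}"
  have "f \<in> \<Union>?S" if f: "f \<in> HTb \<Theta> N" for f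
  proof (rule UnionI)
    show "f \<in> {g \<in> HTb \<Theta> N. HTb_seminorm N 1 (g - f) < 1}"
      using f by (simp add: seminorm_0)
    show "{g \<in> HTb \<Theta> N. HTb_seminorm N 1 (g - f) < 1} \<in> ?S"
      using f zero_less_one by blast
  qed
  then show ?thesis
    unfolding HTb_topology_def topology_generated_by_topspace by blast
qed

lemma openin_ball:
  assumes "f \<in> HTb \<Theta> N" and "e > 0"
  shows "openin (HTb_topology \<Theta> N) {g \<in> HTb \<Theta> N. HTb_seminorm N (real (Suc n)) (g - f) < e}"
  unfolding HTb_topology_def
proof (rule topology_generated_by_Basis)
  have "0 < real (Suc n)"
    by simp
  with assms show "{g \<in> HTb \<Theta> N. HTb_seminorm N (real (Suc n)) (g - f) < e} \<in>
      {{g \<in> HTb \<Theta> N. HTb_seminorm N \<rho> (g - f) < \<epsilon>} | f \<rho> \<epsilon>. f \<in> HTb \<Theta> N \<and> 0 < \<rho> \<and> 0 < \<epsilon>}"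
    by blast
qed

text \<open>The generating sets form a mere subbase with arbitrary centres and arbitrary \<rho>;
  balls around \<open>f\<close> with integer \<rho> nevertheless form a neighbourhood base.
  Intersections are handled by the larger index, other centres by the triangle inequality.\<close>

lemma openin_imp_ball:
  assumes "openin (HTb_topology \<Theta> N) U" and "f \<in> U"
  shows "\<exists>n. \<exists>e>0. {g \<in> HTb \<Theta> N. HTb_seminorm N (real (Suc n)) (g - f) < e} \<subseteq> U"
proof -
  have fX: "f \<in> HTb \<Theta> N"
    using openin_subset[OF assms(1)] assms(2) topspace_HTb by blast
  have "generate_topology_on {{g \<in> HTb \<Theta> N. HTb_seminorm N \<rho> (g - f) < \<epsilon>} | f \<rho> \<epsilon>.
      f \<in> HTb \<Theta> N \<and> 0 < \<rho> \<and> 0 < \<epsilon>} U"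
    using assms(1) unfolding HTb_topology_def by (rule openin_topology_generated_by)
  then show ?thesis
    using assms(2)
  proof (induction rule: generate_topology_on.induct)
    case Empty
    then show ?case
      by simp
  next
    case (Int U V)
    obtain n d where n: "d > 0" "{g \<in> HTb \<Theta> N. HTb_seminorm N (real (Suc n)) (g - f) < d} \<subseteq> U"
      using Int by blast
    obtain m e where m: "e > 0" "{g \<in> HTb \<Theta> N. HTb_seminorm N (real (Suc m)) (g - f) < e} \<subseteq> V"
      using Int by blast
    have "g \<in> U \<inter> V" if "g \<in> HTb \<Theta> N" "HTb_seminorm N (real (Suc (max m n))) (g - f) < min d e" for g
    proof -
      have gf: "g - f \<in> HTb \<Theta> N"
        by (rule diff_mem[OF that(1) fX])
      have "HTb_seminorm N (real (Suc n)) (g - f) < d" "HTb_seminorm N (real (Suc m)) (g - f) < e"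
        using p_mono[OF gf, of n "max m n"] p_mono[OF gf, of m "max m n"] that(2) by simp_all
      with n m that(1) show ?thesis
        by blast
    qed
    then have "{g \<in> HTb \<Theta> N. HTb_seminorm N (real (Suc (max m n))) (g - f) < min d e} \<subseteq> U \<inter> V"
      by blast
    moreover have "min d e > 0"
      using n(1) m(1) by simp
    ultimately show ?case
      by blast
  next
    case (UN \<U>)
    then show ?case
      by blast
  next
    case (Basis U)
    then obtain f0 \<rho> \<epsilon> where U: "U = {g \<in> HTb \<Theta> N. HTb_seminorm N \<rho> (g - f0) < \<epsilon>}"
      and f0: "f0 \<in> HTb \<Theta> N" and \<rho>: "\<rho> > 0"
      by blast
    have f: "f \<in> HTb \<Theta> N" "HTb_seminorm N \<rho> (f - f0) < \<epsilon>"
      using Basis U by auto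
    obtain n where n: "\<rho> \<le> real n"
      using real_arch_simple by blast
    have "g \<in> U" if g: "g \<in> HTb \<Theta> N" "HTb_seminorm N (real (Suc n)) (g - f) < \<epsilon> - HTb_seminorm N \<rho> (f - f0)" for g
    proof -
      have "HTb_seminorm N \<rho> ((g - f) + (f - f0)) \<le> HTb_seminorm N \<rho> (g - f) + HTb_seminorm N \<rho> (f - f0)"
        using \<rho> by (intro seminorm_add diff_mem g f f0) simp
      moreover have "(g - f) + (f - f0) = g - f0"
        by simp
      moreover have "HTb_seminorm N \<rho> (g - f) \<le> HTb_seminorm N (real (Suc n)) (g - f)"
        using \<rho> n by (intro seminorm_mono diff_mem g f) simp_all
      ultimately have "HTb_seminorm N \<rho> (g - f0) < \<epsilon>"
        using g(2) by simp
      with g(1) show ?thesis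
        by (simp add: U)
    qed
    then have "{g \<in> HTb \<Theta> N. HTb_seminorm N (real (Suc n)) (g - f) < \<epsilon> - HTb_seminorm N \<rho> (f - f0)} \<subseteq> U"
      by blast
    moreover have "\<epsilon> - HTb_seminorm N \<rho> (f - f0) > 0"
      using f(2) by simp
    ultimately show ?case
      by blast
  qed
qed

end

section \<open>Convolution operators\<close>

locale convolution = pi1_type_on +
  fixes L :: "('a \<Rightarrow> complex) \<Rightarrow> 'a \<Rightarrow> complex"
  assumes conv: "convolution_operator \<Theta> N L"
begin

lemma L_mem: "f \<in> HTb \<Theta> N \<Longrightarrow> L f \<in> HTb \<Theta> N"
  and L_add: "f \<in> HTb \<Theta> N \<Longrightarrow> g \<in> HTb \<Theta> N \<Longrightarrow> L (f + g) = L f + L g"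
  and L_scale: "f \<in> HTb \<Theta> N \<Longrightarrow> L (fscale c f) = fscale c (L f)"
  and L_translate: "f \<in> HTb \<Theta> N \<Longrightarrow> L (translate a f) = translate a (L f)"
  and L_continuous: "continuous_map (HTb_topology \<Theta> N) (HTb_topology \<Theta> N) L"
  using conv unfolding convolution_operator_def by blast+

lemma L_0: "L 0 = 0"
  using L_scale[OF zero_mem, of 0] by (simp only: cfun.scale_zero_left)

lemma L_diff:
  assumes "f \<in> HTb \<Theta> N" "g \<in> HTb \<Theta> N"
  shows "L (f - g) = L f - L g"
  using L_add[OF diff_mem[OF assms] assms(2)] by (simp add: algebra_simps)

lemma L_sum:
  assumes "\<And>i. i \<in> I \<Longrightarrow> f i \<in> HTb \<Theta> N"
  shows "L (sum f I) = (\<Sum>i\<in>I. L (f i))"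
  using assms
proof (induction I rule: infinite_finite_induct)
  case (insert i I)
  have "sum f I \<in> HTb \<Theta> N"
    using insert.prems by (intro cfun.subspace_sum[OF subspace_HTb]) simp
  then have "L (f i + sum f I) = L (f i) + L (sum f I)"
    using insert.prems by (intro L_add) simp_all
  moreover have "L (sum f I) = (\<Sum>i\<in>I. L (f i))"
    using insert.prems by (intro insert.IH) simp
  ultimately show ?case
    unfolding sum.insert[OF insert.hyps] by (simp only:)
qed (simp_all add: L_0)

lemma L_cont:
  assumes "e > 0"
  shows "\<exists>m d. d > 0 \<and> (\<forall>f\<in>HTb \<Theta> N. HTb_seminorm N (real (Suc m)) f < d \<longrightarrow>
    HTb_seminorm N (real (Suc n)) (L f) < e)"
proof -
  let ?U = "{g \<in> HTb \<Theta> N. HTb_seminorm N (real (Suc n)) (g - 0) < e}"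
  have "openin (HTb_topology \<Theta> N) {f \<in> HTb \<Theta> N. L f \<in> ?U}"
    using openin_continuous_map_preimage[OF L_continuous openin_ball[OF zero_mem assms, of n]]
    unfolding topspace_HTb .
  moreover have "0 \<in> {f \<in> HTb \<Theta> N. L f \<in> ?U}"
    using assms by (simp add: L_0 zero_mem seminorm_0)
  ultimately obtain m d where "d > 0"
    "{g \<in> HTb \<Theta> N. HTb_seminorm N (real (Suc m)) (g - 0) < d} \<subseteq> {f \<in> HTb \<Theta> N. L f \<in> ?U}"
    using openin_imp_ball by blast
  then show ?thesis
    by (intro exI[of _ m] exI[of _ d]) auto
qed

text \<open>Evaluation at 0 reads off the factor because exponentials are 1 there.\<close>

definition eigenvalue :: "('a \<Rightarrow>\<^sub>L complex) \<Rightarrow> complex"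
  where "eigenvalue \<phi> = L (expo \<phi>) 0"

lemma L_expo:
  assumes \<phi>: "\<phi> \<in> cdual"
  shows "L (expo \<phi>) = fscale (eigenvalue \<phi>) (expo \<phi>)"
proof
  fix x
  have "translate (- x) (expo \<phi>) = fscale (exp (blinfun_apply \<phi> x)) (expo \<phi>)"
    by (rule ext) (simp add: translate_def expo_def fscale_def blinfun.add_right exp_add)
  then have "translate (- x) (L (expo \<phi>)) = fscale (exp (blinfun_apply \<phi> x)) (L (expo \<phi>))"
    using L_translate[OF expo_mem[OF \<phi>], of "- x"] L_scale[OF expo_mem[OF \<phi>]] by simp
  \<comment> \<open>At 0 the translated function has the value of \<open>L (expo \<phi>)\<close> at
    \<open>x\<close>.\<close>
  then have "translate (- x) (L (expo \<phi>)) 0 = fscale (exp (blinfun_apply \<phi> x)) (L (expo \<phi>)) 0"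
    by (rule fun_cong)
  then show "L (expo \<phi>) x = fscale (eigenvalue \<phi>) (expo \<phi>) x"
    by (simp add: translate_def fscale_def eigenvalue_def expo_def)
qed

lemma L_pow_expo:
  assumes \<phi>: "\<phi> \<in> cdual"
  shows "(L ^^ k) (expo \<phi>) = fscale (eigenvalue \<phi> ^ k) (expo \<phi>)"
proof (induction k)
  case (Suc k)
  then show ?case
    using L_scale[OF expo_mem[OF \<phi>]] by (simp add: L_expo[OF \<phi>] mult.commute)
qed simp

text \<open>The series for exp(\<phi> + z \<psi>) converges in the space, and \<open>L\<close>
  followed by evaluation at 0 is continuous and linear, so it may be applied term by term. This
  gives holomorphy on the line.\<close>

lemma eigenvalue_sums:
  assumes \<phi>: "\<phi> \<in> cdual" and \<psi>: "\<psi> \<in> cdual"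
  shows "(\<lambda>n. L (expo_coeff \<phi> \<psi> n) 0 * z ^ n) sums eigenvalue (\<phi> + cmult z \<psi>)"
proof -
  note z\<psi> = cdual_cmult[OF \<psi>, of z]
  note cX = expo_coeff_mem[OF \<phi> \<psi>]
  define R where "R = (\<lambda>n. expo (\<phi> + cmult z \<psi>) - (\<Sum>k<n. expo_coeff \<phi> (cmult z \<psi>) k))"
  have sX: "(\<Sum>k<n. expo_coeff \<phi> (cmult z \<psi>) k) \<in> HTb \<Theta> N" for n
    by (intro cfun.subspace_sum[OF subspace_HTb] expo_coeff_mem \<phi> z\<psi>)
  have RX: "R n \<in> HTb \<Theta> N" for n
    unfolding R_def by (intro diff_mem sX expo_mem cdual_add \<phi> z\<psi>)
  have "L (R n) = L (expo (\<phi> + cmult z \<psi>)) - (\<Sum>k<n. L (expo_coeff \<phi> (cmult z \<psi>) k))" for n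
    unfolding R_def L_diff[OF expo_mem[OF cdual_add[OF \<phi> z\<psi>]] sX]
    by (simp only: L_sum expo_coeff_mem[OF \<phi> z\<psi>])
  moreover have "L (expo_coeff \<phi> (cmult z \<psi>) k) = fscale (z ^ k) (L (expo_coeff \<phi> \<psi> k))" for k
    unfolding expo_coeff_cmult by (rule L_scale[OF cX])
  ultimately have LR: "L (R n) 0 = eigenvalue (\<phi> + cmult z \<psi>) - (\<Sum>k<n. L (expo_coeff \<phi> \<psi> k) 0 * z ^ k)" for n
    by (simp add: fscale_def eigenvalue_def sum_fun_apply mult.commute)
  have "(\<lambda>n. L (R n) 0) \<longlonglongrightarrow> 0"
  proof (rule tendstoI)
    fix e :: real assume "e > 0"
    from L_cont[OF this, of 0] obtain m d where d: "d > 0"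
      "\<And>f. f \<in> HTb \<Theta> N \<Longrightarrow> HTb_seminorm N (real (Suc m)) f < d \<Longrightarrow> HTb_seminorm N (real (Suc 0)) (L f) < e"
      by blast
    have "(\<lambda>n. HTb_seminorm N (real (Suc m)) (R n)) \<longlonglongrightarrow> 0"
      unfolding R_def by (rule expo_series_converges[OF \<phi> z\<psi>]) simp
    from order_tendstoD(2)[OF this d(1)] show "\<forall>\<^sub>F n in sequentially. dist (L (R n) 0) 0 < e"
    proof eventually_elim
      case (elim n)
      have "cmod (L (R n) 0) \<le> HTb_seminorm N (\<sigma> * norm (0::'a)) (L (R n))"
        by (rule eval_le_seminorm[OF L_mem[OF RX]])
      also have "\<dots> \<le> HTb_seminorm N (real (Suc 0)) (L (R n))"
        by (rule seminorm_mono[OF L_mem[OF RX]]) simp_all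
      also have "\<dots> < e"
        by (rule d(2)[OF RX elim])
      finally show ?case
        by simp
    qed
  qed
  then have "(\<lambda>n. eigenvalue (\<phi> + cmult z \<psi>) - L (R n) 0) \<longlonglongrightarrow> eigenvalue (\<phi> + cmult z \<psi>) - 0"
    by (intro tendsto_diff tendsto_const)
  then show ?thesis
    unfolding sums_def LR by simp
qed

lemma eigenvalue_holomorphic:
  assumes \<phi>: "\<phi> \<in> cdual" and \<psi>: "\<psi> \<in> cdual"
  shows "(\<lambda>z. eigenvalue (\<phi> + cmult z \<psi>)) holomorphic_on UNIV"
proof -
  have ball: "(\<lambda>z. eigenvalue (\<phi> + cmult z \<psi>)) holomorphic_on ball 0 r" for r
    by (rule power_series_holomorphic[where a = "\<lambda>n. L (expo_coeff \<phi> \<psi> n) 0"])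
      (simp add: eigenvalue_sums[OF \<phi> \<psi>])
  have "(\<lambda>z. eigenvalue (\<phi> + cmult z \<psi>)) field_differentiable (at z)" for z
    by (rule holomorphic_on_imp_differentiable_at[OF ball[of "cmod z + 1"]]) simp_all
  then show ?thesis
    by (simp add: holomorphic_on_def field_differentiable_at_within)
qed

lemma eigenvalue_open_on_lines:
  assumes \<phi>: "\<phi> \<in> cdual" and \<psi>: "\<psi> \<in> cdual" and S: "open S" "eigenvalue \<phi> \<in> S"
  shows "\<exists>\<epsilon>>0. \<forall>z. cmod z < \<epsilon> \<longrightarrow> eigenvalue (\<phi> + cmult z \<psi>) \<in> S"
proof -
  let ?h = "\<lambda>z. eigenvalue (\<phi> + cmult z \<psi>)"
  have "cmult 0 \<psi> = 0"
    by (rule blinfun_eqI) simp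
  then have "0 \<in> ?h -` S"
    using S by simp
  moreover have "open (?h -` S)"
    using holomorphic_on_imp_continuous_on[OF eigenvalue_holomorphic[OF \<phi> \<psi>]] S(1)
    by (simp add: continuous_on_open_vimage)
  ultimately obtain \<epsilon> where "\<epsilon> > 0" "ball 0 \<epsilon> \<subseteq> ?h -` S"
    using open_contains_ball by blast
  then show ?thesis
    by (intro exI[of _ \<epsilon>]) auto
qed

text \<open>The set \<open>W\<close> where \<open>L\<close> agrees with multiplication by
  \<open>c\<close> is a closed subspace by continuity of \<open>L\<close>, and it contains every
  exponential.\<close>

lemma scalar_if_eigenvalue_constant:
  assumes c: "\<And>\<phi>. \<phi> \<in> cdual \<Longrightarrow> eigenvalue \<phi> = c" and f: "f \<in> HTb \<Theta> N"
  shows "L f = fscale c f"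
proof -
  define W where "W = {f \<in> HTb \<Theta> N. L f = fscale c f}"
  have WX: "W \<subseteq> HTb \<Theta> N"
    by (auto simp: W_def)
  have sub: "cfun.subspace W"
  proof (rule cfun.subspaceI)
    show "0 \<in> W"
      by (simp only: W_def mem_Collect_eq zero_mem L_0 cfun.scale_zero_right)
  next
    fix f g assume "f \<in> W" "g \<in> W"
    then show "f + g \<in> W"
      by (simp only: W_def mem_Collect_eq add_mem L_add cfun.scale_right_distrib)
  next
    fix d f assume "f \<in> W"
    then show "fscale d f \<in> W"
      by (simp add: W_def cfun.subspace_scale[OF subspace_HTb] L_scale mult.commute)
  qed
  have closed: "cl W \<subseteq> W"
  proof
    fix f assume f: "f \<in> cl W"
    note fX = clD(1)[OF f]
    let ?r = "L f - fscale c f"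
    have rX: "?r \<in> HTb \<Theta> N"
      by (intro diff_mem L_mem fX cfun.subspace_scale[OF subspace_HTb])
    have small: "HTb_seminorm N (real (Suc n)) ?r \<le> e" if "e > 0" for n e
    proof -
      let ?p = "\<lambda>n. HTb_seminorm N (real (Suc n))"
      obtain m d where d: "d > 0" "\<And>f. f \<in> HTb \<Theta> N \<Longrightarrow> ?p m f < d \<Longrightarrow> ?p n (L f) < e / 2"
        using L_cont[of "e / 2" n] \<open>e > 0\<close> by auto
      \<comment> \<open>One approximant has to serve two purposes: \<open>L\<close> must be small on
        the difference, and so must multiplication by \<open>c\<close>; hence the minimum here and
        the maximum of the indices.\<close>
      define e' where "e' = min d (e / 2 / (cmod c + 1))"
      have "e' > 0"
        using d(1) that by (simp add: e'_def add_nonneg_pos)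
      then obtain g where g: "g \<in> W" "?p (max m n) (f - g) < e'"
        using clD(2)[OF f] by blast
      have gX: "g \<in> HTb \<Theta> N" and Lg: "L g = fscale c g"
        using g(1) by (simp_all add: W_def)
      note fg = diff_mem[OF fX gX]
      have "?p m (f - g) < d" and pn: "?p n (f - g) < e / 2 / (cmod c + 1)"
        using p_mono[OF fg, of m "max m n"] p_mono[OF fg, of n "max m n"] g(2) by (simp_all add: e'_def)
      then have 1: "?p n (L (f - g)) < e / 2"
        using d(2)[OF fg] by blast
      have "cmod c * ?p n (f - g) \<le> ?p n (f - g) * (cmod c + 1)"
        using p_nonneg[OF fg, of n] unfolding distrib_left mult.commute[of "cmod c"] by simp
      also have "\<dots> < e / 2"
        by (rule mult_less_if_less_divide[OF pn]) (simp add: add_nonneg_pos)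
      finally have 2: "?p n (fscale c (f - g)) < e / 2"
        using seminorm_scale[OF fg, of "real (Suc n)" c] by simp
      have "?r = L (f - g) - fscale c (f - g)"
        unfolding L_diff[OF fX gX] Lg by (simp only: cfun.scale_right_diff_distrib) simp
      then have "?p n ?r \<le> ?p n (L (f - g)) + ?p n (fscale c (f - g))"
        using p_diff[OF L_mem[OF fg] cfun.subspace_scale[OF subspace_HTb fg], of n c] by (simp only:)
      with 1 2 show ?thesis
        by simp
    qed
    \<comment> \<open>All seminorms of the difference vanish, and point evaluations are dominated by
      seminorms.\<close>
    have "?r x = 0" for x
    proof -
      obtain n where n: "\<sigma> * norm x \<le> real n"
        using real_arch_simple by blast
      have "cmod (?r x) \<le> HTb_seminorm N (\<sigma> * norm x) ?r"
        by (rule eval_le_seminorm[OF rX])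
      also have "\<dots> \<le> HTb_seminorm N (real (Suc n)) ?r"
        using n sigma_ge_1 by (intro seminorm_mono rX) simp_all
      also have "\<dots> \<le> 0"
        by (rule field_le_epsilon) (unfold add_0, rule small)
      finally show ?thesis
        by simp
    qed
    then have "L f = fscale c f"
      by (intro ext) simp
    with fX show "f \<in> W"
      by (simp add: W_def)
  qed
  have expo: "expo \<phi> \<in> W" if "\<phi> \<in> cdual" for \<phi>
    using expo_mem[OF that] L_expo[OF that] c[OF that] by (simp add: W_def)
  have "W = HTb \<Theta> N"
  proof (rule closed_subspace_eq_HTb[OF WX sub closed cdual_0])
    show "\<exists>\<epsilon>>0. \<forall>z. cmod z < \<epsilon> \<longrightarrow> expo (0 + cmult z \<psi>) \<in> W" if "\<psi> \<in> cdual" for \<psi>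
      using expo[OF cdual_add[OF cdual_0 cdual_cmult[OF that]]] zero_less_one by blast
  qed
  with f show ?thesis
    by (auto simp: W_def)
qed

text \<open>Liouville's theorem is used on the line through 0 and a functional with another
  eigenvalue: for values outside the disc it is applied to the eigenvalue itself, for values inside
  to its reciprocal, which would otherwise be entire and bounded by 1.\<close>

lemma eigenvalue_ranges:
  assumes "\<not> (\<exists>c. \<forall>f\<in>HTb \<Theta> N. L f = fscale c f)"
  shows "\<exists>\<phi>\<in>cdual. cmod (eigenvalue \<phi>) < 1" and "\<exists>\<phi>\<in>cdual. cmod (eigenvalue \<phi>) > 1"
proof -
  obtain \<psi> where \<psi>: "\<psi> \<in> cdual" "eigenvalue \<psi> \<noteq> eigenvalue 0"
    using assms scalar_if_eigenvalue_constant by metis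
  let ?h = "\<lambda>z. eigenvalue (0 + cmult z \<psi>)"
  have "cmult 1 \<psi> = \<psi>" "cmult 0 \<psi> = 0"
    by (rule blinfun_eqI, simp)+
  then have ne: "?h 1 \<noteq> ?h 0"
    using \<psi>(2) by simp
  have hol: "?h holomorphic_on UNIV"
    by (rule eigenvalue_holomorphic[OF cdual_0 \<psi>(1)])
  have mem: "0 + cmult z \<psi> \<in> cdual" for z
    by (intro cdual_add cdual_0 cdual_cmult \<psi>)
  show "\<exists>\<phi>\<in>cdual. cmod (eigenvalue \<phi>) > 1"
  proof (rule ccontr)
    assume "\<not> ?thesis"
    then have "cmod (?h z) \<le> 1" for z
      using mem by (auto simp: not_less)
    then have "bounded (range ?h)"
      unfolding bounded_iff by blast
    from Liouville_theorem[OF hol this] obtain y where "\<forall>z\<in>UNIV. ?h z = y"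
      unfolding constant_on_def by blast
    with ne show False
      by simp
  qed
  show "\<exists>\<phi>\<in>cdual. cmod (eigenvalue \<phi>) < 1"
  proof (rule ccontr)
    assume "\<not> ?thesis"
    then have ge: "cmod (?h z) \<ge> 1" for z
      using mem by (auto simp: not_less)
    have nz: "?h z \<noteq> 0" for z
      using ge[of z] by auto
    have "cmod (inverse (?h z)) \<le> 1" for z
      using ge[of z] by (simp add: norm_inverse inverse_le_1_iff)
    then have "bounded (range (\<lambda>z. inverse (?h z)))"
      unfolding bounded_iff by blast
    moreover have "(\<lambda>z. inverse (?h z)) holomorphic_on UNIV"
      by (rule holomorphic_on_inverse[OF hol]) (use nz in auto)
    ultimately have "(\<lambda>z. inverse (?h z)) constant_on UNIV"
      using Liouville_theorem by blast
    then obtain y where "\<forall>z\<in>UNIV. inverse (?h z) = y"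
      unfolding constant_on_def by blast
    then have "inverse (?h 1) = inverse (?h 0)"
      by simp
    with ne show False
      by simp
  qed
qed

section \<open>Iterates and the two dense subspaces\<close>

lemma L_pow_mem: "f \<in> HTb \<Theta> N \<Longrightarrow> (L ^^ k) f \<in> HTb \<Theta> N"
  by (induction k) (auto intro: L_mem)

lemma L_pow_0: "(L ^^ k) 0 = 0"
  by (induction k) (simp_all only: funpow.simps comp_apply id_apply L_0)

lemma L_pow_add: "f \<in> HTb \<Theta> N \<Longrightarrow> g \<in> HTb \<Theta> N \<Longrightarrow> (L ^^ k) (f + g) = (L ^^ k) f + (L ^^ k) g"
  by (induction k) (auto simp: L_add L_pow_mem)

lemma L_pow_scale: "f \<in> HTb \<Theta> N \<Longrightarrow> (L ^^ k) (fscale c f) = fscale c ((L ^^ k) f)"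
  by (induction k) (auto simp: L_scale L_pow_mem)

text \<open>Openness of \<open>S\<close> and continuity of the eigenvalue on lines put the
  exponentials of a disc on each line through one good \<phi> into \<open>V\<close>.\<close>

lemma dense_if_expo_open:
  assumes V: "V \<subseteq> HTb \<Theta> N" "cfun.subspace V"
    and S: "open S" "\<exists>\<phi>\<in>cdual. eigenvalue \<phi> \<in> S"
    and expo: "\<And>\<phi>. \<phi> \<in> cdual \<Longrightarrow> eigenvalue \<phi> \<in> S \<Longrightarrow> expo \<phi> \<in> V"
  shows "cl V = HTb \<Theta> N"
proof -
  obtain \<phi> where \<phi>: "\<phi> \<in> cdual" "eigenvalue \<phi> \<in> S"
    using S by blast
  have clV: "cl V \<subseteq> HTb \<Theta> N"
    using clD(1) by blast
  have "\<exists>\<epsilon>>0. \<forall>z. cmod z < \<epsilon> \<longrightarrow> expo (\<phi> + cmult z \<psi>) \<in> cl V" if \<psi>: "\<psi> \<in> cdual" for \<psi>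
  proof -
    obtain \<epsilon> where "\<epsilon> > 0" "\<And>z. cmod z < \<epsilon> \<Longrightarrow> eigenvalue (\<phi> + cmult z \<psi>) \<in> S"
      using eigenvalue_open_on_lines[OF \<phi>(1) \<psi> S(1) \<phi>(2)] by blast
    then have "\<forall>z. cmod z < \<epsilon> \<longrightarrow> expo (\<phi> + cmult z \<psi>) \<in> cl V"
      using expo[OF cdual_add[OF \<phi>(1) cdual_cmult[OF \<psi>]]] cl_superset[OF V(1)] by blast
    with \<open>\<epsilon> > 0\<close> show ?thesis
      by blast
  qed
  then show ?thesis
    by (rule closed_subspace_eq_HTb[OF clV cl_subspace[OF V] cl_cl[OF V(1)] \<phi>(1)])
qed

definition vanishing_orbits :: "('a \<Rightarrow> complex) set"
  where "vanishing_orbits = {f \<in> HTb \<Theta> N. \<forall>n. (\<lambda>k. HTb_seminorm N (real (Suc n)) ((L ^^ k) f)) \<longlonglongrightarrow> 0}"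

text \<open>\<open>s k\<close> is any preimage under the \<open>k\<close>-th iterate; consecutive
  members need not be linked by \<open>L\<close>. This is the form in which
  \<open>hypercyclic_vector\<close> uses backward orbits.\<close>

definition vanishing_backward_orbits :: "('a \<Rightarrow> complex) set"
  where "vanishing_backward_orbits = {f \<in> HTb \<Theta> N. \<exists>s. (\<forall>k. s k \<in> HTb \<Theta> N \<and> (L ^^ k) (s k) = f) \<and>
    (\<forall>n. (\<lambda>k. HTb_seminorm N (real (Suc n)) (s k)) \<longlonglongrightarrow> 0)}"

lemma seminorm_tendsto_add:
  assumes "\<And>k. s k \<in> HTb \<Theta> N" "\<And>k. t k \<in> HTb \<Theta> N" "\<rho> \<ge> 0"
    and "(\<lambda>k. HTb_seminorm N \<rho> (s k)) \<longlonglongrightarrow> 0" "(\<lambda>k. HTb_seminorm N \<rho> (t k)) \<longlonglongrightarrow> 0"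
  shows "(\<lambda>k. HTb_seminorm N \<rho> (s k + t k)) \<longlonglongrightarrow> 0"
proof (rule Lim_null_comparison)
  show "(\<lambda>k. HTb_seminorm N \<rho> (s k) + HTb_seminorm N \<rho> (t k)) \<longlonglongrightarrow> 0"
    using tendsto_add[OF assms(4,5)] by simp
  show "\<forall>\<^sub>F k in sequentially. norm (HTb_seminorm N \<rho> (s k + t k)) \<le> HTb_seminorm N \<rho> (s k) + HTb_seminorm N \<rho> (t k)"
    using seminorm_nonneg[OF add_mem[OF assms(1,2)] assms(3)] seminorm_add[OF assms(1,2,3)]
    by (intro always_eventually allI) (simp only: real_norm_def abs_of_nonneg)
qed

lemma seminorm_tendsto_scale:
  assumes "\<And>k. s k \<in> HTb \<Theta> N" "\<rho> \<ge> 0" "(\<lambda>k. HTb_seminorm N \<rho> (s k)) \<longlonglongrightarrow> 0"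
  shows "(\<lambda>k. HTb_seminorm N \<rho> (fscale c (s k))) \<longlonglongrightarrow> 0"
  unfolding seminorm_scale[OF assms(1,2)] by (rule tendsto_mult_right_zero[OF assms(3)])

lemma seminorm_tendsto_power:
  assumes "f \<in> HTb \<Theta> N" "\<rho> \<ge> 0" "cmod c < 1"
  shows "(\<lambda>k. HTb_seminorm N \<rho> (fscale (c ^ k) f)) \<longlonglongrightarrow> 0"
  unfolding seminorm_scale[OF assms(1,2)] norm_power
  by (intro tendsto_mult_left_zero LIMSEQ_realpow_zero) (use assms in simp_all)

lemma vanishing_orbits_subspace: "cfun.subspace vanishing_orbits"
proof (rule cfun.subspaceI)
  show "0 \<in> vanishing_orbits"
    by (simp only: vanishing_orbits_def mem_Collect_eq zero_mem L_pow_0 seminorm_0 tendsto_const simp_thms)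
next
  fix f g assume fg: "f \<in> vanishing_orbits" "g \<in> vanishing_orbits"
  then have X: "f \<in> HTb \<Theta> N" "g \<in> HTb \<Theta> N"
    by (simp_all add: vanishing_orbits_def)
  have "(\<lambda>k. HTb_seminorm N (real (Suc n)) ((L ^^ k) (f + g))) \<longlonglongrightarrow> 0" for n
    unfolding L_pow_add[OF X] using fg
    by (intro seminorm_tendsto_add L_pow_mem X) (simp_all add: vanishing_orbits_def)
  then show "f + g \<in> vanishing_orbits"
    unfolding vanishing_orbits_def using add_mem[OF X] by blast
next
  fix c f assume f: "f \<in> vanishing_orbits"
  then have X: "f \<in> HTb \<Theta> N"
    by (simp add: vanishing_orbits_def)
  have "(\<lambda>k. HTb_seminorm N (real (Suc n)) ((L ^^ k) (fscale c f))) \<longlonglongrightarrow> 0" for n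
    unfolding L_pow_scale[OF X] using f
    by (intro seminorm_tendsto_scale L_pow_mem X) (simp_all add: vanishing_orbits_def)
  then show "fscale c f \<in> vanishing_orbits"
    unfolding vanishing_orbits_def using cfun.subspace_scale[OF subspace_HTb X] by blast
qed

lemma vanishing_backward_orbitsE:
  assumes "f \<in> vanishing_backward_orbits"
  obtains s where "f \<in> HTb \<Theta> N" "\<And>k. s k \<in> HTb \<Theta> N" "\<And>k. (L ^^ k) (s k) = f"
    "\<And>n. (\<lambda>k. HTb_seminorm N (real (Suc n)) (s k)) \<longlonglongrightarrow> 0"
  using assms unfolding vanishing_backward_orbits_def by blast

lemma vanishing_backward_orbitsI:
  assumes "f \<in> HTb \<Theta> N" "\<And>k. s k \<in> HTb \<Theta> N" "\<And>k. (L ^^ k) (s k) = f"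
    "\<And>n. (\<lambda>k. HTb_seminorm N (real (Suc n)) (s k)) \<longlonglongrightarrow> 0"
  shows "f \<in> vanishing_backward_orbits"
  unfolding vanishing_backward_orbits_def
  by (intro CollectI conjI assms(1) exI[of _ s] allI assms(2-4))

lemma vanishing_backward_orbits_subspace: "cfun.subspace vanishing_backward_orbits"
proof (rule cfun.subspaceI)
  show "0 \<in> vanishing_backward_orbits"
    by (rule vanishing_backward_orbitsI[of 0 "\<lambda>_. 0"])
      (simp_all only: zero_mem L_pow_0 seminorm_0 tendsto_const)
next
  fix f g assume fg: "f \<in> vanishing_backward_orbits" "g \<in> vanishing_backward_orbits"
  obtain s where s: "f \<in> HTb \<Theta> N" "\<And>k. s k \<in> HTb \<Theta> N" "\<And>k. (L ^^ k) (s k) = f"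
    "\<And>n. (\<lambda>k. HTb_seminorm N (real (Suc n)) (s k)) \<longlonglongrightarrow> 0"
    using fg(1) by (rule vanishing_backward_orbitsE) (rule that)
  obtain t where t: "g \<in> HTb \<Theta> N" "\<And>k. t k \<in> HTb \<Theta> N" "\<And>k. (L ^^ k) (t k) = g"
    "\<And>n. (\<lambda>k. HTb_seminorm N (real (Suc n)) (t k)) \<longlonglongrightarrow> 0"
    using fg(2) by (rule vanishing_backward_orbitsE) (rule that)
  show "f + g \<in> vanishing_backward_orbits"
    by (rule vanishing_backward_orbitsI[where s = "\<lambda>k. s k + t k"])
      (simp_all only: s t add_mem L_pow_add seminorm_tendsto_add of_nat_0_le_iff)
next
  fix c f assume f: "f \<in> vanishing_backward_orbits"
  obtain s where s: "f \<in> HTb \<Theta> N" "\<And>k. s k \<in> HTb \<Theta> N" "\<And>k. (L ^^ k) (s k) = f"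
    "\<And>n. (\<lambda>k. HTb_seminorm N (real (Suc n)) (s k)) \<longlonglongrightarrow> 0"
    using f by (rule vanishing_backward_orbitsE) (rule that)
  show "fscale c f \<in> vanishing_backward_orbits"
    by (rule vanishing_backward_orbitsI[where s = "\<lambda>k. fscale c (s k)"])
      (simp_all only: s cfun.subspace_scale[OF subspace_HTb] L_pow_scale seminorm_tendsto_scale of_nat_0_le_iff)
qed

lemma hypercyclic_L:
  fixes \<Phi> :: "('a \<Rightarrow>\<^sub>L complex) set"
  assumes \<Phi>: "countable \<Phi>" "\<Phi> \<subseteq> cdual"
    and dense: "\<And>\<phi> e. \<phi> \<in> cdual \<Longrightarrow> e > 0 \<Longrightarrow> \<exists>\<eta>\<in>\<Phi>. norm (\<eta> - \<phi>) < e"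
    and nonscalar: "\<not> (\<exists>c. \<forall>f\<in>HTb \<Theta> N. L f = fscale c f)"
  shows "hypercyclic (HTb_topology \<Theta> N) L"
proof -
  obtain D where D: "countable D" "D \<noteq> {}" "D \<subseteq> HTb \<Theta> N" "cl D = HTb \<Theta> N"
    using HTb_separable[OF \<Phi> dense] by blast
  have A: "vanishing_orbits \<subseteq> HTb \<Theta> N" and B: "vanishing_backward_orbits \<subseteq> HTb \<Theta> N"
    by (auto simp: vanishing_orbits_def vanishing_backward_orbits_def)
  have clA: "cl vanishing_orbits = HTb \<Theta> N"
  proof (rule dense_if_expo_open[OF A vanishing_orbits_subspace, of "ball 0 1"])
    show "\<exists>\<phi>\<in>cdual. eigenvalue \<phi> \<in> ball 0 1"
      using eigenvalue_ranges(1)[OF nonscalar] by simp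
    fix \<phi> assume \<phi>: "\<phi> \<in> cdual" "eigenvalue \<phi> \<in> ball 0 1"
    then show "expo \<phi> \<in> vanishing_orbits"
      by (simp add: vanishing_orbits_def expo_mem L_pow_expo seminorm_tendsto_power)
  qed simp
  have clB: "cl vanishing_backward_orbits = HTb \<Theta> N"
  proof (rule dense_if_expo_open[OF B vanishing_backward_orbits_subspace, of "- cball 0 1"])
    show "\<exists>\<phi>\<in>cdual. eigenvalue \<phi> \<in> - cball 0 1"
      using eigenvalue_ranges(2)[OF nonscalar] by (simp add: not_le)
    fix \<phi> assume \<phi>: "\<phi> \<in> cdual" "eigenvalue \<phi> \<in> - cball 0 1"
    then have gt: "cmod (eigenvalue \<phi>) > 1"
      by simp
    show "expo \<phi> \<in> vanishing_backward_orbits"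
    \<comment> \<open>An eigenvalue outside the closed disc can be inverted: dividing by its
      \<open>k\<close>-th power gives a preimage under the \<open>k\<close>-th iterate, and these
      preimages tend to 0.\<close>
    proof (rule vanishing_backward_orbitsI[where s = "\<lambda>k. fscale (inverse (eigenvalue \<phi>) ^ k) (expo \<phi>)"])
      show "(L ^^ k) (fscale (inverse (eigenvalue \<phi>) ^ k) (expo \<phi>)) = expo \<phi>" for k
      proof -
        have "eigenvalue \<phi> \<noteq> 0"
          using gt by auto
        then have "inverse (eigenvalue \<phi>) ^ k * eigenvalue \<phi> ^ k = 1"
          by (simp flip: power_mult_distrib)
        then show ?thesis
          by (simp add: L_pow_scale[OF expo_mem[OF \<phi>(1)]] L_pow_expo[OF \<phi>(1)])
      qed
      have "cmod (inverse (eigenvalue \<phi>)) < 1"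
        using gt by (simp add: norm_inverse inverse_less_1_iff)
      then show "(\<lambda>k. HTb_seminorm N (real (Suc n)) (fscale (inverse (eigenvalue \<phi>) ^ k) (expo \<phi>))) \<longlonglongrightarrow> 0" for n
        by (intro seminorm_tendsto_power expo_mem \<phi>(1)) simp
    qed (intro expo_mem cfun.subspace_scale[OF subspace_HTb] \<phi>(1))+
  qed (rule open_Compl[OF closed_cball])
  have "\<exists>x\<in>HTb \<Theta> N. \<forall>y\<in>HTb \<Theta> N. \<forall>n. \<forall>e>0. \<exists>k. HTb_seminorm N (real (Suc n)) ((L ^^ k) x - y) < e"
  proof (rule hypercyclic_vector[OF HTb_complete L_mem L_add L_cont D A clA _ B clB])
    show "(\<lambda>k. HTb_seminorm N (real (Suc n)) ((L ^^ k) a)) \<longlonglongrightarrow> 0" if "a \<in> vanishing_orbits" for a n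
      using that by (simp add: vanishing_orbits_def)
    show "\<exists>s. (\<forall>k. s k \<in> HTb \<Theta> N \<and> (L ^^ k) (s k) = b) \<and>
        (\<forall>n. (\<lambda>k. HTb_seminorm N (real (Suc n)) (s k)) \<longlonglongrightarrow> 0)" if "b \<in> vanishing_backward_orbits" for b
      using that by (simp add: vanishing_backward_orbits_def)
  qed
  then obtain x where x: "x \<in> HTb \<Theta> N" and
    orbit: "\<And>y n e. y \<in> HTb \<Theta> N \<Longrightarrow> e > 0 \<Longrightarrow> \<exists>k. HTb_seminorm N (real (Suc n)) ((L ^^ k) x - y) < e"
    by blast
  have "y \<in> HTb_topology \<Theta> N closure_of range (\<lambda>n. (L ^^ n) x)" if y: "y \<in> HTb \<Theta> N" for y
    unfolding in_closure_of topspace_HTb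
  proof (intro conjI y allI impI, elim conjE)
    fix U assume "y \<in> U" "openin (HTb_topology \<Theta> N) U"
    then obtain n e where U: "e > 0" "{g \<in> HTb \<Theta> N. HTb_seminorm N (real (Suc n)) (g - y) < e} \<subseteq> U"
      using openin_imp_ball by blast
    obtain k where "HTb_seminorm N (real (Suc n)) ((L ^^ k) x - y) < e"
      using orbit[OF y U(1)] by blast
    with U(2) L_pow_mem[OF x] show "\<exists>z. z \<in> range (\<lambda>n. (L ^^ n) x) \<and> z \<in> U"
      by blast
  qed
  then show ?thesis
    unfolding hypercyclic_def topspace_HTb
    using x closure_of_subset_topspace[of "HTb_topology \<Theta> N"] topspace_HTb by blast
qed

end

theorem theorem2p6:
  fixes \<Theta> :: "nat \<Rightarrow> ('a::complex_banach \<Rightarrow> complex) set"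
    and N :: "nat \<Rightarrow> ('a \<Rightarrow> complex) \<Rightarrow> real"
    and L :: "('a \<Rightarrow> complex) \<Rightarrow> ('a \<Rightarrow> complex)"
  assumes "separable_space (top_of_set (cdual :: ('a \<Rightarrow>\<^sub>L complex) set))"
    and "pi1_holomorphy_type \<Theta> N"
    and "convolution_operator \<Theta> N L"
    and "\<not> (\<exists>c. \<forall>f\<in>HTb \<Theta> N. L f = fscale c f)"
  shows "hypercyclic (HTb_topology \<Theta> N) L"
proof -
  have type: "holomorphy_type \<Theta> N"
    and finite_type: "\<And>m. cpoly_finite_type m \<subseteq> \<Theta> m"
    and closure: "\<And>m. Metric_space.mtopology (\<Theta> m) (norm_dist (\<Theta> m) (N m)) closure_of cpoly_finite_type m = \<Theta> m"
    using assms(2) by (auto simp: pi1_holomorphy_type_def)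
  obtain K where K: "K > 0" "\<And>\<phi> b m. \<phi> \<in> cdual \<Longrightarrow> m \<ge> 1 \<Longrightarrow>
      N m (\<lambda>x. blinfun_apply \<phi> x ^ m * b) \<le> K ^ m * norm \<phi> ^ m * cmod b"
    using assms(2) unfolding pi1_holomorphy_type_def by blast
  have banach: "\<And>m. banach_function_space (\<Theta> m) (N m)" and sub: "\<And>m. \<Theta> m \<subseteq> cpoly m"
    and const: "\<And>c. N 0 (\<lambda>_. c) = cmod c"
    using type by (auto simp: holomorphy_type_def)
  obtain \<sigma> where \<sigma>: "\<sigma> \<ge> 1" "\<forall>m. \<forall>k\<le>m. \<forall>a. \<forall>P\<in>\<Theta> m. dhat k P a \<in> \<Theta> k \<and>
      N k (fscale (1 / fact k) (dhat k P a)) \<le> \<sigma> ^ m * N m P * norm a ^ (m - k)"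
    using type unfolding holomorphy_type_def by (elim conjE exE) (rule that)
  have subspace: "cfun.subspace (\<Theta> m)" for m
    using banach[of m] by (simp add: banach_function_space_def normed_function_space_def)
  interpret convolution \<Theta> N \<sigma> K L
  proof
    show "taylor_coeff P a k \<in> \<Theta> k" if "k \<le> m" "P \<in> \<Theta> m" for k m P a
      using \<sigma>(2) that unfolding taylor_coeff_def by (intro cfun.subspace_scale[OF subspace]) simp
    show "N k (taylor_coeff P a k) \<le> \<sigma> ^ m * N m P * norm a ^ (m - k)" if "k \<le> m" "P \<in> \<Theta> m" for k m P a
      using \<sigma>(2) that unfolding taylor_coeff_def by simp
    \<comment> \<open>For \<open>m = 0\<close> the norm of a constant is its modulus; (a1) covers
      the remaining degrees.\<close>
    show "N m (\<lambda>x. blinfun_apply \<phi> x ^ m) \<le> K ^ m * norm \<phi> ^ m" if "\<phi> \<in> cdual" for \<phi> m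
      using K(2)[OF that, of m 1] const[of 1] by (cases "m = 0") simp_all
    show "\<exists>Q\<in>cpoly_finite_type m. N m (P - Q) < e" if "P \<in> \<Theta> m" "e > 0" for P m e
    proof -
      interpret M: Metric_space "\<Theta> m" "norm_dist (\<Theta> m) (N m)"
        using banach[of m] by (simp add: banach_function_space_def Metric_space_norm_dist)
      have "P \<in> M.mtopology closure_of cpoly_finite_type m"
        using that closure by simp
      then obtain Q where "Q \<in> cpoly_finite_type m" "Q \<in> M.mball P e"
        using \<open>e > 0\<close> unfolding M.metric_closure_of by blast
      then show ?thesis
        by (auto simp: M.mball_def norm_dist_def)
    qed
  qed (fact banach sub const \<sigma>(1) K(1) finite_type assms(3))+
  obtain \<Phi> :: "('a \<Rightarrow>\<^sub>L complex) set" where \<Phi>: "countable \<Phi>" "\<Phi> \<subseteq> cdual"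
    and cl: "top_of_set cdual closure_of \<Phi> = cdual"
    using assms(1) by (auto simp: separable_space_def)
  have "\<exists>\<eta>\<in>\<Phi>. norm (\<eta> - \<phi>) < e" if "\<phi> \<in> cdual" "e > 0" for \<phi> e
  proof -
    have "\<phi> \<in> top_of_set cdual closure_of \<Phi>"
      using cl that by simp
    \<comment> \<open>Balls intersected with the dual are open in the subspace topology, so
      topological density of \<Phi> becomes density in the operator norm.\<close>
    moreover have "openin (top_of_set cdual) (cdual \<inter> ball \<phi> e)" "\<phi> \<in> cdual \<inter> ball \<phi> e"
      using that by (auto intro: openin_open_Int)
    ultimately obtain \<eta> where "\<eta> \<in> \<Phi>" "\<eta> \<in> ball \<phi> e"
      unfolding in_closure_of by blast
    then show ?thesis
      by (auto simp: dist_norm norm_minus_commute)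
  qed
  then show ?thesis
    using \<Phi> assms(4) by (intro hypercyclic_L)
qed

end
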